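(* Let $\Phi,\lambda,f,\mathcal D,F,\Phi^{(1)},\Phi^{(2)}$ be as in the context, and let $Z,\tilde Z$ be independent with density $f$. For Borel $A\subset\mathbb{R}^2$ let $M^{(i)}(A)=\mathbb E\big[\sum_{a\in\Phi^{(i)}}\mathbf 1_{\{\hat a\in A\}}\big]$, $i=1,2$, and let $\mathcal S(A)$ be the Lebesgue measure of $A$. Define $$P_{\mathcal D}(\lambda,f)=2\pi\lambda\int_0^\infty\mathbb E\Big[e^{-\lambda F(s,Z,\tilde Z)}\mathbf 1_{\{(Z,\tilde Z)\in\mathcal D\}}\Big]s\,ds.$$ Then $P_{\mathcal D}(\lambda,f)\in[0,1]$ and for every Borel $A\subset\mathbb{R}^2$, $$M^{(2)}(A)=P_{\mathcal D}(\lambda,f)\,\lambda\,\mathcal S(A),\qquad M^{(1)}(A)=\big(1-P_{\mathcal D}(\lambda,f)\big)\lambda\,\mathcal S(A).$$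
   Context: $\mathbb{H}^3=\{(x,y,z):z>0\}$; for $a=(x,y,z)$, $\hat a=(x,y)$. $d_{\mathbb{H}^3}(a,b)=\operatorname{acosh}\big(\frac{|\hat a-\hat b|^2}{2z\tilde z}+\frac12(\frac{z}{\tilde z}+\frac{\tilde z}{z})\big)$ for marks $z,\tilde z$. $\Phi$ is a Poisson point process on $\mathbb{R}^2\times(0,\infty)$ with intensity $\lambda\,dx\,dy\,f(z)dz$, $\lambda>0$, $f$ a probability density on $(0,\infty)$. $\mathcal D\subset(0,\infty)^2$ is Borel and symmetric. $a\xrightarrow{\phi}b$: $b$ is the unique minimizer of $d_{\mathbb{H}^3}(a,\cdot)$ on $\phi\setminus\{a\}$. $a\overset{\phi,\mathcal D}{\leftrightarrow}b$: $a\xrightarrow{\phi}b$, $b\xrightarrow{\phi}a$, and marks $(z,\tilde z)\in\mathcal D$. $\Phi^{(2)}=\{a\in\Phi:\exists b\in\Phi\setminus\{a\},a\overset{\Phi,\mathcal D}{\leftrightarrow}b\}$, $\Phi^{(1)}=\Phi\setminus\Phi^{(2)}$. $F(s,z,\tilde z)$: with $R=\operatorname{acosh}\big(\frac{s^2}{2z\tilde z}+\frac12(\frac{z}{\tilde z}+\frac{\tilde z}{z})\big)$, $d=\sqrt{s^2+(z-\tilde z)^2\cosh^2R}$, $r=z\sinh R$, $\tilde r=\tilde z\sinh R$, $c=z\cosh R$, $\tilde c=\tilde z\cosh R$, $h=\frac{(\tilde r-r+d)(r+\tilde r-d)}{2d}$, $\tilde h=\frac{(r-\tilde r+d)(r+\tilde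 r-d)}{2d}$, $\delta=\frac\pi2-\arcsin\frac{\tilde c-c}{d}$, $\tilde\delta=\frac\pi2-\arcsin\frac{c-\tilde c}{d}$, $F(s,z,\tilde z)=\pi\int_{-r}^{r}f(w+c)(r^2-w^2)dw+\pi\int_{-\tilde r}^{\tilde r}f(w+\tilde c)(\tilde r^2-w^2)dw-\int_{r-h}^{r}\int_0^{2\pi}\int_0^{\sqrt{r^2-w^2}}f(c+w\cos\delta-\rho\cos\theta\sin\delta)\rho\,d\rho\,d\theta\,dw-\int_{\tilde r-\tilde h}^{\tilde r}\int_0^{2\pi}\int_0^{\sqrt{\tilde r^2-w^2}}f(\tilde c+w\cos\tilde\delta-\rho\cos\theta\sin\tilde\delta)\rho\,d\rho\,d\theta\,dw$. *)

theory Defs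
  imports "HOL-Probability.Probability"
begin

text \<open>Points of the upper half space H^3 are represented as ((x,y),z); the
  horizontal projection is fst, the mark (height) is snd.\<close>

type_synonym pt = "(real \<times> real) \<times> real"

definition dH :: "pt \<Rightarrow> pt \<Rightarrow> real" where
  "dH a b = arcosh ((dist (fst a) (fst b))\<^sup>2 / (2 * snd a * snd b)
                    + (snd a / snd b + snd b / snd a) / 2)"

definition nn_to :: "pt set \<Rightarrow> pt \<Rightarrow> pt \<Rightarrow> bool" where
  "nn_to \<phi> a b \<longleftrightarrow> b \<in> \<phi> \<and> b \<noteq> a \<and> (\<forall>c\<in>\<phi> - {a, b}. dH a b < dH a c)"

definition mutual_nn :: "pt set \<Rightarrow> (real \<times> real) set \<Rightarrow> pt \<Rightarrow> pt \<Rightarrow> bool" where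
  "mutual_nn \<phi> D a b \<longleftrightarrow> nn_to \<phi> a b \<and> nn_to \<phi> b a \<and> (snd a, snd b) \<in> D"

definition Phi2 :: "pt set \<Rightarrow> (real \<times> real) set \<Rightarrow> pt set" where
  "Phi2 \<phi> D = {a \<in> \<phi>. \<exists>b \<in> \<phi> - {a}. mutual_nn \<phi> D a b}"

definition Phi1 :: "pt set \<Rightarrow> (real \<times> real) set \<Rightarrow> pt set" where
  "Phi1 \<phi> D = \<phi> - Phi2 \<phi> D"

definition poisson_pp :: "'w measure \<Rightarrow> ('w \<Rightarrow> 'p set) \<Rightarrow> 'p measure \<Rightarrow> bool" where
  "poisson_pp M \<Phi> \<mu> \<longleftrightarrow> prob_space M \<and>
     (\<forall>\<omega>\<in>space M. \<Phi> \<omega> \<subseteq> space \<mu>) \<and>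
     (\<forall>B\<in>sets \<mu>. emeasure \<mu> B < \<infinity> \<longrightarrow>
        (AE \<omega> in M. finite (\<Phi> \<omega> \<inter> B)) \<and>
        (\<lambda>\<omega>. card (\<Phi> \<omega> \<inter> B)) \<in> measurable M (count_space UNIV) \<and>
        (\<forall>k::nat. measure M {\<omega>\<in>space M. card (\<Phi> \<omega> \<inter> B) = k}
              = (measure \<mu> B) ^ k / fact k * exp (- measure \<mu> B))) \<and>
     (\<forall>(I::nat set) B. finite I \<longrightarrow> (\<forall>i\<in>I. B i \<in> sets \<mu> \<and> emeasure \<mu> (B i) < \<infinity>) \<longrightarrow>
        disjoint_family_on B I \<longrightarrow>
        prob_space.indep_vars M (\<lambda>_. count_space UNIV) (\<lambda>i \<omega>. card (\<Phi> \<omega> \<inter> B i)) I)"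

definition mark_measure :: "(real \<Rightarrow> real) \<Rightarrow> real measure" where
  "mark_measure f = density lborel (\<lambda>z. ennreal (f z * indicator {0<..} z))"

definition intensity :: "real \<Rightarrow> (real \<Rightarrow> real) \<Rightarrow> pt measure" where
  "intensity lam f = scale_measure (ennreal lam) ((lborel \<Otimes>\<^sub>M lborel) \<Otimes>\<^sub>M mark_measure f)"

definition Fun_F :: "(real \<Rightarrow> real) \<Rightarrow> real \<Rightarrow> real \<Rightarrow> real \<Rightarrow> real" where
  "Fun_F f s z z' =
    (let R = arcosh (s\<^sup>2 / (2 * z * z') + (z / z' + z' / z) / 2);
         d = sqrt (s\<^sup>2 + (z - z')\<^sup>2 * (cosh R)\<^sup>2);
         r = z * sinh R; r' = z' * sinh R;
         c = z * cosh R; c' = z' * cosh R;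
         h = (r' - r + d) * (r + r' - d) / (2 * d);
         h' = (r - r' + d) * (r + r' - d) / (2 * d);
         \<delta> = pi / 2 - arcsin ((c' - c) / d);
         \<delta>' = pi / 2 - arcsin ((c - c') / d)
     in pi * (LBINT w=-r..r. f (w + c) * (r\<^sup>2 - w\<^sup>2))
      + pi * (LBINT w=-r'..r'. f (w + c') * (r'\<^sup>2 - w\<^sup>2))
      - (LBINT w=r-h..r. (LBINT \<theta>=0..2*pi. (LBINT \<rho>=0..sqrt (r\<^sup>2 - w\<^sup>2).
            f (c + w * cos \<delta> - \<rho> * cos \<theta> * sin \<delta>) * \<rho>)))
      - (LBINT w=r'-h'..r'. (LBINT \<theta>=0..2*pi. (LBINT \<rho>=0..sqrt (r'\<^sup>2 - w\<^sup>2).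
            f (c' + w * cos \<delta>' - \<rho> * cos \<theta> * sin \<delta>') * \<rho>))))"

text \<open>P_D(lambda,f) = 2 pi lambda int_0^oo E[exp(-lambda F(s,Z,Z')) 1_D(Z,Z')] s ds,
  with Z, Z' independent with density f, so the expectation is the integral
  against the product of the mark distributions.\<close>
definition P_D :: "(real \<times> real) set \<Rightarrow> real \<Rightarrow> (real \<Rightarrow> real) \<Rightarrow> ennreal" where
  "P_D D lam f = ennreal (2 * pi * lam) *
     (\<integral>\<^sup>+ s. (\<integral>\<^sup>+ zz. ennreal (exp (- lam * Fun_F f s (fst zz) (snd zz)) * indicator D zz)
                \<partial>(mark_measure f \<Otimes>\<^sub>M mark_measure f)) * ennreal s \<partial>(restrict_space lborel {0<..}))"

definition mean_meas :: "'w measure \<Rightarrow> ('w \<Rightarrow> pt set) \<Rightarrow> (real \<times> real) set \<Rightarrow> ennreal" where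
  "mean_meas M \<Psi> A = (\<integral>\<^sup>+ \<omega>. emeasure (count_space UNIV) {a \<in> \<Psi> \<omega>. fst a \<in> A} \<partial>M)"

end

theory Submission
  imports Defs
begin

text \<open>
  For \<open>a\<close>, \<open>b\<close> in the half space let \<open>K a b\<close> be the union of the closed hyperbolic balls around \<open>a\<close>
  and \<open>b\<close> with radius the distance of \<open>a\<close> and \<open>b\<close>. Two points \<open>a \<noteq> b\<close> of \<open>\<phi>\<close> are mutual nearest
  neighbours iff \<open>\<phi> \<inter> K a b \<subseteq> {a, b}\<close>, and then \<open>b\<close> is determined by \<open>a\<close>. The mean measure of \<open>\<Phi>\<^sup>(\<^sup>2\<^sup>)\<close>
  therefore counts such pairs, and for a Poisson process with intensity measure \<open>\<mu>\<close> their expected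
  number is \<open>\<integral>\<integral> exp (- \<mu> (K a b)) \<mu>(da) \<mu>(db)\<close>. To see this, cut two disjoint sets into small cells and
  count the pairs of cells \<open>S\<close>, \<open>T\<close> that contain exactly one point each while the rest of the closure of
  \<open>\<Union>{K a b | a \<in> S, b \<in> T}\<close> contains none. The expectation is explicit by independence, and as the cells
  shrink the count increases to the number of isolated pairs, because the graph of \<open>K\<close> is closed.

  Hyperbolic balls are Euclidean balls, so \<open>K a b\<close> is a union of two balls whose intersection consists of
  two spherical caps separated by the radical plane. Fubini in coordinates adapted to these
  gives \<open>\<mu> (K a b) = \<lambda> F(s, z, z')\<close>, where \<open>s\<close> is the horizontal distance, and translation invariance
  together with polar coordinates in the plane turns the double integral into \<open>P\<^sub>D \<lambda> S(A)\<close>.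
\<close>

section \<open>Lebesgue measure under rotations and in polar coordinates\<close>

lemma borel_measurable_fst [measurable (raw)]:
  fixes f :: "'a \<Rightarrow> 'b::topological_space \<times> 'c::topological_space"
  assumes "f \<in> borel_measurable M"
  shows "(\<lambda>x. fst (f x)) \<in> borel_measurable M"
  by (rule measurable_compose[OF assms borel_measurable_continuous_onI]) (intro continuous_intros)

lemma borel_measurable_snd [measurable (raw)]:
  fixes f :: "'a \<Rightarrow> 'b::topological_space \<times> 'c::topological_space"
  assumes "f \<in> borel_measurable M"
  shows "(\<lambda>x. snd (f x)) \<in> borel_measurable M"
  by (rule measurable_compose[OF assms borel_measurable_continuous_onI]) (intro continuous_intros)

lemma nn_integral_lborel_fst:
  fixes h :: "'a::euclidean_space \<times> 'b::euclidean_space \<Rightarrow> ennreal"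
  assumes "h \<in> borel_measurable borel"
  shows "(\<integral>\<^sup>+p. h p \<partial>lborel) = (\<integral>\<^sup>+x. \<integral>\<^sup>+y. h (x, y) \<partial>lborel \<partial>lborel)"
  unfolding lborel_prod[symmetric]
  by (rule lborel.nn_integral_fst[symmetric]) (use assms in \<open>simp add: lborel_prod\<close>)

lemma nn_integral_lborel_snd:
  fixes h :: "'a::euclidean_space \<times> 'b::euclidean_space \<Rightarrow> ennreal"
  assumes "h \<in> borel_measurable borel"
  shows "(\<integral>\<^sup>+p. h p \<partial>lborel) = (\<integral>\<^sup>+y. \<integral>\<^sup>+x. h (x, y) \<partial>lborel \<partial>lborel)"
  unfolding lborel_prod[symmetric]
  by (rule lborel_pair.nn_integral_snd[symmetric]) (use assms in \<open>simp add: lborel_prod\<close>)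

lemma nn_integral_lborel_translate:
  fixes h :: "'a::euclidean_space \<Rightarrow> ennreal"
  assumes "h \<in> borel_measurable borel"
  shows "(\<integral>\<^sup>+x. h (a + x) \<partial>lborel) = (\<integral>\<^sup>+x. h x \<partial>lborel)"
proof -
  have "(\<integral>\<^sup>+x. h x \<partial>lborel) = (\<integral>\<^sup>+x. h x \<partial>distr lborel borel ((+) a))"
    by (simp add: lborel_distr_plus)
  also have "\<dots> = (\<integral>\<^sup>+x. h (a + x) \<partial>lborel)"
    using assms by (intro nn_integral_distr) auto
  finally show ?thesis by simp
qed

lemma borel_measurable_orthogonal_transformation:
  fixes f :: "'a::euclidean_space \<Rightarrow> 'a"
  assumes "orthogonal_transformation f"
  shows "f \<in> borel_measurable borel"
  using orthogonal_transformation_linear[OF assms]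
  by (intro borel_measurable_continuous_onI linear_continuous_on) (simp add: linear_conv_bounded_linear)

lemma nn_integral_lborel_orthogonal_translate:
  fixes f :: "'a::euclidean_space \<Rightarrow> 'a" and h :: "'a \<Rightarrow> ennreal"
  assumes orth: "orthogonal_transformation f" and [measurable]: "h \<in> borel_measurable borel"
  shows "(\<integral>\<^sup>+x. h (f x + y) \<partial>lborel) = (\<integral>\<^sup>+x. h (f x) \<partial>lborel)"
proof -
  note [measurable] = borel_measurable_orthogonal_transformation[OF orth]
  obtain z where "y = f z" using orthogonal_transformation_surj[OF orth] by auto
  then have "f x + y = f (z + x)" for x
    using orthogonal_transformation_linear[OF orth] by (simp add: linear_add add.commute)
  then show ?thesis
    using nn_integral_lborel_translate[of "\<lambda>x. h (f x)" z] by simp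
qed

text \<open>Uniqueness of Haar measure: comparing with the unit ball \<open>B\<close>, which the orthogonal map preserves,
  through the double integral of \<open>1\<^bsub>B\<^esub>(y) h(f x + y)\<close>.\<close>

lemma nn_integral_lborel_orthogonal:
  fixes f :: "'a::euclidean_space \<Rightarrow> 'a" and h :: "'a \<Rightarrow> ennreal"
  assumes orth: "orthogonal_transformation f" and [measurable]: "h \<in> borel_measurable borel"
  shows "(\<integral>\<^sup>+x. h (f x) \<partial>lborel) = (\<integral>\<^sup>+x. h x \<partial>lborel)"
proof -
  let ?B = "cball 0 1 :: 'a set"
  note [measurable] = borel_measurable_orthogonal_transformation[OF orth]
  have ball_meas [measurable]: "(indicator ?B :: 'a \<Rightarrow> ennreal) \<in> borel_measurable borel"
    by (rule borel_measurable_indicator) simp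
  have translated_ball: "(\<integral>\<^sup>+x. indicator ?B (y - f x) \<partial>lborel) = emeasure lborel ?B" for y
  proof -
    have "(\<integral>\<^sup>+x. indicator ?B (y - f x) \<partial>lborel) = (\<integral>\<^sup>+x. indicator ?B (f x + - y) \<partial>lborel)"
      by (simp add: indicator_def norm_minus_commute)
    also have "\<dots> = (\<integral>\<^sup>+x. indicator ?B (f x) \<partial>lborel)"
      by (rule nn_integral_lborel_orthogonal_translate[OF orth ball_meas])
    also have "\<dots> = (\<integral>\<^sup>+x. indicator ?B x \<partial>lborel)"
      by (simp add: indicator_def orthogonal_transformation_norm[OF orth])
    finally show ?thesis by simp
  qed
  have "emeasure lborel ?B * (\<integral>\<^sup>+x. h (f x) \<partial>lborel)
    = (\<integral>\<^sup>+y. indicator ?B y * (\<integral>\<^sup>+x. h (f x + y) \<partial>lborel) \<partial>lborel)"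
    by (simp add: nn_integral_lborel_orthogonal_translate[OF orth] nn_integral_multc ball_meas)
  also have "\<dots> = (\<integral>\<^sup>+y. \<integral>\<^sup>+x. indicator ?B y * h (f x + y) \<partial>lborel \<partial>lborel)"
    by (intro nn_integral_cong nn_integral_cmult[symmetric]) measurable
  also have "\<dots> = (\<integral>\<^sup>+x. \<integral>\<^sup>+y. indicator ?B y * h (f x + y) \<partial>lborel \<partial>lborel)"
    by (rule lborel_pair.Fubini') measurable
  also have "\<dots> = (\<integral>\<^sup>+x. \<integral>\<^sup>+y. indicator ?B (y - f x) * h y \<partial>lborel \<partial>lborel)"
  proof (rule nn_integral_cong)
    fix x
    show "(\<integral>\<^sup>+y. indicator ?B y * h (f x + y) \<partial>lborel) = (\<integral>\<^sup>+y. indicator ?B (y - f x) * h y \<partial>lborel)"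
      using nn_integral_lborel_translate[of "\<lambda>y. indicator ?B (y - f x) * h y" "f x"] by simp
  qed
  also have "\<dots> = (\<integral>\<^sup>+y. \<integral>\<^sup>+x. indicator ?B (y - f x) * h y \<partial>lborel \<partial>lborel)"
    by (rule lborel_pair.Fubini') measurable
  also have "\<dots> = emeasure lborel ?B * (\<integral>\<^sup>+y. h y \<partial>lborel)"
    by (simp add: nn_integral_multc nn_integral_cmult translated_ball)
  finally show ?thesis
    using less_imp_neq[OF unit_ball_vol_pos[of "real DIM('a)"]]
    by (auto simp: emeasure_cball ennreal_mult_cancel_left)
qed

lemma nn_integral_UN_incseq:
  fixes A :: "nat \<Rightarrow> 'a set"
  assumes "incseq A" "\<And>n. A n \<in> sets M" "u \<in> borel_measurable M"
  shows "(\<integral>\<^sup>+x\<in>(\<Union>n. A n). u x \<partial>M) = (SUP n. \<integral>\<^sup>+x\<in>A n. u x \<partial>M)"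
  using assms SUP_emeasure_incseq[of A "density M u"]
  by (simp add: emeasure_density image_subset_iff sets.countable_UN)

lemma UN_atLeastAtMost_eq_range:
  fixes g :: "real \<Rightarrow> real"
  assumes "mono g" and "continuous_on UNIV g"
  shows "(\<Union>n. {g (- real n)..g (real n)}) = range g"
proof (intro equalityI subsetI)
  fix y assume "y \<in> (\<Union>n. {g (- real n)..g (real n)})"
  then obtain n where "g (- real n) \<le> y" "y \<le> g (real n)" by auto
  then show "y \<in> range g"
    using IVT'[of g "- real n" y "real n"] assms(2) continuous_on_subset by fastforce
next
  fix y assume "y \<in> range g"
  then obtain x n where "y = g x" "\<bar>x\<bar> \<le> real n" using real_arch_simple by blast
  then show "y \<in> (\<Union>n. {g (- real n)..g (real n)})"
    by (auto intro!: monoD[OF assms(1)] exI[of _ n])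
qed

lemma nn_integral_substitution_range:
  fixes f :: "real \<Rightarrow> ennreal"
  assumes [measurable]: "f \<in> borel_measurable borel"
    and deriv: "\<And>x. (g has_real_derivative g' x) (at x)" and cont: "continuous_on UNIV g'"
    and nonneg: "\<And>x. 0 \<le> g' x"
  shows "(\<integral>\<^sup>+x\<in>range g. f x \<partial>lborel) = (\<integral>\<^sup>+x. f (g x) * g' x \<partial>lborel)"
proof -
  let ?I = "\<lambda>n. {g (- real n)..g (real n)}" and ?J = "\<lambda>n. {- real n..real n}"
  have [measurable]: "g \<in> borel_measurable borel" "g' \<in> borel_measurable borel"
    using cont deriv DERIV_isCont
    by (auto intro!: borel_measurable_continuous_onI continuous_at_imp_continuous_on)
  have "mono g"
    using DERIV_nonneg_imp_nondecreasing deriv nonneg by (intro monoI) blast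
  moreover have "continuous_on UNIV g"
    using deriv DERIV_isCont by (intro continuous_at_imp_continuous_on) blast
  ultimately have UN_I: "(\<Union>n. ?I n) = range g" by (rule UN_atLeastAtMost_eq_range)
  have UN_J: "(\<Union>n. ?J n) = UNIV"
    using UN_atLeastAtMost_eq_range[of "\<lambda>x. x"] by (simp add: mono_def)
  have incseq: "incseq ?I" "incseq ?J" using \<open>mono g\<close> by (intro incseq_SucI; simp add: monoD)+
  have "(\<integral>\<^sup>+x\<in>?I n. f x \<partial>lborel) = (\<integral>\<^sup>+x\<in>?J n. (f (g x) * g' x) \<partial>lborel)" for n
  proof (cases "n = 0")
    case True
    then show ?thesis
      using AE_lborel_singleton[of "g 0"] AE_lborel_singleton[of 0]
      by (intro nn_integral_cong_AE) auto
  next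
    case False
    then show ?thesis
      using cont deriv nonneg by (intro nn_integral_substitution_aux) (auto intro: continuous_on_subset)
  qed
  moreover have "(\<integral>\<^sup>+x\<in>range g. f x \<partial>lborel) = (SUP n. \<integral>\<^sup>+x\<in>?I n. f x \<partial>lborel)"
    unfolding UN_I[symmetric] by (intro nn_integral_UN_incseq incseq) auto
  moreover have "(\<integral>\<^sup>+x. f (g x) * g' x \<partial>lborel) = (SUP n. \<integral>\<^sup>+x\<in>?J n. (f (g x) * g' x) \<partial>lborel)"
    using nn_integral_UN_incseq[OF incseq(2), of lborel "\<lambda>x. f (g x) * g' x"] by (simp add: UN_J)
  ultimately show ?thesis by simp
qed

lemma range_arctan: "range arctan = {- (pi / 2)<..<pi / 2}"
  using arctan_bounded arctan_tan by (auto simp: image_iff) metis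

lemma nn_integral_polar_right_half:
  fixes h :: "real \<times> real \<Rightarrow> ennreal"
  assumes [measurable]: "h \<in> borel_measurable borel"
  shows "(\<integral>\<^sup>+p\<in>{p. 0 < fst p}. h p \<partial>lborel)
    = (\<integral>\<^sup>+\<theta>\<in>{- (pi / 2)<..<pi / 2}. (\<integral>\<^sup>+\<rho>\<in>{0<..}. h (\<rho> * cos \<theta>, \<rho> * sin \<theta>) * \<rho> \<partial>lborel) \<partial>lborel)"
proof -
  have "(\<integral>\<^sup>+p\<in>{p. 0 < fst p}. h p \<partial>lborel) = (\<integral>\<^sup>+x. \<integral>\<^sup>+y. h (x, y) * indicator {0<..} x \<partial>lborel \<partial>lborel)"
    by (subst nn_integral_lborel_fst) (measurable, simp add: indicator_def)
  also have "\<dots> = (\<integral>\<^sup>+x. \<integral>\<^sup>+t. h (x, x * t) * x * indicator {0<..} x \<partial>lborel \<partial>lborel)"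
  proof (rule nn_integral_cong)
    fix x :: real
    show "(\<integral>\<^sup>+y. h (x, y) * indicator {0<..} x \<partial>lborel)
      = (\<integral>\<^sup>+t. h (x, x * t) * x * indicator {0<..} x \<partial>lborel)"
      using nn_integral_real_affine[of "\<lambda>y. h (x, y)" x 0]
      by (cases "0 < x") (simp_all add: nn_integral_cmult mult.commute)
  qed
  also have "\<dots> = (\<integral>\<^sup>+t. \<integral>\<^sup>+x. h (x, x * t) * x * indicator {0<..} x \<partial>lborel \<partial>lborel)"
    by (rule lborel_pair.Fubini') measurable
  also have "\<dots> = (\<integral>\<^sup>+t. (\<integral>\<^sup>+\<rho>\<in>{0<..}. h (\<rho> * cos (arctan t), \<rho> * sin (arctan t)) * \<rho> \<partial>lborel)
    * inverse (1 + t\<^sup>2) \<partial>lborel)"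
  proof (rule nn_integral_cong)
    fix t :: real
    define k where "k = cos (arctan t)"
    have k_simps: "0 < k" "k * t = sin (arctan t)" "k * k = inverse (1 + t\<^sup>2)"
      unfolding k_def cos_arctan sin_arctan by (auto simp: add_pos_nonneg inverse_eq_divide)
    have "(\<integral>\<^sup>+x. h (x, x * t) * x * indicator {0<..} x \<partial>lborel)
      = ennreal k * (\<integral>\<^sup>+\<rho>. h (k * \<rho>, k * \<rho> * t) * ennreal (k * \<rho>) * indicator {0<..} (k * \<rho>) \<partial>lborel)"
      using k_simps(1) by (subst nn_integral_real_affine[where c=k and t=0]) auto
    also have "\<dots> = (\<integral>\<^sup>+\<rho>. ennreal k
      * (h (k * \<rho>, k * \<rho> * t) * ennreal (k * \<rho>) * indicator {0<..} (k * \<rho>)) \<partial>lborel)"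
      by (rule nn_integral_cmult[symmetric]) measurable
    also have "\<dots> = (\<integral>\<^sup>+\<rho>. h (\<rho> * k, \<rho> * sin (arctan t)) * \<rho> * indicator {0<..} \<rho> * inverse (1 + t\<^sup>2) \<partial>lborel)"
      unfolding k_simps(2,3)[symmetric] using k_simps(1)
      by (intro nn_integral_cong) (auto simp: indicator_def zero_less_mult_iff ennreal_mult mult_ac)
    finally show "(\<integral>\<^sup>+x. h (x, x * t) * x * indicator {0<..} x \<partial>lborel)
      = (\<integral>\<^sup>+\<rho>\<in>{0<..}. h (\<rho> * cos (arctan t), \<rho> * sin (arctan t)) * \<rho> \<partial>lborel) * inverse (1 + t\<^sup>2)"
      unfolding k_def by (simp add: nn_integral_multc)
  qed
  also have "\<dots> = (\<integral>\<^sup>+\<theta>\<in>{- (pi / 2)<..<pi / 2}. (\<integral>\<^sup>+\<rho>\<in>{0<..}. h (\<rho> * cos \<theta>, \<rho> * sin \<theta>) * \<rho> \<partial>lborel) \<partial>lborel)"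
    unfolding range_arctan[symmetric]
    by (rule nn_integral_substitution_range[symmetric])
      (auto intro!: DERIV_arctan continuous_intros simp: add_nonneg_eq_0_iff)
  finally show ?thesis .
qed

lemma nn_integral_polar_half_plane:
  fixes h :: "real \<times> real \<Rightarrow> ennreal"
  assumes [measurable]: "h \<in> borel_measurable borel" and quarter_turn: "cos \<alpha> = 0" "sin \<alpha> = e" "e\<^sup>2 = 1"
  shows "(\<integral>\<^sup>+p\<in>{p. 0 < e * snd p}. h p \<partial>lborel)
    = (\<integral>\<^sup>+\<theta>\<in>{\<alpha> - pi / 2<..<\<alpha> + pi / 2}. (\<integral>\<^sup>+\<rho>\<in>{0<..}. h (\<rho> * cos \<theta>, \<rho> * sin \<theta>) * \<rho> \<partial>lborel) \<partial>lborel)"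
    (is "_ = (\<integral>\<^sup>+\<theta>\<in>_. ?J \<theta> \<partial>lborel)")
proof -
  let ?f = "\<lambda>p. (- e * snd p, e * fst p)"
  have e_twice: "e * (e * x) = x" for x
    using quarter_turn(3) by (simp add: power2_eq_square flip: mult.assoc)
  have "linear ?f" by (rule linearI) (auto simp: algebra_simps)
  moreover have "norm (?f p) = norm p" for p
    by (simp add: norm_prod_def power_mult_distrib quarter_turn(3) add.commute)
  ultimately have orth: "orthogonal_transformation ?f" by (simp add: orthogonal_transformation)
  have "(\<integral>\<^sup>+p\<in>{p. 0 < e * snd p}. h p \<partial>lborel) = (\<integral>\<^sup>+p\<in>{p. 0 < fst p}. h (?f p) \<partial>lborel)"
    by (subst nn_integral_lborel_orthogonal[OF orth, symmetric])
      (measurable, simp add: indicator_def e_twice)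
  also have "\<dots> = (\<integral>\<^sup>+\<theta>. ?J (\<alpha> + \<theta>) * indicator {\<alpha> - pi / 2<..<\<alpha> + pi / 2} (\<alpha> + \<theta>) \<partial>lborel)"
    by (subst nn_integral_polar_right_half)
      (auto simp: cos_add sin_add quarter_turn mult_ac indicator_def intro!: nn_integral_cong)
  also have "\<dots> = (\<integral>\<^sup>+\<theta>\<in>{\<alpha> - pi / 2<..<\<alpha> + pi / 2}. ?J \<theta> \<partial>lborel)"
    by (rule nn_integral_lborel_translate) measurable
  finally show ?thesis .
qed

lemma nn_integral_polar:
  fixes h :: "real \<times> real \<Rightarrow> ennreal"
  assumes [measurable]: "h \<in> borel_measurable borel"
  shows "(\<integral>\<^sup>+p. h p \<partial>lborel)
    = (\<integral>\<^sup>+\<theta>\<in>{0<..<2 * pi}. (\<integral>\<^sup>+\<rho>\<in>{0<..}. h (\<rho> * cos \<theta>, \<rho> * sin \<theta>) * \<rho> \<partial>lborel) \<partial>lborel)"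
    (is "_ = (\<integral>\<^sup>+\<theta>\<in>_. ?J \<theta> \<partial>lborel)")
proof -
  have off_axis: "AE p in lborel \<Otimes>\<^sub>M lborel. snd (p :: real \<times> real) \<noteq> 0"
    by (rule lborel_pair.AE_pair_measure) (measurable, auto intro: AE_lborel_singleton)
  have "(\<integral>\<^sup>+p. h p \<partial>lborel)
    = (\<integral>\<^sup>+p. h p * indicator {p. 0 < 1 * snd p} p + h p * indicator {p. 0 < (- 1) * snd p} p \<partial>lborel)"
    by (intro nn_integral_cong_AE, use off_axis[unfolded lborel_prod] in eventually_elim)
      (auto simp: indicator_def)
  also have "\<dots> = (\<integral>\<^sup>+p\<in>{p. 0 < 1 * snd p}. h p \<partial>lborel) + (\<integral>\<^sup>+p\<in>{p. 0 < (- 1) * snd p}. h p \<partial>lborel)"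
    by (rule nn_integral_add) auto
  also have "\<dots> = (\<integral>\<^sup>+\<theta>\<in>{pi / 2 - pi / 2<..<pi / 2 + pi / 2}. ?J \<theta> \<partial>lborel)
     + (\<integral>\<^sup>+\<theta>\<in>{3 / 2 * pi - pi / 2<..<3 / 2 * pi + pi / 2}. ?J \<theta> \<partial>lborel)"
    by (intro arg_cong2[where f="(+)"] nn_integral_polar_half_plane assms cos_3over2_pi sin_3over2_pi
      cos_pi_half sin_pi_half) auto
  also have "\<dots> = (\<integral>\<^sup>+\<theta>. ?J \<theta> * indicator {0<..<pi} \<theta> + ?J \<theta> * indicator {pi<..<2 * pi} \<theta> \<partial>lborel)"
    by (subst nn_integral_add) auto
  also have "\<dots> = (\<integral>\<^sup>+\<theta>\<in>{0<..<2 * pi}. ?J \<theta> \<partial>lborel)"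
    by (intro nn_integral_cong_AE, use AE_lborel_singleton[of pi] in eventually_elim)
      (auto simp: indicator_def)
  finally show ?thesis .
qed

lemma nn_integral_radial:
  fixes h :: "real \<Rightarrow> ennreal"
  assumes [measurable]: "h \<in> borel_measurable borel"
  shows "(\<integral>\<^sup>+p. h (norm p) \<partial>(lborel :: (real \<times> real) measure))
    = ennreal (2 * pi) * (\<integral>\<^sup>+s\<in>{0<..}. h s * s \<partial>lborel)"
proof -
  have "norm (\<rho> * cos \<theta>, \<rho> * sin \<theta>) = \<bar>\<rho>\<bar>" for \<rho> \<theta> :: real
    by (simp add: norm_Pair power_mult_distrib flip: distrib_left)
  then have "(\<integral>\<^sup>+p. h (norm p) \<partial>(lborel :: (real \<times> real) measure))
     = (\<integral>\<^sup>+\<theta>\<in>{0<..<2 * pi}. (\<integral>\<^sup>+s\<in>{0<..}. h s * s \<partial>lborel) \<partial>lborel)"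
    by (subst nn_integral_polar) (auto intro!: nn_integral_cong simp: indicator_def)
  also have "\<dots> = (\<integral>\<^sup>+s\<in>{0<..}. h s * s \<partial>lborel) * emeasure lborel {0<..<2 * pi}"
    by (rule nn_integral_cmult_indicator) simp
  finally show ?thesis by (simp add: mult.commute)
qed

lemma norm_orthonormal_combination:
  fixes n m l :: "'a::real_inner"
  assumes "norm n = 1" "norm m = 1" "norm l = 1" "n \<bullet> m = 0" "n \<bullet> l = 0" "m \<bullet> l = 0"
  shows "(norm (w *\<^sub>R n + x *\<^sub>R m + y *\<^sub>R l))\<^sup>2 = w\<^sup>2 + x\<^sup>2 + y\<^sup>2"
  unfolding power2_norm_eq_inner using assms
  by (simp add: inner_simps norm_eq_1 inner_commute power2_eq_square)

lemma nn_integral_cylindrical: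
  fixes h :: "(real \<times> real) \<times> real \<Rightarrow> ennreal" and n m l :: "(real \<times> real) \<times> real"
  assumes [measurable]: "h \<in> borel_measurable borel"
    and frame: "norm n = 1" "norm m = 1" "norm l = 1" "n \<bullet> m = 0" "n \<bullet> l = 0" "m \<bullet> l = 0"
  shows "(\<integral>\<^sup>+p. h p \<partial>lborel) = (\<integral>\<^sup>+w. (\<integral>\<^sup>+\<theta>\<in>{0<..<2 * pi}. (\<integral>\<^sup>+\<rho>\<in>{0<..}.
    h (w *\<^sub>R n + (\<rho> * cos \<theta>) *\<^sub>R m + (\<rho> * sin \<theta>) *\<^sub>R l) * \<rho> \<partial>lborel) \<partial>lborel) \<partial>lborel)"
proof -
  let ?f = "\<lambda>p. snd p *\<^sub>R n + fst (fst p) *\<^sub>R m + snd (fst p) *\<^sub>R l"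
  have "linear ?f" by (rule linearI) (auto simp: algebra_simps)
  moreover have "norm (?f p) = norm p" for p
  proof -
    have "(norm (?f p))\<^sup>2 = (norm p)\<^sup>2"
      unfolding norm_orthonormal_combination[OF frame] by (simp add: norm_prod_def)
    then show ?thesis by simp
  qed
  ultimately have orth: "orthogonal_transformation ?f" by (simp add: orthogonal_transformation)
  have "(\<integral>\<^sup>+p. h p \<partial>lborel) = (\<integral>\<^sup>+p. h (?f p) \<partial>lborel)"
    by (rule nn_integral_lborel_orthogonal[OF orth, symmetric]) measurable
  also have "\<dots> = (\<integral>\<^sup>+w. \<integral>\<^sup>+v. h (?f (v, w)) \<partial>lborel \<partial>lborel)"
    by (rule nn_integral_lborel_snd) measurable
  also have "\<dots> = (\<integral>\<^sup>+w. (\<integral>\<^sup>+\<theta>\<in>{0<..<2 * pi}. (\<integral>\<^sup>+\<rho>\<in>{0<..}.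
      h (w *\<^sub>R n + (\<rho> * cos \<theta>) *\<^sub>R m + (\<rho> * sin \<theta>) *\<^sub>R l) * \<rho> \<partial>lborel) \<partial>lborel) \<partial>lborel)"
    by (intro nn_integral_cong, subst nn_integral_polar) auto
  finally show ?thesis .
qed

section \<open>Iterated interval integrals of nonnegative functions\<close>

lemma interval_integral_eq_nn_integral:
  fixes f :: "real \<Rightarrow> real" and a b :: real
  assumes [measurable]: "f \<in> borel_measurable borel" and "a \<le> b"
    and nonneg: "\<And>x. a < x \<Longrightarrow> x < b \<Longrightarrow> 0 \<le> f x"
  shows "(LBINT x=a..b. f x) = enn2real (\<integral>\<^sup>+x\<in>{a<..<b}. f x \<partial>lborel)"
proof -
  have "(LBINT x=a..b. f x) = (LINT x|lborel. indicator {a<..<b} x * f x)"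
    using \<open>a \<le> b\<close> by (simp add: interval_integral_Ioo set_lebesgue_integral_def)
  also have "\<dots> = enn2real (\<integral>\<^sup>+x. ennreal (indicator {a<..<b} x * f x) \<partial>lborel)"
    by (rule integral_eq_nn_integral) (auto simp: indicator_def nonneg)
  also have "(\<integral>\<^sup>+x. ennreal (indicator {a<..<b} x * f x) \<partial>lborel) = (\<integral>\<^sup>+x\<in>{a<..<b}. f x \<partial>lborel)"
    by (intro nn_integral_cong) (auto simp: indicator_def)
  finally show ?thesis .
qed

lemma AE_set_nn_integral_finite:
  fixes u :: "'a \<Rightarrow> ennreal"
  assumes "u \<in> borel_measurable M" "A \<in> sets M" "(\<integral>\<^sup>+x\<in>A. u x \<partial>M) < \<infinity>"
  shows "AE x\<in>A in M. u x < \<infinity>"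
proof -
  have "AE x in M. u x * indicator A x \<noteq> \<infinity>"
    using assms by (intro nn_integral_noteq_infinite) auto
  then show ?thesis by eventually_elim (auto simp: less_top)
qed

lemma interval_integral_enn2real:
  fixes u :: "real \<Rightarrow> ennreal" and a b :: real
  assumes [measurable]: "u \<in> borel_measurable borel" and "a \<le> b"
    and fin: "(\<integral>\<^sup>+x\<in>{a<..<b}. u x \<partial>lborel) < \<infinity>"
  shows "(LBINT x=a..b. enn2real (u x)) = enn2real (\<integral>\<^sup>+x\<in>{a<..<b}. u x \<partial>lborel)"
proof -
  have "AE x\<in>{a<..<b} in lborel. u x < \<infinity>"
    by (rule AE_set_nn_integral_finite[OF _ _ fin]) auto
  then have "AE x in lborel. ennreal (enn2real (u x)) * indicator {a<..<b} x = u x * indicator {a<..<b} x"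
    by eventually_elim (auto simp: indicator_def)
  then have "(\<integral>\<^sup>+x\<in>{a<..<b}. ennreal (enn2real (u x)) \<partial>lborel) = (\<integral>\<^sup>+x\<in>{a<..<b}. u x \<partial>lborel)"
    by (rule nn_integral_cong_AE)
  then show ?thesis
    using \<open>a \<le> b\<close> by (simp add: interval_integral_eq_nn_integral)
qed

lemma interval_integral_iterated_enn2real:
  fixes u :: "real \<Rightarrow> real \<Rightarrow> ennreal" and a b c d :: real
  assumes meas: "case_prod u \<in> borel_measurable (borel \<Otimes>\<^sub>M borel)" and "a \<le> b" "c \<le> d"
    and fin: "(\<integral>\<^sup>+x\<in>{a<..<b}. (\<integral>\<^sup>+y\<in>{c<..<d}. u x y \<partial>lborel) \<partial>lborel) < \<infinity>"
  shows "(LBINT x=a..b. (LBINT y=c..d. enn2real (u x y)))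
    = enn2real (\<integral>\<^sup>+x\<in>{a<..<b}. (\<integral>\<^sup>+y\<in>{c<..<d}. u x y \<partial>lborel) \<partial>lborel)"
proof -
  let ?v = "\<lambda>x. \<integral>\<^sup>+y\<in>{c<..<d}. u x y \<partial>lborel"
  have [measurable (raw)]: "(\<lambda>z. u (g z) (h z)) \<in> borel_measurable N"
    if [measurable]: "g \<in> borel_measurable N" "h \<in> borel_measurable N" for g h and N :: "'c measure"
    using measurable_compose[OF _ meas, of "\<lambda>z. (g z, h z)" N] by simp
  have "(LBINT x=a..b. (LBINT y=c..d. enn2real (u x y))) = (LBINT x=a..b. enn2real (?v x))"
  proof (rule interval_integral_cong_AE)
    show "(\<lambda>x. LBINT y=c..d. enn2real (u x y)) \<in> borel_measurable borel"
      using \<open>c \<le> d\<close> by (simp add: interval_integral_Ioo set_lebesgue_integral_def)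
    have "AE x\<in>{a<..<b} in lborel. ?v x < \<infinity>"
      by (rule AE_set_nn_integral_finite[OF _ _ fin]) auto
    moreover have "(LBINT y=c..d. enn2real (u x y)) = enn2real (?v x)" if "?v x < \<infinity>" for x
      using that \<open>c \<le> d\<close> by (intro interval_integral_enn2real) auto
    ultimately show
      "AE x\<in>einterval (min (ereal a) b) (max (ereal a) b) in lborel. (LBINT y=c..d. enn2real (u x y))
        = enn2real (?v x)"
      using \<open>a \<le> b\<close> by (auto simp: einterval_iff elim: AE_mp)
  qed measurable
  then show ?thesis
    using \<open>a \<le> b\<close> fin by (simp add: interval_integral_enn2real)
qed

section \<open>The intersection of two balls\<close>

definition ball_slice :: "'a::real_inner \<Rightarrow> real \<Rightarrow> 'a \<Rightarrow> real set \<Rightarrow> 'a set" where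
  "ball_slice p r n T = {x \<in> cball p r. n \<bullet> (x - p) \<in> T}"

lemma ball_slice_borel [measurable]:
  fixes p :: "'a::{real_inner, second_countable_topology}"
  assumes "T \<in> sets borel"
  shows "ball_slice p r n T \<in> sets borel"
proof -
  have "ball_slice p r n T = cball p r \<inter> (\<lambda>x. n \<bullet> (x - p)) -` T" by (auto simp: ball_slice_def)
  moreover have "(\<lambda>x. n \<bullet> (x - p)) -` T \<inter> space borel \<in> sets borel"
    by (rule measurable_sets[OF borel_measurable_continuous_onI assms]) (intro continuous_intros)
  ultimately show ?thesis by auto
qed

context
  fixes p q :: "'a::real_inner" and r r' d t :: real and n :: 'a
  assumes neq: "p \<noteq> q" and r_nonneg: "0 \<le> r" "0 \<le> r'"
    and d_eq: "d = dist p q" and n_eq: "n = (q - p) /\<^sub>R d" and t_eq: "t = (d\<^sup>2 + r\<^sup>2 - r'\<^sup>2) / (2 * d)"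
begin

text \<open>Two balls meet along their radical hyperplane \<open>n \<bullet> (x - p) = t\<close>, on which the powers of a point
  with respect to the two spheres agree.\<close>

lemma power_of_point_diff: "((dist p x)\<^sup>2 - r\<^sup>2) - ((dist q x)\<^sup>2 - r'\<^sup>2) = 2 * d * (n \<bullet> (x - p) - t)"
proof -
  have d_pos: "0 < d" using neq by (simp add: d_eq)
  have "(dist q x)\<^sup>2 = (dist p x)\<^sup>2 - 2 * ((q - p) \<bullet> (x - p)) + d\<^sup>2"
    by (simp add: d_eq dist_norm power2_norm_eq_inner inner_simps inner_commute)
  moreover have "d * (n \<bullet> (x - p)) = (q - p) \<bullet> (x - p)" using d_pos by (simp add: n_eq)
  moreover have "2 * d * t = d\<^sup>2 + r\<^sup>2 - r'\<^sup>2" using d_pos by (simp add: t_eq)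
  ultimately show ?thesis by (simp add: right_diff_distrib mult.assoc)
qed

lemma inner_reversed_axis: "- n \<bullet> (x - q) = d - n \<bullet> (x - p)"
proof -
  have "n \<bullet> (q - p) = d"
    using neq by (simp add: n_eq d_eq dist_norm norm_minus_commute power2_norm_eq_inner[symmetric]
      power2_eq_square)
  then show ?thesis by (simp add: inner_simps)
qed

lemma cball_Int_cball_eq_slices:
  "cball p r \<inter> cball q r' = ball_slice p r n {t..} \<union> ball_slice q r' (- n) {d - t<..}"
  "ball_slice p r n {t..} \<inter> ball_slice q r' (- n) {d - t<..} = {}"
proof -
  let ?P = "\<lambda>x. (dist p x)\<^sup>2 - r\<^sup>2" and ?Q = "\<lambda>x. (dist q x)\<^sup>2 - r'\<^sup>2"
  have d_pos: "0 < d" using neq by (simp add: d_eq)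
  have side: "t \<le> n \<bullet> (x - p) \<longleftrightarrow> ?Q x \<le> ?P x" for x
  proof -
    have "t \<le> n \<bullet> (x - p) \<longleftrightarrow> 0 \<le> 2 * d * (n \<bullet> (x - p) - t)"
      using d_pos by (simp add: zero_le_mult_iff)
    then show ?thesis unfolding power_of_point_diff[symmetric] by simp
  qed
  have balls: "x \<in> cball p r \<longleftrightarrow> ?P x \<le> 0" "x \<in> cball q r' \<longleftrightarrow> ?Q x \<le> 0" for x
    using r_nonneg power_mono_iff[of "dist p x" r 2] power_mono_iff[of "dist q x" r' 2] by auto
  have "x \<in> ball_slice p r n {t..} \<longleftrightarrow> ?P x \<le> 0 \<and> ?Q x \<le> ?P x" for x
    using balls(1) side by (simp only: ball_slice_def mem_Collect_eq atLeast_iff)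
  moreover have "x \<in> ball_slice q r' (- n) {d - t<..} \<longleftrightarrow> ?Q x \<le> 0 \<and> ?P x < ?Q x" for x
    using balls(2) side[of x] unfolding ball_slice_def inner_reversed_axis by auto
  ultimately show "cball p r \<inter> cball q r' = ball_slice p r n {t..} \<union> ball_slice q r' (- n) {d - t<..}"
    "ball_slice p r n {t..} \<inter> ball_slice q r' (- n) {d - t<..} = {}"
    by (auto simp only: set_eq_iff Int_iff Un_iff balls empty_iff)
qed

end

section \<open>Balls and caps in the marked space\<close>

lemma emeasure_disc_section:
  fixes x :: "real \<times> real"
  assumes "0 \<le> r"
  shows "emeasure lborel (cball x (sqrt (r\<^sup>2 - w\<^sup>2))) = ennreal (pi * (r\<^sup>2 - w\<^sup>2)) * indicator {-r<..<r} w"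
proof (cases "w \<in> {-r<..<r}")
  case True
  then have "w\<^sup>2 \<le> r\<^sup>2" by (auto simp: abs_le_square_iff[symmetric])
  then show ?thesis using True by (simp add: emeasure_cball unit_ball_vol_2)
next
  case False
  then have "r\<^sup>2 \<le> w\<^sup>2" using assms by (auto simp: abs_le_square_iff[symmetric])
  then have "cball x (sqrt (r\<^sup>2 - w\<^sup>2)) \<subseteq> cball x 0" by (intro subset_cball) simp
  then show ?thesis using False by (simp add: emeasure_lborel_countable countable_subset)
qed

definition marked_lborel :: "(real \<Rightarrow> real) \<Rightarrow> pt measure" where
  "marked_lborel f = (lborel \<Otimes>\<^sub>M lborel) \<Otimes>\<^sub>M mark_measure f"

lemma ex_orthonormal_frame:
  fixes n :: pt
  assumes "norm n = 1"
  obtains m l :: pt where "norm m = 1" "norm l = 1" "n \<bullet> m = 0" "n \<bullet> l = 0" "m \<bullet> l = 0"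
    "snd m = - sqrt (1 - (snd n)\<^sup>2)" "snd l = 0"
proof -
  define \<sigma> where "\<sigma> = sqrt (1 - (snd n)\<^sup>2)"
  have "norm (fst n) = \<sigma>"
    using assms by (auto simp: \<sigma>_def norm_prod_def intro!: real_sqrt_unique[symmetric])
  obtain e :: "real \<times> real" where e_unit: "norm e = 1" "fst n = \<sigma> *\<^sub>R e"
  proof (cases "fst n = 0")
    case True
    then show ?thesis using that[of "(1, 0)"] \<open>norm (fst n) = \<sigma>\<close> by (simp add: zero_prod_def)
  next
    case False
    then show ?thesis using that[of "fst n /\<^sub>R \<sigma>"] \<open>norm (fst n) = \<sigma>\<close> by auto
  qed
  have pythagoras: "\<sigma>\<^sup>2 + (snd n)\<^sup>2 = 1"
    using assms by (auto simp flip: \<open>norm (fst n) = \<sigma>\<close> simp: norm_prod_def)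
  have e_coords: "(fst e)\<^sup>2 + (snd e)\<^sup>2 = 1" using e_unit(1) by (simp add: norm_prod_def)
  have n_coords: "n = (\<sigma> *\<^sub>R e, snd n)" by (simp add: e_unit(2)[symmetric])
  show ?thesis
  proof (rule that[of "(snd n *\<^sub>R e, - \<sigma>)" "((- snd e, fst e), 0)"])
    show "norm (snd n *\<^sub>R e, - \<sigma>) = 1" using pythagoras e_unit(1)
      by (simp add: norm_Pair power_mult_distrib add.commute)
    show "norm ((- snd e, fst e), 0::real) = 1" using e_coords by (simp add: norm_Pair add.commute)
    show "n \<bullet> (snd n *\<^sub>R e, - \<sigma>) = 0" by (subst n_coords) (simp add: e_unit(1) norm_eq_1[symmetric])
    show "n \<bullet> ((- snd e, fst e), 0) = 0" by (subst n_coords) (simp add: inner_prod_def)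
  qed (simp_all add: inner_prod_def \<sigma>_def)
qed

locale mark_density =
  fixes f :: "real \<Rightarrow> real"
  assumes f_meas [measurable]: "f \<in> borel_measurable borel"
    and f_nonneg: "\<And>z. z > 0 \<Longrightarrow> f z \<ge> 0"
    and f_prob: "(\<integral>\<^sup>+ z. ennreal (f z * indicator {0<..} z) \<partial>lborel) = 1"
begin

definition mark_weight :: "real \<Rightarrow> ennreal" where
  "mark_weight z = ennreal (f z * indicator {0<..} z)"

lemma mark_weight_measurable [measurable]: "mark_weight \<in> borel_measurable borel"
  unfolding mark_weight_def by measurable

lemma mark_weight_snd_measurable [measurable]: "(\<lambda>p :: pt. mark_weight (snd p)) \<in> borel_measurable borel"
  by (rule measurable_compose[OF borel_measurable_snd mark_weight_measurable]) simp

lemma mark_weight_pos: "0 < z \<Longrightarrow> mark_weight z = ennreal (f z)"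
  by (simp add: mark_weight_def)

lemma mark_measure_eq_density: "mark_measure f = density lborel mark_weight"
  by (simp add: mark_measure_def mark_weight_def[abs_def])

lemma sets_mark_measure [measurable_cong]: "sets (mark_measure f) = sets borel"
  by (simp add: mark_measure_eq_density)

sublocale mark: prob_space "mark_measure f"
  by (rule prob_spaceI) (simp add: mark_measure_eq_density emeasure_density mark_weight_def f_prob)

lemma marked_lborel_eq_density: "marked_lborel f = density lborel (\<lambda>p. mark_weight (snd p))"
proof -
  have "marked_lborel f = density lborel (\<lambda>_. 1) \<Otimes>\<^sub>M density lborel mark_weight"
    by (simp add: marked_lborel_def mark_measure_eq_density lborel_prod density_1)
  also have "\<dots> = density (lborel \<Otimes>\<^sub>M lborel) (\<lambda>(x, z). 1 * mark_weight z)"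
    using mark.sigma_finite_measure_axioms
    by (intro pair_measure_density)
      (auto simp: mark_measure_eq_density density_1 lborel.sigma_finite_measure_axioms)
  finally show ?thesis by (simp add: lborel_prod case_prod_unfold)
qed

lemma sets_marked_lborel [measurable_cong, simp]: "sets (marked_lborel f) = sets borel"
  by (simp add: marked_lborel_eq_density)

lemma emeasure_marked_lborel_cylinder:
  assumes "A \<in> sets borel"
  shows "emeasure (marked_lborel f) (A \<times> UNIV) = emeasure lborel A"
proof -
  have "A \<in> sets (lborel \<Otimes>\<^sub>M lborel)" using assms by (simp only: lborel_prod sets_lborel)
  then have "emeasure (marked_lborel f) (A \<times> UNIV)
    = emeasure (lborel \<Otimes>\<^sub>M lborel) A * emeasure (mark_measure f) UNIV"
    unfolding marked_lborel_def by (rule mark.emeasure_pair_measure_Times) (simp add: sets_mark_measure)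
  moreover have "space (mark_measure f) = UNIV" by (simp add: mark_measure_eq_density)
  ultimately show ?thesis using mark.emeasure_space_1 by (simp add: lborel_prod)
qed

lemma emeasure_marked_lborel_finite:
  assumes "S \<subseteq> cball x R \<times> UNIV"
  shows "emeasure (marked_lborel f) S < \<infinity>"
proof -
  have "emeasure (marked_lborel f) S \<le> emeasure (marked_lborel f) (cball x R \<times> UNIV)"
    using assms by (intro emeasure_mono) (auto intro!: borel_closed closed_Times)
  also have "\<dots> < \<infinity>"
    using emeasure_lborel_cball_finite[of x R] by (simp add: emeasure_marked_lborel_cylinder)
  finally show ?thesis .
qed

lemma cball_fmeasurable: "cball p r \<in> fmeasurable (marked_lborel f)"
proof (rule fmeasurableI)
  have "cball p r \<subseteq> cball (fst p) r \<times> UNIV"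
  proof
    fix q assume "q \<in> cball p r"
    then show "q \<in> cball (fst p) r \<times> UNIV" using dist_fst_le[of p q] by (simp add: mem_Times_iff)
  qed
  then show "emeasure (marked_lborel f) (cball p r) < \<infinity>" by (rule emeasure_marked_lborel_finite)
qed simp

lemma ball_slice_fmeasurable: "T \<in> sets borel \<Longrightarrow> ball_slice p r n T \<in> fmeasurable (marked_lborel f)"
  by (rule fmeasurableI2[OF cball_fmeasurable]) (auto simp: ball_slice_def[of p] ball_slice_borel)

lemma emeasure_cball_disc_slices:
  assumes "0 \<le> r"
  shows "emeasure (marked_lborel f) (cball (x, c) r)
    = (\<integral>\<^sup>+w\<in>{-r<..<r}. mark_weight (w + c) * ennreal (pi * (r\<^sup>2 - w\<^sup>2)) \<partial>lborel)"
proof -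
  have meas: "(\<lambda>p. mark_weight (snd p) * indicator (cball (x, c) r) p) \<in> borel_measurable borel"
    by (intro borel_measurable_times_ennreal mark_weight_snd_measurable borel_measurable_indicator) simp
  have disc: "indicator (cball (x, c) r) (v, z) = (indicator (cball x (sqrt (r\<^sup>2 - (z - c)\<^sup>2))) v :: ennreal)"
    for v z
  proof -
    have "dist (x, c) (v, z) \<le> r \<longleftrightarrow> (dist x v)\<^sup>2 \<le> r\<^sup>2 - (z - c)\<^sup>2"
    proof -
      have "(dist (x, c) (v, z))\<^sup>2 = (dist x v)\<^sup>2 + (z - c)\<^sup>2"
        by (simp add: dist_Pair_Pair dist_real_def power2_commute)
      then show ?thesis using assms power_mono_iff[of "dist (x, c) (v, z)" r 2] by auto
    qed
    also have "\<dots> \<longleftrightarrow> dist x v \<le> sqrt (r\<^sup>2 - (z - c)\<^sup>2)"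
      by (auto intro: real_le_rsqrt sqrt_ge_absD)
    finally show ?thesis by (simp add: indicator_def)
  qed
  have "emeasure (marked_lborel f) (cball (x, c) r)
    = (\<integral>\<^sup>+p. mark_weight (snd p) * indicator (cball (x, c) r) p \<partial>lborel)"
    by (simp add: marked_lborel_eq_density emeasure_density)
  also have "\<dots> = (\<integral>\<^sup>+z. mark_weight z * emeasure lborel (cball x (sqrt (r\<^sup>2 - (z - c)\<^sup>2))) \<partial>lborel)"
    unfolding nn_integral_lborel_snd[OF meas] by (simp add: disc nn_integral_cmult_indicator)
  also have "\<dots> = (\<integral>\<^sup>+w. mark_weight (c + w) * emeasure lborel (cball x (sqrt (r\<^sup>2 - (c + w - c)\<^sup>2))) \<partial>lborel)"
    by (rule nn_integral_lborel_translate[symmetric]) (simp add: emeasure_disc_section assms)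
  finally show ?thesis by (simp add: emeasure_disc_section assms mult.assoc add.commute)
qed

lemma measure_cball_eq_interval_integral:
  assumes radius: "0 < r" "r < c"
  shows "measure (marked_lborel f) (cball (x, c) r) = pi * (LBINT w=-r..r. f (w + c) * (r\<^sup>2 - w\<^sup>2))"
proof -
  have disc_nonneg: "0 \<le> r\<^sup>2 - w\<^sup>2" if "-r < w" "w < r" for w
    using that by (simp add: abs_le_square_iff[symmetric])
  have "pi * (LBINT w=-r..r. f (w + c) * (r\<^sup>2 - w\<^sup>2)) = (LBINT w=-r..r. pi * (f (w + c) * (r\<^sup>2 - w\<^sup>2)))"
    by simp
  also have "\<dots> = enn2real (\<integral>\<^sup>+w\<in>{-r<..<r}. ennreal (pi * (f (w + c) * (r\<^sup>2 - w\<^sup>2))) \<partial>lborel)"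
    using radius f_nonneg disc_nonneg
    by (intro interval_integral_eq_nn_integral[of _ "-r" r, simplified]) auto
  also have "(\<integral>\<^sup>+w\<in>{-r<..<r}. ennreal (pi * (f (w + c) * (r\<^sup>2 - w\<^sup>2))) \<partial>lborel)
    = emeasure (marked_lborel f) (cball (x, c) r)"
  proof -
    have "mark_weight (w + c) * ennreal (pi * (r\<^sup>2 - w\<^sup>2)) = ennreal (pi * (f (w + c) * (r\<^sup>2 - w\<^sup>2)))"
      if "-r < w" "w < r" for w
      using that radius f_nonneg[of "w + c"] disc_nonneg[of w]
      by (simp add: mark_weight_pos ennreal_mult[symmetric] mult_ac)
    then show ?thesis
      using radius by (subst emeasure_cball_disc_slices) (auto simp: indicator_def intro!: nn_integral_cong)
  qed
  finally show ?thesis by (simp add: measure_def)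
qed

lemma norm_cylindrical_le_iff:
  fixes n m l :: "'a::real_inner"
  assumes frame: "norm n = 1" "norm m = 1" "norm l = 1" "n \<bullet> m = 0" "n \<bullet> l = 0" "m \<bullet> l = 0"
    and "0 \<le> r" "0 \<le> \<rho>"
  shows "norm (w *\<^sub>R n + (\<rho> * cos \<theta>) *\<^sub>R m + (\<rho> * sin \<theta>) *\<^sub>R l) \<le> r \<longleftrightarrow> \<rho> \<le> sqrt (r\<^sup>2 - w\<^sup>2)"
    (is "norm ?q \<le> r \<longleftrightarrow> _")
proof -
  have "norm ?q \<le> r \<longleftrightarrow> (norm ?q)\<^sup>2 \<le> r\<^sup>2"
    using \<open>0 \<le> r\<close> by (simp add: power_mono_iff)
  also have "(norm ?q)\<^sup>2 = w\<^sup>2 + \<rho>\<^sup>2"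
    by (simp add: norm_orthonormal_combination[OF frame] power_mult_distrib flip: distrib_left)
  also have "w\<^sup>2 + \<rho>\<^sup>2 \<le> r\<^sup>2 \<longleftrightarrow> \<rho>\<^sup>2 \<le> r\<^sup>2 - w\<^sup>2" by (simp add: algebra_simps)
  also have "\<dots> \<longleftrightarrow> \<rho> \<le> sqrt (r\<^sup>2 - w\<^sup>2)"
    using \<open>0 \<le> \<rho>\<close> by (auto intro: real_le_rsqrt sqrt_ge_absD)
  finally show ?thesis .
qed

lemma emeasure_ball_slice_cylindrical:
  fixes n :: pt
  assumes unit: "norm n = 1" and r_nonneg: "0 \<le> r" and [measurable]: "T \<in> sets borel"
  shows "emeasure (marked_lborel f) (ball_slice (x, c) r n T)
    = (\<integral>\<^sup>+w\<in>T. (\<integral>\<^sup>+\<theta>\<in>{0<..<2*pi}. (\<integral>\<^sup>+\<rho>\<in>{0<..<sqrt (r\<^sup>2 - w\<^sup>2)}.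
        mark_weight (c + w * snd n - \<rho> * cos \<theta> * sqrt (1 - (snd n)\<^sup>2)) * \<rho> \<partial>lborel) \<partial>lborel) \<partial>lborel)"
proof -
  obtain m l :: pt where frame: "norm m = 1" "norm l = 1" "n \<bullet> m = 0" "n \<bullet> l = 0" "m \<bullet> l = 0"
    and snd_frame: "snd m = - sqrt (1 - (snd n)\<^sup>2)" "snd l = 0"
    using ex_orthonormal_frame[OF unit] by blast
  let ?q = "\<lambda>w \<theta> \<rho>. w *\<^sub>R n + (\<rho> * cos \<theta>) *\<^sub>R m + (\<rho> * sin \<theta>) *\<^sub>R l"
  let ?h = "\<lambda>q. mark_weight (c + snd q) * (indicator (cball 0 r) q * indicator T (n \<bullet> q))"
  have n_q: "n \<bullet> ?q w \<theta> \<rho> = w" for w \<theta> \<rho>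
    using unit frame by (simp add: inner_add_right norm_eq_1)
  have norm_q: "norm (?q w \<theta> \<rho>) \<le> r \<longleftrightarrow> \<rho> \<le> sqrt (r\<^sup>2 - w\<^sup>2)" if "0 < \<rho>" for w \<theta> \<rho>
    using norm_cylindrical_le_iff[OF unit frame r_nonneg] that by simp
  have [measurable]: "cball (0::pt) r \<in> sets borel" by simp
  have "emeasure (marked_lborel f) (ball_slice (x, c) r n T)
    = (\<integral>\<^sup>+p. mark_weight (snd p) * indicator (ball_slice (x, c) r n T) p \<partial>lborel)"
    by (simp add: marked_lborel_eq_density emeasure_density ball_slice_borel)
  also have "\<dots> = (\<integral>\<^sup>+q. mark_weight (snd ((x, c) + q))
    * indicator (ball_slice (x, c) r n T) ((x, c) + q) \<partial>lborel)"
    by (rule nn_integral_lborel_translate[symmetric]) (simp add: ball_slice_borel)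
  also have "\<dots> = (\<integral>\<^sup>+q. ?h q \<partial>lborel)"
    by (intro nn_integral_cong) (auto simp: ball_slice_def indicator_def dist_norm)
  also have "\<dots> = (\<integral>\<^sup>+w. (\<integral>\<^sup>+\<theta>\<in>{0<..<2*pi}. (\<integral>\<^sup>+\<rho>\<in>{0<..}. ?h (?q w \<theta> \<rho>) * \<rho> \<partial>lborel) \<partial>lborel) \<partial>lborel)"
    using unit frame by (intro nn_integral_cylindrical) measurable
  also have "\<dots> = (\<integral>\<^sup>+w. (\<integral>\<^sup>+\<theta>\<in>{0<..<2*pi}. (\<integral>\<^sup>+\<rho>\<in>{0<..<sqrt (r\<^sup>2 - w\<^sup>2)}.
      mark_weight (c + w * snd n - \<rho> * cos \<theta> * sqrt (1 - (snd n)\<^sup>2))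
        * indicator T w * \<rho> \<partial>lborel) \<partial>lborel) \<partial>lborel)"
  proof (rule nn_integral_cong, rule nn_integral_cong,
      rule arg_cong2[where f="(*)", OF _ refl], rule nn_integral_cong_AE)
    fix w \<theta> :: real
    have "AE \<rho> in lborel. \<rho> \<noteq> sqrt (r\<^sup>2 - w\<^sup>2)" by (rule AE_lborel_singleton)
    then show "AE \<rho> in lborel. ?h (?q w \<theta> \<rho>) * \<rho> * indicator {0<..} \<rho>
      = mark_weight (c + w * snd n - \<rho> * cos \<theta> * sqrt (1 - (snd n)\<^sup>2)) * indicator T w * \<rho>
        * indicator {0<..<sqrt (r\<^sup>2 - w\<^sup>2)} \<rho>"
    proof eventually_elim
      case (elim \<rho>)
      then show ?case
        unfolding n_q using norm_q[of \<rho> w \<theta>] by (auto simp: snd_frame indicator_def algebra_simps)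
    qed
  qed
  also have "\<dots> = (\<integral>\<^sup>+w\<in>T. (\<integral>\<^sup>+\<theta>\<in>{0<..<2*pi}. (\<integral>\<^sup>+\<rho>\<in>{0<..<sqrt (r\<^sup>2 - w\<^sup>2)}.
      mark_weight (c + w * snd n - \<rho> * cos \<theta> * sqrt (1 - (snd n)\<^sup>2)) * \<rho> \<partial>lborel) \<partial>lborel) \<partial>lborel)"
    by (intro nn_integral_cong) (auto simp: indicator_def intro!: nn_integral_cong)
  finally show ?thesis .
qed

lemma cap_height_pos:
  fixes c r w \<rho> \<theta> \<delta> :: real
  assumes "w\<^sup>2 + \<rho>\<^sup>2 \<le> r\<^sup>2" "0 < r" "r < c"
  shows "0 < c + w * cos \<delta> - \<rho> * cos \<theta> * sin \<delta>"
proof -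
  let ?y = "w * cos \<delta> - \<rho> * cos \<theta> * sin \<delta>"
  have "?y\<^sup>2 + (w * sin \<delta> + \<rho> * cos \<theta> * cos \<delta>)\<^sup>2 = (w\<^sup>2 + \<rho>\<^sup>2 * (cos \<theta>)\<^sup>2) * ((sin \<delta>)\<^sup>2 + (cos \<delta>)\<^sup>2)"
    by algebra
  then have "?y\<^sup>2 \<le> w\<^sup>2 + \<rho>\<^sup>2 * (cos \<theta>)\<^sup>2" by (simp add: sum_power2_ge_zero) (smt (verit) zero_le_power2)
  also have "\<dots> \<le> w\<^sup>2 + \<rho>\<^sup>2 * 1"
    by (intro add_left_mono mult_left_mono) (auto simp: abs_square_le_1)
  also have "\<dots> \<le> r\<^sup>2" using assms by simp
  finally have "\<bar>?y\<bar> \<le> r" using assms by (simp add: abs_le_square_iff[symmetric])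
  then show ?thesis using assms by linarith
qed

definition radial_mass :: "real \<Rightarrow> real \<Rightarrow> real \<Rightarrow> real \<Rightarrow> real \<Rightarrow> ennreal" where
  "radial_mass c r \<delta> w \<theta>
    = (\<integral>\<^sup>+\<rho>\<in>{0<..<sqrt (r\<^sup>2 - w\<^sup>2)}. mark_weight (c + w * cos \<delta> - \<rho> * cos \<theta> * sin \<delta>) * \<rho> \<partial>lborel)"

lemma radial_mass_measurable: "case_prod (radial_mass c r \<delta>) \<in> borel_measurable (borel \<Otimes>\<^sub>M borel)"
proof -
  have "indicator {0<..<s} \<rho> = (if 0 < \<rho> \<and> \<rho> < s then 1 else 0 :: ennreal)" for s \<rho> :: real
    by (simp add: indicator_def)
  then show ?thesis unfolding radial_mass_def case_prod_unfold by (simp only:) measurable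
qed

lemma radial_mass_eq_0: "0 \<le> r \<Longrightarrow> r \<le> w \<Longrightarrow> radial_mass c r \<delta> w \<theta> = 0"
  by (simp add: radial_mass_def power_mono)

lemma interval_integral_eq_radial_mass:
  assumes radius: "0 < r" "r < c" and offset: "- r \<le> w" "w \<le> r"
  shows "(LBINT \<rho>=0..sqrt (r\<^sup>2 - w\<^sup>2). f (c + w * cos \<delta> - \<rho> * cos \<theta> * sin \<delta>) * \<rho>)
    = enn2real (radial_mass c r \<delta> w \<theta>)"
    (is "(LBINT \<rho>=_.._. f (?z \<rho>) * \<rho>) = _")
proof -
  have sqrt_nonneg: "0 \<le> sqrt (r\<^sup>2 - w\<^sup>2)" using offset by (auto simp: abs_le_square_iff[symmetric])
  have pos: "0 < ?z \<rho>" if "0 < \<rho>" "\<rho> < sqrt (r\<^sup>2 - w\<^sup>2)" for \<rho>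
  proof (rule cap_height_pos)
    have "\<rho>\<^sup>2 \<le> r\<^sup>2 - w\<^sup>2" using that by (intro sqrt_ge_absD) auto
    then show "w\<^sup>2 + \<rho>\<^sup>2 \<le> r\<^sup>2" by simp
  qed (use radius in auto)
  have "(LBINT \<rho>=0..sqrt (r\<^sup>2 - w\<^sup>2). f (?z \<rho>) * \<rho>)
    = enn2real (\<integral>\<^sup>+\<rho>\<in>{0<..<sqrt (r\<^sup>2 - w\<^sup>2)}. ennreal (f (?z \<rho>) * \<rho>) \<partial>lborel)"
    using sqrt_nonneg f_nonneg pos unfolding zero_ereal_def by (intro interval_integral_eq_nn_integral) auto
  also have "(\<integral>\<^sup>+\<rho>\<in>{0<..<sqrt (r\<^sup>2 - w\<^sup>2)}. ennreal (f (?z \<rho>) * \<rho>) \<partial>lborel) = radial_mass c r \<delta> w \<theta>"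
    using pos f_nonneg unfolding radial_mass_def
    by (intro nn_integral_cong) (auto simp: indicator_def mark_weight_pos ennreal_mult)
  finally show ?thesis .
qed

lemma emeasure_cap:
  assumes unit: "norm n = 1" and r_nonneg: "0 \<le> r" and T_ray: "T = {t..} \<or> T = {t<..}"
    and \<delta>_eq: "\<delta> = pi / 2 - arcsin (snd n)"
  shows "emeasure (marked_lborel f) (ball_slice (x, c) r n T)
    = (\<integral>\<^sup>+w\<in>{t<..<r}. (\<integral>\<^sup>+\<theta>\<in>{0<..<2*pi}. radial_mass c r \<delta> w \<theta> \<partial>lborel) \<partial>lborel)"
proof -
  let ?\<Theta> = "\<lambda>w. \<integral>\<^sup>+\<theta>\<in>{0<..<2*pi}. radial_mass c r \<delta> w \<theta> \<partial>lborel"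
  have "\<bar>snd n\<bar> \<le> 1" using unit norm_snd_le[of "snd n" "fst n"] by simp
  then have trig: "cos \<delta> = snd n" "sin \<delta> = sqrt (1 - (snd n)\<^sup>2)"
    unfolding \<delta>_eq by (simp_all add: cos_diff sin_diff cos_arcsin)
  have "T \<in> sets borel" using T_ray by auto
  then have "emeasure (marked_lborel f) (ball_slice (x, c) r n T) = (\<integral>\<^sup>+w\<in>T. ?\<Theta> w \<partial>lborel)"
    unfolding radial_mass_def trig by (rule emeasure_ball_slice_cylindrical[OF unit r_nonneg])
  also have "\<dots> = (\<integral>\<^sup>+w\<in>{t<..<r}. ?\<Theta> w \<partial>lborel)"
  proof (rule nn_integral_cong_AE)
    have "AE w in lborel. w \<noteq> t" by (rule AE_lborel_singleton)
    then show "AE w in lborel. ?\<Theta> w * indicator T w = ?\<Theta> w * indicator {t<..<r} w"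
      by eventually_elim (use T_ray r_nonneg in \<open>auto simp: indicator_def radial_mass_eq_0\<close>)
  qed
  finally show ?thesis .
qed

lemma measure_cap_eq_interval_integral:
  assumes unit: "norm n = 1" and radius: "0 < r" "r < c" and offset: "- r \<le> t" "t \<le> r"
    and T_ray: "T = {t..} \<or> T = {t<..}"
    and \<delta>_eq: "\<delta> = pi / 2 - arcsin (snd n)"
  shows "measure (marked_lborel f) (ball_slice (x, c) r n T)
    = (LBINT w=t..r. (LBINT \<theta>=0..2*pi. (LBINT \<rho>=0..sqrt (r\<^sup>2 - w\<^sup>2).
        f (c + w * cos \<delta> - \<rho> * cos \<theta> * sin \<delta>) * \<rho>)))"
proof -
  have "T \<in> sets borel" using T_ray by auto
  then have fin: "emeasure (marked_lborel f) (ball_slice (x, c) r n T) < \<infinity>"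
    using ball_slice_fmeasurable[of T "(x, c)" r n] by (simp add: fmeasurable_def)
  note cap = emeasure_cap[OF unit less_imp_le[OF radius(1)] T_ray \<delta>_eq, of x c]
  have "(LBINT w=t..r. (LBINT \<theta>=0..2*pi. (LBINT \<rho>=0..sqrt (r\<^sup>2 - w\<^sup>2).
      f (c + w * cos \<delta> - \<rho> * cos \<theta> * sin \<delta>) * \<rho>)))
    = (LBINT w=t..r. (LBINT \<theta>=0..2*pi. enn2real (radial_mass c r \<delta> w \<theta>)))"
    using offset by (intro interval_integral_cong interval_integral_eq_radial_mass radius)
      (auto simp: einterval_iff)
  also have "\<dots> = enn2real (emeasure (marked_lborel f) (ball_slice (x, c) r n T))"
    using fin offset unfolding cap zero_ereal_def
    by (intro interval_integral_iterated_enn2real) (auto simp: radial_mass_measurable)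
  finally show ?thesis by (simp add: measure_def)
qed

end

section \<open>Hyperbolic balls in the upper half space\<close>

definition dH_numerator :: "pt \<Rightarrow> pt \<Rightarrow> real" where
  "dH_numerator a b = (dist (fst a) (fst b))\<^sup>2 + (snd a)\<^sup>2 + (snd b)\<^sup>2"

lemma dH_numerator_commute: "dH_numerator a b = dH_numerator b a"
  by (simp add: dH_numerator_def dist_commute)

lemma dH_commute: "dH a b = dH b a"
  by (simp add: dH_def dist_commute add.commute mult_ac)

lemma dH_numerator_ge: "2 * snd a * snd b \<le> dH_numerator a b"
  unfolding dH_numerator_def
  using sum_squares_bound[of "snd a" "snd b"] zero_le_power2[of "dist (fst a) (fst b)"]
  by linarith

context
  fixes a b :: pt
  assumes pos: "0 < snd a" "0 < snd b"
begin

lemma dH_eq_arcosh: "dH a b = arcosh (dH_numerator a b / (2 * snd a * snd b))"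
  and dH_arcosh_arg_ge_1: "1 \<le> dH_numerator a b / (2 * snd a * snd b)"
proof -
  have "(dist (fst a) (fst b))\<^sup>2 / (2 * snd a * snd b) + (snd a / snd b + snd b / snd a) / 2
    = dH_numerator a b / (2 * snd a * snd b)"
    using pos by (simp add: dH_numerator_def field_simps power2_eq_square)
  then show "dH a b = arcosh (dH_numerator a b / (2 * snd a * snd b))" by (simp add: dH_def)
  show "1 \<le> dH_numerator a b / (2 * snd a * snd b)"
    using pos dH_numerator_ge[of a b] by simp
qed

lemma cosh_dH: "cosh (dH a b) = dH_numerator a b / (2 * snd a * snd b)"
  using dH_arcosh_arg_ge_1 by (simp add: dH_eq_arcosh)

lemma dH_nonneg: "0 \<le> dH a b"
  using dH_arcosh_arg_ge_1 by (simp add: dH_eq_arcosh)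

lemma dH_pos: "a \<noteq> b \<Longrightarrow> 0 < dH a b"
proof -
  assume "a \<noteq> b"
  then have "0 < (dist (fst a) (fst b))\<^sup>2 + (snd a - snd b)\<^sup>2"
    by (auto simp: prod_eq_iff sum_power2_gt_zero_iff)
  then have "2 * snd a * snd b < dH_numerator a b"
    by (simp add: dH_numerator_def power2_diff)
  then have "cosh (dH a b) \<noteq> cosh 0" using pos by (simp add: cosh_dH)
  then show ?thesis using dH_nonneg by (auto simp: order_less_le)
qed

end

text \<open>The closed hyperbolic ball around \<open>a\<close> with \<open>b\<close> on its boundary, for points of positive height.
  With denominators cleared it is closed jointly in \<open>a\<close>, \<open>b\<close> and \<open>c\<close> on all of space.\<close>

definition hball_through :: "pt \<Rightarrow> pt \<Rightarrow> pt set" where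
  "hball_through a b = {c. dH_numerator a c * snd b \<le> dH_numerator a b * snd c}"

lemma dH_less_iff_notin_hball_through:
  assumes "0 < snd a" "0 < snd b" "0 < snd c"
  shows "dH a b < dH a c \<longleftrightarrow> c \<notin> hball_through a b"
proof -
  have "dH a b < dH a c \<longleftrightarrow> cosh (dH a b) < cosh (dH a c)"
    using assms by (simp add: cosh_real_nonneg_less_iff dH_nonneg)
  also have "\<dots> \<longleftrightarrow> dH_numerator a b * snd c < dH_numerator a c * snd b"
    using assms by (simp add: cosh_dH field_simps)
  finally show ?thesis by (auto simp: hball_through_def)
qed

lemma center_in_hball_through:
  assumes "0 < snd a"
  shows "a \<in> hball_through a b"
  using mult_right_mono[OF dH_numerator_ge[of a b], of "snd a"] assms
  by (simp add: hball_through_def dH_numerator_def power2_eq_square mult_ac)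

definition hball_center :: "pt \<Rightarrow> pt \<Rightarrow> pt" where
  "hball_center a b = (fst a, snd a * cosh (dH a b))"

definition hball_radius :: "pt \<Rightarrow> pt \<Rightarrow> real" where
  "hball_radius a b = snd a * sinh (dH a b)"

lemma power_of_point_hball:
  "(dist (hball_center a b) c)\<^sup>2 - (hball_radius a b)\<^sup>2
    = dH_numerator a c - 2 * snd a * snd c * cosh (dH a b)"
proof -
  have "(dist (hball_center a b) c)\<^sup>2 = (dist (fst a) (fst c))\<^sup>2 + (snd a * cosh (dH a b) - snd c)\<^sup>2"
    by (simp add: hball_center_def dist_prod_def dist_real_def)
  moreover have "(snd a * cosh (dH a b))\<^sup>2 = (snd a)\<^sup>2 + (hball_radius a b)\<^sup>2"
    by (simp add: hball_radius_def power_mult_distrib cosh_square_eq algebra_simps)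
  ultimately show ?thesis by (simp add: dH_numerator_def power2_diff)
qed

lemma hball_radius_nonneg: "0 < snd a \<Longrightarrow> 0 < snd b \<Longrightarrow> 0 \<le> hball_radius a b"
  by (simp add: hball_radius_def dH_nonneg)

lemma hball_radius_pos: "0 < snd a \<Longrightarrow> 0 < snd b \<Longrightarrow> a \<noteq> b \<Longrightarrow> 0 < hball_radius a b"
  by (simp add: hball_radius_def dH_pos)

lemma hball_through_eq_cball:
  assumes "0 < snd a" "0 < snd b"
  shows "hball_through a b = cball (hball_center a b) (hball_radius a b)"
proof (intro set_eqI)
  fix c
  have "c \<in> hball_through a b \<longleftrightarrow> dH_numerator a c \<le> 2 * snd a * snd c * cosh (dH a b)"
    using assms by (simp add: hball_through_def cosh_dH field_simps)
  also have "\<dots> \<longleftrightarrow> (dist (hball_center a b) c)\<^sup>2 \<le> (hball_radius a b)\<^sup>2"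
    using power_of_point_hball[of a b c] by auto
  also have "\<dots> \<longleftrightarrow> c \<in> cball (hball_center a b) (hball_radius a b)"
    using assms by (simp add: power_mono_iff hball_radius_nonneg)
  finally show "c \<in> hball_through a b \<longleftrightarrow> c \<in> cball (hball_center a b) (hball_radius a b)" .
qed

lemma dist_hball_center_boundary:
  assumes "0 < snd a" "0 < snd b"
  shows "dist (hball_center a b) b = hball_radius a b"
proof -
  have "dH_numerator a b = 2 * snd a * snd b * cosh (dH a b)" using assms by (simp add: cosh_dH)
  then have "(dist (hball_center a b) b)\<^sup>2 = (hball_radius a b)\<^sup>2"
    using power_of_point_hball[of a b b] by simp
  then show ?thesis using assms by (simp add: power2_eq_iff_nonneg hball_radius_nonneg)
qed

text \<open>Each of \<open>a\<close> and \<open>b\<close> lies inside one of the spheres and on the other, so the spheres intersect.\<close>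

lemma hball_triangle:
  assumes pos: "0 < snd a" "0 < snd b"
  shows "dist (hball_center a b) (hball_center b a) \<le> hball_radius a b + hball_radius b a"
    and "hball_radius a b \<le> hball_radius b a + dist (hball_center a b) (hball_center b a)"
proof -
  have "a \<in> hball_through a b" "b \<in> hball_through b a" using pos by (simp_all add: center_in_hball_through)
  then have "dist (hball_center a b) a \<le> hball_radius a b" "dist (hball_center b a) b \<le> hball_radius b a"
    using pos by (simp_all add: hball_through_eq_cball)
  moreover have "dist (hball_center a b) b = hball_radius a b"
    "dist (hball_center b a) a = hball_radius b a"
    using pos by (simp_all add: dist_hball_center_boundary)
  ultimately show "dist (hball_center a b) (hball_center b a) \<le> hball_radius a b + hball_radius b a"
    "hball_radius a b \<le> hball_radius b a + dist (hball_center a b) (hball_center b a)"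
    using dist_triangle[of "hball_center a b" "hball_center b a" a]
      dist_triangle[of "hball_center a b" b "hball_center b a"]
    by (simp_all add: dist_commute)
qed

lemma hball_center_neq:
  assumes "a \<noteq> b"
  shows "hball_center a b \<noteq> hball_center b a"
  using assms by (auto simp: hball_center_def dH_commute[of b a] prod_eq_iff)

lemma dist_fst_le_hball_through:
  assumes "0 < snd a" "0 < snd b" "c \<in> hball_through a b"
  shows "dist (fst a) (fst c) \<le> dH_numerator a b / (2 * snd b)"
proof -
  have "dist (fst a) (fst c) \<le> dist (hball_center a b) c"
    using dist_fst_le[of "hball_center a b" c] by (simp add: hball_center_def)
  also have "\<dots> \<le> snd a * sinh (dH a b)"
    using assms by (simp add: hball_through_eq_cball hball_radius_def)
  also have "\<dots> \<le> snd a * cosh (dH a b)" using assms by (simp add: sinh_le_cosh_real)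
  also have "\<dots> = dH_numerator a b / (2 * snd b)" using assms by (simp add: cosh_dH)
  finally show ?thesis .
qed

definition exclusion_region :: "pt \<Rightarrow> pt \<Rightarrow> pt set" where
  "exclusion_region a b = hball_through a b \<union> hball_through b a"

lemma exclusion_region_left: "a \<in> exclusion_region a b"
  and exclusion_region_right: "b \<in> exclusion_region a b"
  by (simp_all add: exclusion_region_def hball_through_def dH_numerator_commute)

lemma closed_exclusion_region_graph: "closed {(a, b, c). c \<in> exclusion_region a b}"
proof -
  have "{(a, b, c). c \<in> exclusion_region a b} = {x :: pt \<times> pt \<times> pt.
      snd (snd x) \<in> hball_through (fst x) (fst (snd x))
      \<or> snd (snd x) \<in> hball_through (fst (snd x)) (fst x)}"
    by (auto simp: exclusion_region_def)
  then show ?thesis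
    unfolding hball_through_def dH_numerator_def mem_Collect_eq
    by (simp only:) (intro closed_Collect_disj closed_Collect_le continuous_intros)
qed

lemma dist_fst_le_exclusion_region:
  assumes pos: "0 < snd a" "0 < snd b" and mem: "c \<in> exclusion_region a b"
  shows "dist (fst a) (fst c)
    \<le> dist (fst a) (fst b) + dH_numerator a b / (2 * snd a) + dH_numerator a b / (2 * snd b)"
proof -
  have nonneg: "0 \<le> dH_numerator a b / (2 * snd a)" "0 \<le> dH_numerator a b / (2 * snd b)"
    using pos by (auto simp: dH_numerator_def)
  show ?thesis
  proof (cases "c \<in> hball_through a b")
    case True
    then show ?thesis
      using dist_fst_le_hball_through[OF pos True] nonneg zero_le_dist[of "fst a" "fst b"] by linarith
  next
    case False
    then have "c \<in> hball_through b a" using mem by (simp add: exclusion_region_def)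
    then have "dist (fst b) (fst c) \<le> dH_numerator a b / (2 * snd a)"
      using dist_fst_le_hball_through[OF pos(2,1)] by (simp add: dH_numerator_commute)
    then show ?thesis
      using nonneg dist_triangle[of "fst a" "fst c" "fst b"] by linarith
  qed
qed

lemma exclusion_region_locally_bounded:
  assumes "0 < snd a" "0 < snd b"
  obtains X Y R where "open X" "open Y" "a \<in> X" "b \<in> Y"
    "(\<Union>a'\<in>X. \<Union>b'\<in>Y. exclusion_region a' b') \<subseteq> cball (fst a) R \<times> UNIV"
proof -
  define \<beta> where "\<beta> = (\<lambda>x. dist (fst a) (fst (fst x)) + dist (fst (fst x)) (fst (snd x))
    + dH_numerator (fst x) (snd x) / (2 * snd (fst x)) + dH_numerator (fst x) (snd x) / (2 * snd (snd x)))"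
  have "isCont \<beta> (a, b)"
    unfolding \<beta>_def dH_numerator_def using assms by (intro continuous_intros) auto
  then have "\<forall>\<^sub>F x in nhds (a, b). \<beta> x < \<beta> (a, b) + 1"
    unfolding continuous_at tendsto_at_iff_tendsto_nhds by (rule order_tendstoD) simp
  moreover have "open {x :: pt \<times> pt. 0 < snd (fst x) \<and> 0 < snd (snd x)}"
    by (intro open_Collect_conj open_Collect_less continuous_intros)
  from eventually_nhds_in_open[OF this, of "(a, b)"]
  have "\<forall>\<^sub>F x in nhds (a, b). 0 < snd (fst x) \<and> 0 < snd (snd x)" using assms by simp
  ultimately have "\<forall>\<^sub>F x in nhds (a, b). \<beta> x < \<beta> (a, b) + 1 \<and> 0 < snd (fst x) \<and> 0 < snd (snd x)"
    by eventually_elim simp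
  then obtain S where S_nhds: "open S" "(a, b) \<in> S"
    "\<And>x. x \<in> S \<Longrightarrow> \<beta> x < \<beta> (a, b) + 1 \<and> 0 < snd (fst x) \<and> 0 < snd (snd x)"
    unfolding eventually_nhds by blast
  obtain X Y where rectangle: "open X" "open Y" "a \<in> X" "b \<in> Y" "X \<times> Y \<subseteq> S"
    using open_prod_elim[OF S_nhds(1,2)] by (metis mem_Sigma_iff)
  have "dist (fst a) (fst c) \<le> \<beta> (a, b) + 1"
    if mem: "a' \<in> X" "b' \<in> Y" "c \<in> exclusion_region a' b'" for a' b' c
  proof -
    have near: "\<beta> (a', b') < \<beta> (a, b) + 1" and pos: "0 < snd a'" "0 < snd b'"
      using S_nhds(3)[of "(a', b')"] rectangle(5) mem by auto
    have "dist (fst a) (fst c) \<le> dist (fst a) (fst a') + dist (fst a') (fst c)"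
      by (rule dist_triangle)
    then show ?thesis
      using near dist_fst_le_exclusion_region[OF pos mem(3)] unfolding \<beta>_def fst_conv snd_conv by linarith
  qed
  then have "(\<Union>a'\<in>X. \<Union>b'\<in>Y. exclusion_region a' b') \<subseteq> cball (fst a) (\<beta> (a, b) + 1) \<times> UNIV"
    by (auto simp: mem_Times_iff simp del: split_paired_All)
  then show ?thesis using that rectangle by blast
qed

lemma radical_offset_bounds:
  fixes r r' d :: real
  assumes "0 < d" "0 \<le> r" "0 \<le> r'" "d \<le> r + r'" "r \<le> r' + d" "r' \<le> r + d"
  shows "- r \<le> (d\<^sup>2 + r\<^sup>2 - r'\<^sup>2) / (2 * d)" "(d\<^sup>2 + r\<^sup>2 - r'\<^sup>2) / (2 * d) \<le> r"
proof -
  have "0 \<le> (d + r - r') * (d + r + r')" "0 \<le> (r' + d - r) * (r' + r - d)"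
    using assms by simp_all
  then show "- r \<le> (d\<^sup>2 + r\<^sup>2 - r'\<^sup>2) / (2 * d)" "(d\<^sup>2 + r\<^sup>2 - r'\<^sup>2) / (2 * d) \<le> r"
    using assms(1) by (simp_all add: field_simps power2_eq_square)
qed

context mark_density
begin

lemma measure_cball_Un_cball:
  fixes p q :: pt
  assumes neq: "p \<noteq> q" and r_nonneg: "0 \<le> r" "0 \<le> r'" and d_eq: "d = dist p q"
    and n_eq: "n = (q - p) /\<^sub>R d" and t_eq: "t = (d\<^sup>2 + r\<^sup>2 - r'\<^sup>2) / (2 * d)"
  shows "measure (marked_lborel f) (cball p r \<union> cball q r')
    = measure (marked_lborel f) (cball p r) + measure (marked_lborel f) (cball q r')
      - measure (marked_lborel f) (ball_slice p r n {t..})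
      - measure (marked_lborel f) (ball_slice q r' (- n) {d - t<..})"
proof -
  have "measure (marked_lborel f) (cball p r \<inter> cball q r')
    = measure (marked_lborel f) (ball_slice p r n {t..})
      + measure (marked_lborel f) (ball_slice q r' (- n) {d - t<..})"
    unfolding cball_Int_cball_eq_slices(1)[OF neq r_nonneg d_eq n_eq t_eq]
    using cball_Int_cball_eq_slices(2)[OF neq r_nonneg d_eq n_eq t_eq]
    by (intro measure_Un_AE) (auto intro: ball_slice_fmeasurable)
  then show ?thesis by (simp add: measure_Un3 cball_fmeasurable)
qed

lemma measure_cball_Un_cball_eq_interval_integrals:
  fixes x y :: "real \<times> real"
  assumes radii: "0 < r" "r < c" "0 < r'" "r' < c'" and d_eq: "d = dist (x, c) (y, c')" "0 < d"
    and tri: "d \<le> r + r'" "r \<le> r' + d" "r' \<le> r + d"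
    and h_eq: "h = (r' - r + d) * (r + r' - d) / (2 * d)" "h' = (r - r' + d) * (r + r' - d) / (2 * d)"
    and \<delta>_eq: "\<delta> = pi / 2 - arcsin ((c' - c) / d)" "\<delta>' = pi / 2 - arcsin ((c - c') / d)"
  shows "measure (marked_lborel f) (cball (x, c) r \<union> cball (y, c') r')
    = pi * (LBINT w=-r..r. f (w + c) * (r\<^sup>2 - w\<^sup>2)) + pi * (LBINT w=-r'..r'. f (w + c') * (r'\<^sup>2 - w\<^sup>2))
      - (LBINT w=r-h..r. (LBINT \<theta>=0..2*pi. (LBINT \<rho>=0..sqrt (r\<^sup>2 - w\<^sup>2).
          f (c + w * cos \<delta> - \<rho> * cos \<theta> * sin \<delta>) * \<rho>)))
      - (LBINT w=r'-h'..r'. (LBINT \<theta>=0..2*pi. (LBINT \<rho>=0..sqrt (r'\<^sup>2 - w\<^sup>2).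
          f (c' + w * cos \<delta>' - \<rho> * cos \<theta> * sin \<delta>') * \<rho>)))"
proof -
  define t where "t = (d\<^sup>2 + r\<^sup>2 - r'\<^sup>2) / (2 * d)"
  define n where "n = ((y, c') - (x, c)) /\<^sub>R d"
  have neq: "(x, c) \<noteq> (y, c')" using d_eq by auto
  have caps_eq: "r - h = t" "r' - h' = d - t"
    using d_eq(2) by (simp_all add: h_eq t_def field_simps power2_eq_square)
  have offset: "d - t = (d\<^sup>2 + r'\<^sup>2 - r\<^sup>2) / (2 * d)"
    using d_eq(2) by (simp add: t_def field_simps power2_eq_square)
  have bounds: "- r \<le> t" "t \<le> r"
    unfolding t_def using tri radii d_eq(2) by (intro radical_offset_bounds; simp)+
  have offset_bounds: "- r' \<le> d - t" "d - t \<le> r'"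
    unfolding offset using tri radii d_eq(2) by (intro radical_offset_bounds; simp add: add.commute)+
  have "norm ((y, c') - (x, c)) = d" unfolding d_eq(1) dist_norm by (rule norm_minus_commute)
  then have norm_n: "norm n = 1" "norm (- n) = 1"
    using d_eq(2) by (simp_all only: n_def norm_minus_cancel norm_scaleR) simp_all
  have "snd n = (c' - c) / d" "snd (- n) = (c - c') / d"
    using d_eq(2) by (simp_all add: n_def field_simps)
  then have \<delta>_n: "\<delta> = pi / 2 - arcsin (snd n)" "\<delta>' = pi / 2 - arcsin (snd (- n))"
    by (simp_all only: \<delta>_eq)
  have "measure (marked_lborel f) (cball (x, c) r \<union> cball (y, c') r')
    = measure (marked_lborel f) (cball (x, c) r) + measure (marked_lborel f) (cball (y, c') r')
      - measure (marked_lborel f) (ball_slice (x, c) r n {t..})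
      - measure (marked_lborel f) (ball_slice (y, c') r' (- n) {d - t<..})"
    using radii by (intro measure_cball_Un_cball[OF neq _ _ d_eq(1) n_def t_def]) auto
  then show ?thesis
    unfolding caps_eq measure_cball_eq_interval_integral[OF radii(1,2)]
      measure_cball_eq_interval_integral[OF radii(3,4)]
    by (simp add: measure_cap_eq_interval_integral[OF norm_n(1) radii(1,2) bounds _ \<delta>_n(1)]
      measure_cap_eq_interval_integral[OF norm_n(2) radii(3,4) offset_bounds _ \<delta>_n(2)])
qed

theorem measure_exclusion_region:
  assumes pos: "0 < snd a" "0 < snd b" and neq: "a \<noteq> b"
  shows "measure (marked_lborel f) (exclusion_region a b) = Fun_F f (dist (fst a) (fst b)) (snd a) (snd b)"
proof -
  define R where "R = dH a b"
  have center: "hball_center a b = (fst a, snd a * cosh R)" "hball_center b a = (fst b, snd b * cosh R)"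
    and radius: "hball_radius a b = snd a * sinh R" "hball_radius b a = snd b * sinh R"
    by (simp_all add: hball_center_def hball_radius_def R_def dH_commute[of b a])
  have dist: "dist (hball_center a b) (hball_center b a)
    = sqrt ((dist (fst a) (fst b))\<^sup>2 + (snd a - snd b)\<^sup>2 * (cosh R)\<^sup>2)"
    by (simp add: center dist_prod_def dist_real_def flip: power_mult_distrib left_diff_distrib)
  have "measure (marked_lborel f) (exclusion_region a b)
    = measure (marked_lborel f) (cball (fst a, snd a * cosh R) (snd a * sinh R)
      \<union> cball (fst b, snd b * cosh R) (snd b * sinh R))"
    using pos by (simp add: exclusion_region_def hball_through_eq_cball center radius)
  also have "\<dots> = Fun_F f (dist (fst a) (fst b)) (snd a) (snd b)"
    unfolding Fun_F_def Let_def dH_def[symmetric] R_def[symmetric] dist[symmetric]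
  proof (rule measure_cball_Un_cball_eq_interval_integrals)
    show "0 < dist (hball_center a b) (hball_center b a)" using hball_center_neq[OF neq] by simp
    show "0 < snd a * sinh R" "0 < snd b * sinh R"
      using hball_radius_pos[OF pos neq] hball_radius_pos[OF pos(2,1) neq[symmetric]]
      by (simp_all add: radius)
    show "snd a * sinh R < snd a * cosh R" "snd b * sinh R < snd b * cosh R"
      using pos by (simp_all add: sinh_less_cosh_real)
  qed (use hball_triangle[OF pos] hball_triangle[OF pos(2,1)] in \<open>simp_all add: center radius dist_commute\<close>)
  finally show ?thesis .
qed

end

section \<open>Poisson processes\<close>

lemma borel_measurable_completion_AE:
  fixes f g :: "'a \<Rightarrow> 'b::{second_countable_topology, t2_space}"
  assumes [measurable]: "f \<in> borel_measurable (completion M)" and ae: "AE x in M. f x = g x"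
  shows "g \<in> borel_measurable (completion M)"
proof (rule measurableI)
  fix A :: "'b set" assume [measurable]: "A \<in> sets borel"
  have [measurable]: "Measurable.pred (completion M) (\<lambda>x. f x \<noteq> g x)"
    "Measurable.pred (completion M) (\<lambda>x. g x \<in> A \<and> f x \<noteq> g x)"
    using ae by (auto intro!: sets_completion_AE)
  have "g -` A \<inter> space (completion M)
    = {x \<in> space (completion M). (f x \<in> A \<and> \<not> f x \<noteq> g x) \<or> (g x \<in> A \<and> f x \<noteq> g x)}" by auto
  also have "\<dots> \<in> sets (completion M)" by measurable
  finally show "g -` A \<inter> space (completion M) \<in> sets (completion M)" .
qed simp

lemma poisson_mean_sums:
  fixes c :: real
  shows "(\<lambda>k. real k * (c ^ k / fact k * exp (- c))) sums c"
proof -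
  have "(\<lambda>k. c ^ k / fact k) sums exp c"
    using exp_converges[of c] by (simp add: divide_inverse mult.commute scaleR_conv_of_real)
  then have "(\<lambda>k. c * exp (- c) * (c ^ k / fact k)) sums (c * exp (- c) * exp c)" by (rule sums_mult)
  moreover have "c * exp (- c) * (c ^ k / fact k) = real (Suc k) * (c ^ Suc k / fact (Suc k) * exp (- c))"
    for k
    by (simp add: fact_Suc del: of_nat_Suc)
  moreover have "c * exp (- c) * exp c = c" by (simp add: exp_minus)
  ultimately have "(\<lambda>k. real (Suc k) * (c ^ Suc k / fact (Suc k) * exp (- c))) sums c"
    by (simp only:)
  then show ?thesis
    using sums_Suc_iff[of "\<lambda>k. real k * (c ^ k / fact k * exp (- c))" c] by simp
qed

lemma nn_integral_of_nat_eq_suminf: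
  fixes X :: "'w \<Rightarrow> nat"
  assumes [measurable]: "X \<in> measurable M (count_space UNIV)"
  shows "(\<integral>\<^sup>+\<omega>. of_nat (X \<omega>) \<partial>M) = (\<Sum>k. of_nat k * emeasure M {\<omega>\<in>space M. X \<omega> = k})"
proof -
  have "(\<integral>\<^sup>+\<omega>. of_nat (X \<omega>) \<partial>M) = (\<integral>\<^sup>+\<omega>. (\<Sum>k. of_nat k * indicator {\<omega>\<in>space M. X \<omega> = k} \<omega>) \<partial>M)"
  proof (rule nn_integral_cong)
    fix \<omega> assume "\<omega> \<in> space M"
    moreover have "(\<Sum>k. of_nat k * indicator {\<omega>\<in>space M. X \<omega> = k} \<omega> :: ennreal)
      = (\<Sum>k\<in>{X \<omega>}. of_nat k * indicator {\<omega>\<in>space M. X \<omega> = k} \<omega>)"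
      by (rule suminf_finite) auto
    ultimately show "(of_nat (X \<omega>) :: ennreal) = (\<Sum>k. of_nat k * indicator {\<omega>\<in>space M. X \<omega> = k} \<omega>)"
      by simp
  qed
  also have "\<dots> = (\<Sum>k. of_nat k * emeasure M {\<omega>\<in>space M. X \<omega> = k})"
    by (subst nn_integral_suminf) (auto simp: nn_integral_cmult_indicator)
  finally show ?thesis .
qed

locale poisson_process =
  fixes M :: "'w measure" and \<Phi> :: "'w \<Rightarrow> 'p set" and \<mu> :: "'p measure"
  assumes poisson: "poisson_pp M \<Phi> \<mu>"
begin

sublocale prob_space M
  using poisson by (simp add: poisson_pp_def)

definition void_prob :: "'p set \<Rightarrow> ennreal" where
  "void_prob B = ennreal (exp (- measure \<mu> B))"

context
  fixes B :: "'p set"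
  assumes B: "B \<in> sets \<mu>" "emeasure \<mu> B < \<infinity>"
begin

lemma AE_finite_points: "AE \<omega> in M. finite (\<Phi> \<omega> \<inter> B)"
  using poisson B by (simp add: poisson_pp_def)

lemma card_points_measurable: "(\<lambda>\<omega>. card (\<Phi> \<omega> \<inter> B)) \<in> measurable M (count_space UNIV)"
  using poisson B by (simp add: poisson_pp_def)

lemma prob_card_points: "prob {\<omega>\<in>space M. card (\<Phi> \<omega> \<inter> B) = k}
  = measure \<mu> B ^ k / fact k * exp (- measure \<mu> B)"
  using poisson B by (simp add: poisson_pp_def)

lemma AE_count_points:
  "AE \<omega> in M. of_nat (card (\<Phi> \<omega> \<inter> B)) = emeasure (count_space UNIV) (\<Phi> \<omega> \<inter> B)"
  using AE_finite_points by eventually_elim simp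

lemma count_points_measurable:
  "(\<lambda>\<omega>. emeasure (count_space UNIV) (\<Phi> \<omega> \<inter> B)) \<in> borel_measurable (completion M)"
  using card_points_measurable
  by (intro borel_measurable_completion_AE[OF measurable_completion AE_count_points]) measurable

lemma nn_integral_count_points: "(\<integral>\<^sup>+\<omega>. emeasure (count_space UNIV) (\<Phi> \<omega> \<inter> B) \<partial>M) = emeasure \<mu> B"
proof -
  have "(\<integral>\<^sup>+\<omega>. emeasure (count_space UNIV) (\<Phi> \<omega> \<inter> B) \<partial>M) = (\<integral>\<^sup>+\<omega>. of_nat (card (\<Phi> \<omega> \<inter> B)) \<partial>M)"
    using AE_count_points by (intro nn_integral_cong_AE) auto
  also have "\<dots> = (\<Sum>k. of_nat k * emeasure M {\<omega>\<in>space M. card (\<Phi> \<omega> \<inter> B) = k})"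
    by (rule nn_integral_of_nat_eq_suminf[OF card_points_measurable])
  also have "\<dots> = (\<Sum>k. ennreal (real k * (measure \<mu> B ^ k / fact k * exp (- measure \<mu> B))))"
    unfolding emeasure_eq_measure prob_card_points
    by (intro suminf_cong) (simp add: ennreal_of_nat_eq_real_of_nat flip: ennreal_mult)
  also have "\<dots> = ennreal (measure \<mu> B)"
    by (intro suminf_ennreal_eq poisson_mean_sums) auto
  also have "\<dots> = emeasure \<mu> B" using B by (simp add: emeasure_eq_ennreal_measure less_top)
  finally show ?thesis .
qed

end

lemma AE_no_points_in_null_set:
  assumes "B \<in> null_sets \<mu>"
  shows "AE \<omega> in M. \<Phi> \<omega> \<inter> B = {}"
proof -
  have B_finite: "B \<in> sets \<mu>" "emeasure \<mu> B < \<infinity>" using assms by auto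
  have "(\<integral>\<^sup>+\<omega>. emeasure (count_space UNIV) (\<Phi> \<omega> \<inter> B) \<partial>completion M) = 0"
    using assms by (simp add: nn_integral_completion nn_integral_count_points[OF B_finite] null_setsD1)
  then have "AE \<omega> in completion M. emeasure (count_space UNIV) (\<Phi> \<omega> \<inter> B) = 0"
    by (simp add: nn_integral_0_iff_AE[OF count_points_measurable[OF B_finite]])
  then show ?thesis by (simp add: AE_completion_iff emeasure_count_space_eq_0)
qed

lemma indep_card_points:
  fixes I :: "nat set"
  assumes "finite I" "\<forall>i\<in>I. B i \<in> sets \<mu> \<and> emeasure \<mu> (B i) < \<infinity>" "disjoint_family_on B I"
  shows "indep_vars (\<lambda>_. count_space UNIV) (\<lambda>i \<omega>. card (\<Phi> \<omega> \<inter> B i)) I"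
  using poisson assms by (simp add: poisson_pp_def)

lemma prob_one_one_zero:
  assumes sets: "B1 \<in> sets \<mu>" "B2 \<in> sets \<mu>" "B3 \<in> sets \<mu>"
    and fin: "emeasure \<mu> B1 < \<infinity>" "emeasure \<mu> B2 < \<infinity>" "emeasure \<mu> B3 < \<infinity>"
    and disj: "B1 \<inter> B2 = {}" "B1 \<inter> B3 = {}" "B2 \<inter> B3 = {}"
  shows "prob {\<omega>\<in>space M. card (\<Phi> \<omega> \<inter> B1) = 1 \<and> card (\<Phi> \<omega> \<inter> B2) = 1 \<and> card (\<Phi> \<omega> \<inter> B3) = 0}
    = measure \<mu> B1 * measure \<mu> B2 * exp (- (measure \<mu> B1 + measure \<mu> B2 + measure \<mu> B3))"
proof -
  define C where "C = (\<lambda>i::nat. if i = 0 then B1 else if i = 1 then B2 else B3)"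
  define A where "A = (\<lambda>i::nat. if i = 2 then {0::nat} else {1})"
  have "\<forall>i\<in>{0,1,2}. C i \<in> sets \<mu> \<and> emeasure \<mu> (C i) < \<infinity>" "disjoint_family_on C {0,1,2}"
    using sets fin disj by (auto simp: C_def disjoint_family_on_def)
  then have indep: "indep_vars (\<lambda>_. count_space UNIV) (\<lambda>i \<omega>. card (\<Phi> \<omega> \<inter> C i)) {0,1,2}"
    by (intro indep_card_points) auto
  have "{\<omega>\<in>space M. card (\<Phi> \<omega> \<inter> B1) = 1 \<and> card (\<Phi> \<omega> \<inter> B2) = 1 \<and> card (\<Phi> \<omega> \<inter> B3) = 0}
     = (\<Inter>i\<in>{0,1,2}. (\<lambda>\<omega>. card (\<Phi> \<omega> \<inter> C i)) -` A i \<inter> space M)"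
    by (auto simp: C_def A_def)
  also have "prob \<dots> = (\<Prod>i\<in>{0,1,2}. prob ((\<lambda>\<omega>. card (\<Phi> \<omega> \<inter> C i)) -` A i \<inter> space M))"
    by (rule indep_varsD[OF indep]) auto
  also have "\<dots> = prob {\<omega>\<in>space M. card (\<Phi> \<omega> \<inter> B1) = 1} * prob {\<omega>\<in>space M. card (\<Phi> \<omega> \<inter> B2) = 1}
      * prob {\<omega>\<in>space M. card (\<Phi> \<omega> \<inter> B3) = 0}"
    by (simp add: C_def A_def vimage_def Int_def conj_commute mult.assoc)
  also have "\<dots> = measure \<mu> B1 * measure \<mu> B2 * exp (- (measure \<mu> B1 + measure \<mu> B2 + measure \<mu> B3))"
    using sets fin by (simp add: prob_card_points exp_diff exp_minus exp_add field_simps)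
  finally show ?thesis .
qed

end

section \<open>Partitions generated by a countable basis\<close>

definition basis_seq :: "nat \<Rightarrow> 'a::second_countable_topology set" where
  "basis_seq = (SOME W. topological_basis (range W))"

lemma topological_basis_basis_seq: "topological_basis (range basis_seq)"
proof -
  obtain B :: "'a set set" where B_basis: "countable B" "topological_basis B" using ex_countable_basis
    by blast
  have "B \<noteq> {}" using topological_basisE[OF B_basis(2), of UNIV undefined] by auto
  then have "topological_basis (range (from_nat_into B))" using B_basis by (simp add: range_from_nat_into)
  then show ?thesis
    unfolding basis_seq_def by (rule someI[of "\<lambda>W. topological_basis (range W)"])
qed

lemma open_basis_seq: "open (basis_seq k)"
  by (rule topological_basis_open[OF topological_basis_basis_seq]) simp

lemma ex_basis_seq_subset:
  assumes "open X" "a \<in> X"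
  obtains k where "a \<in> basis_seq k" "basis_seq k \<subseteq> X"
  using topological_basisE[OF topological_basis_basis_seq assms] by auto

definition cell :: "nat \<Rightarrow> 'a::second_countable_topology \<Rightarrow> 'a set" where
  "cell n a = {x. \<forall>k<n. x \<in> basis_seq k \<longleftrightarrow> a \<in> basis_seq k}"

lemma in_cell_self: "a \<in> cell n a"
  by (simp add: cell_def)

lemma in_cell_iff: "x \<in> cell n a \<longleftrightarrow> cell n x = cell n a"
  by (auto simp: cell_def)

lemma cell_antimono: "m \<le> n \<Longrightarrow> cell n a \<subseteq> cell m a"
  by (auto simp: cell_def)

lemma cell_borel [measurable]: "cell n a \<in> sets borel"
proof -
  have [measurable]: "basis_seq k \<in> sets borel" for k :: nat
    by (intro borel_open open_basis_seq)
  show ?thesis unfolding cell_def by measurable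
qed

lemma finite_cells: "finite (range (cell n :: 'a::second_countable_topology \<Rightarrow> 'a set))" (is "finite ?C")
proof (rule finite_subset)
  show "?C \<subseteq> (\<lambda>S. {x. \<forall>k<n. x \<in> basis_seq k \<longleftrightarrow> k \<in> S}) ` Pow {..<n}"
  proof (rule image_subsetI)
    fix a :: 'a
    have "cell n a = {x. \<forall>k<n. x \<in> basis_seq k \<longleftrightarrow> k \<in> {k. k < n \<and> a \<in> basis_seq k}}"
      by (auto simp: cell_def)
    then show "cell n a \<in> (\<lambda>S. {x. \<forall>k<n. x \<in> basis_seq k \<longleftrightarrow> k \<in> S}) ` Pow {..<n}" by blast
  qed
qed simp

lemma eventually_cell_subset:
  assumes "open X" "a \<in> X"
  shows "\<forall>\<^sub>F n in sequentially. cell n a \<subseteq> X"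
proof -
  obtain k where k_nhds: "a \<in> basis_seq k" "basis_seq k \<subseteq> X" using ex_basis_seq_subset[OF assms] .
  show ?thesis
    using eventually_gt_at_top[of k] by eventually_elim (use k_nhds in \<open>auto simp: cell_def\<close>)
qed

section \<open>Expected number of isolated pairs\<close>

locale isolated_pairs = poisson_process M \<Phi> \<mu>
  for M :: "'w measure" and \<Phi> :: "'w \<Rightarrow> 'p::{second_countable_topology,t2_space} set" and \<mu> :: "'p measure" +
  fixes K :: "'p \<Rightarrow> 'p \<Rightarrow> 'p set" and H :: "'p set"
  assumes sets_mu [measurable_cong]: "sets \<mu> = sets borel"
    and sigma_finite_mu: "sigma_finite_measure \<mu>"
    and closed_graph: "closed {(a, b, c). c \<in> K a b}"
    and K_left: "a \<in> K a b" and K_right: "b \<in> K a b"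
    and K_locally_finite: "a \<in> H \<Longrightarrow> b \<in> H \<Longrightarrow> \<exists>X Y. open X \<and> open Y \<and> a \<in> X \<and> b \<in> Y \<and>
        emeasure \<mu> (closure (\<Union>a'\<in>X. \<Union>b'\<in>Y. K a' b')) < \<infinity>"
begin

sublocale mu: sigma_finite_measure \<mu>
  by (rule sigma_finite_mu)

lemma sets_mu_pair: "sets (\<mu> \<Otimes>\<^sub>M \<mu>) = sets borel"
  by (simp add: borel_prod[symmetric] cong: sets_pair_measure_cong[OF sets_mu sets_mu])

lemma void_prob_K_measurable: "(\<lambda>p. void_prob (K (fst p) (snd p))) \<in> borel_measurable borel"
proof -
  define Q where "Q = {x :: ('p \<times> 'p) \<times> 'p. snd x \<in> K (fst (fst x)) (snd (fst x))}"
  have "closed ((\<lambda>x. (fst (fst x), snd (fst x), snd x)) -` {(a, b, c). c \<in> K a b} :: (('p \<times> 'p) \<times> 'p) set)"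
    by (rule closed_vimage[OF closed_graph]) (intro continuous_intros)
  then have "Q \<in> sets borel" by (simp add: Q_def vimage_def borel_closed)
  moreover have "sets (borel \<Otimes>\<^sub>M \<mu>) = sets (borel :: (('p \<times> 'p) \<times> 'p) measure)"
    by (subst sets_pair_measure_cong[OF refl sets_mu]) (rule arg_cong[OF borel_prod])
  ultimately have "Q \<in> sets (borel \<Otimes>\<^sub>M \<mu>)" by simp
  from mu.measurable_emeasure_Pair[OF this]
  have [measurable]: "(\<lambda>p. emeasure \<mu> (K (fst p) (snd p))) \<in> borel_measurable borel"
    by (simp add: Q_def vimage_def)
  show ?thesis unfolding void_prob_def measure_def by measurable
qed

definition isolated :: "'w \<Rightarrow> ('p \<times> 'p) set" where
  "isolated \<omega> = {(a, b). a \<in> \<Phi> \<omega> \<and> b \<in> \<Phi> \<omega> \<and> \<Phi> \<omega> \<inter> K a b \<subseteq> {a, b}}"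

definition npairs :: "('p \<times> 'p) set \<Rightarrow> 'w \<Rightarrow> ennreal" where
  "npairs E \<omega> = emeasure (count_space UNIV) (E \<inter> isolated \<omega>)"

text \<open>Counts need not be measurable on the null set of configurations that are not locally finite,
  hence the completion.\<close>

definition mecke_formula :: "('p \<times> 'p) set \<Rightarrow> bool" where
  "mecke_formula E \<longleftrightarrow> npairs E \<in> borel_measurable (completion M) \<and>
     (\<integral>\<^sup>+\<omega>. npairs E \<omega> \<partial>M) = (\<integral>\<^sup>+p\<in>E. void_prob (K (fst p) (snd p)) \<partial>(\<mu> \<Otimes>\<^sub>M \<mu>))"

definition Khull :: "'p set \<Rightarrow> 'p set \<Rightarrow> 'p set" where
  "Khull X Y = closure (\<Union>a\<in>X. \<Union>b\<in>Y. K a b)"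

lemma Khull_borel [measurable]: "Khull X Y \<in> sets borel"
  by (simp add: Khull_def)

lemma Khull_mono: "X \<subseteq> X' \<Longrightarrow> Y \<subseteq> Y' \<Longrightarrow> Khull X Y \<subseteq> Khull X' Y'"
  unfolding Khull_def by (intro closure_mono UN_mono) auto

lemma K_subset_Khull: "a \<in> X \<Longrightarrow> b \<in> Y \<Longrightarrow> K a b \<subseteq> Khull X Y"
  unfolding Khull_def by (rule order_trans[OF _ closure_subset]) blast

lemma Un_subset_Khull:
  assumes "X \<noteq> {}" "Y \<noteq> {}"
  shows "X \<union> Y \<subseteq> Khull X Y"
proof -
  obtain x y where nonempty: "x \<in> X" "y \<in> Y" using assms by blast
  have "a \<in> Khull X Y" if "a \<in> X" for a using subsetD[OF K_subset_Khull[OF that nonempty(2)] K_left] .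
  moreover have "b \<in> Khull X Y" if "b \<in> Y" for b
    using subsetD[OF K_subset_Khull[OF nonempty(1) that] K_right] .
  ultimately show ?thesis by blast
qed

lemma emeasure_Khull_mono: "X \<subseteq> X' \<Longrightarrow> Y \<subseteq> Y' \<Longrightarrow> emeasure \<mu> (Khull X Y) \<le> emeasure \<mu> (Khull X' Y')"
  by (intro emeasure_mono Khull_mono) (auto simp: sets_mu)

lemma INT_Khull_cells:
  assumes "a \<in> U" "b \<in> V"
  shows "(\<Inter>n. Khull (U \<inter> cell n a) (V \<inter> cell n b)) = K a b"
proof (intro equalityI INT_greatest K_subset_Khull subsetI)
  fix c assume c_in_hulls: "c \<in> (\<Inter>n. Khull (U \<inter> cell n a) (V \<inter> cell n b))"
  show "c \<in> K a b"
  proof (rule ccontr)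
    assume "c \<notin> K a b"
    then have "(a, b, c) \<in> - {(a, b, c). c \<in> K a b}" by simp
    with closed_graph obtain X YZ where X_nhds: "open X" "a \<in> X" "open YZ" "(b, c) \<in> YZ"
      and sub: "X \<times> YZ \<subseteq> - {(a, b, c). c \<in> K a b}"
      by (metis open_Compl open_prod_elim mem_Sigma_iff)
    from X_nhds obtain Y Z where Y_nhds: "open Y" "b \<in> Y" and Z_nhds: "open Z" "c \<in> Z" "Y \<times> Z \<subseteq> YZ"
      by (metis open_prod_elim mem_Sigma_iff)
    have "\<forall>\<^sub>F n in sequentially. cell n a \<subseteq> X \<and> cell n b \<subseteq> Y"
      using X_nhds Y_nhds by (intro eventually_conj eventually_cell_subset) auto
    then obtain n where small_cells: "cell n a \<subseteq> X" "cell n b \<subseteq> Y"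
      by (auto simp: eventually_sequentially)
    have "Z \<inter> (\<Union>a'\<in>U \<inter> cell n a. \<Union>b'\<in>V \<inter> cell n b. K a' b') = {}"
      using small_cells sub Z_nhds by fastforce
    then have "Z \<inter> Khull (U \<inter> cell n a) (V \<inter> cell n b) = {}"
      using Z_nhds by (simp add: Khull_def open_Int_closure_eq_empty)
    with c_in_hulls Z_nhds show False by auto
  qed
qed (use assms in_cell_self in auto)

definition isolates :: "'p set \<Rightarrow> 'p set \<Rightarrow> 'w \<Rightarrow> bool" where
  "isolates X Y \<omega> \<longleftrightarrow> card (\<Phi> \<omega> \<inter> X) = 1 \<and> card (\<Phi> \<omega> \<inter> Y) = 1 \<and> card (\<Phi> \<omega> \<inter> (Khull X Y - (X \<union> Y))) = 0"

lemma isolates_iff: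
  assumes a_in: "a \<in> \<Phi> \<omega> \<inter> X" and b_in: "b \<in> \<Phi> \<omega> \<inter> Y" and disj: "X \<inter> Y = {}"
    and fin: "finite (\<Phi> \<omega> \<inter> Khull X Y)"
  shows "isolates X Y \<omega> \<longleftrightarrow> \<Phi> \<omega> \<inter> Khull X Y \<subseteq> {a, b}"
proof
  assume iso: "isolates X Y \<omega>"
  then have "\<Phi> \<omega> \<inter> X = {a}" "\<Phi> \<omega> \<inter> Y = {b}"
    using a_in b_in unfolding isolates_def by (metis card_1_singletonE singletonD)+
  moreover have "finite (\<Phi> \<omega> \<inter> (Khull X Y - (X \<union> Y)))"
    using fin by (rule rev_finite_subset) blast
  then have "\<Phi> \<omega> \<inter> (Khull X Y - (X \<union> Y)) = {}" using iso by (simp add: isolates_def)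
  ultimately show "\<Phi> \<omega> \<inter> Khull X Y \<subseteq> {a, b}" by blast
next
  assume sub: "\<Phi> \<omega> \<inter> Khull X Y \<subseteq> {a, b}"
  have "X \<union> Y \<subseteq> Khull X Y" using a_in b_in by (intro Un_subset_Khull) auto
  then have "\<Phi> \<omega> \<inter> X = {a}" "\<Phi> \<omega> \<inter> Y = {b}" using sub a_in b_in disj by blast+
  moreover from this sub have "\<Phi> \<omega> \<inter> (Khull X Y - (X \<union> Y)) = {}" by blast
  ultimately show "isolates X Y \<omega>" by (simp add: isolates_def)
qed

context
  fixes X Y :: "'p set"
  assumes XY [measurable]: "X \<in> sets borel" "Y \<in> sets borel" and disj: "X \<inter> Y = {}"
    and fin: "emeasure \<mu> (Khull X Y) < \<infinity>"
begin

lemma rectangle_finite: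
  assumes "X \<noteq> {}" "Y \<noteq> {}"
  shows "emeasure \<mu> X < \<infinity>" "emeasure \<mu> Y < \<infinity>" "emeasure \<mu> (Khull X Y - (X \<union> Y)) < \<infinity>"
proof -
  have "emeasure \<mu> Z < \<infinity>" if "Z \<subseteq> Khull X Y" for Z
    using emeasure_mono[of Z "Khull X Y" \<mu>] that fin by (auto simp: sets_mu)
  then show "emeasure \<mu> X < \<infinity>" "emeasure \<mu> Y < \<infinity>" "emeasure \<mu> (Khull X Y - (X \<union> Y)) < \<infinity>"
    using Un_subset_Khull[OF assms] by auto
qed

lemma isolates_sets [measurable]: "{\<omega>\<in>space M. isolates X Y \<omega>} \<in> sets M"
proof (cases "X = {} \<or> Y = {}")
  case False
  then have [measurable]:
    "(\<lambda>\<omega>. card (\<Phi> \<omega> \<inter> X)) \<in> measurable M (count_space UNIV)"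
    "(\<lambda>\<omega>. card (\<Phi> \<omega> \<inter> Y)) \<in> measurable M (count_space UNIV)"
    "(\<lambda>\<omega>. card (\<Phi> \<omega> \<inter> (Khull X Y - (X \<union> Y)))) \<in> measurable M (count_space UNIV)"
    using rectangle_finite by (auto intro!: card_points_measurable simp: sets_mu)
  show ?thesis unfolding isolates_def by measurable
qed (auto simp: isolates_def)

lemma emeasure_isolates:
  "emeasure M {\<omega>\<in>space M. isolates X Y \<omega>} = emeasure \<mu> X * emeasure \<mu> Y * void_prob (Khull X Y)"
proof (cases "X = {} \<or> Y = {}")
  case False
  let ?Z = "Khull X Y - (X \<union> Y)"
  have fmeasurable: "X \<in> fmeasurable \<mu>" "Y \<in> fmeasurable \<mu>" "?Z \<in> fmeasurable \<mu>"
    using False rectangle_finite by (auto intro!: fmeasurableI simp: sets_mu)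
  have "Khull X Y = X \<union> Y \<union> ?Z" using False Un_subset_Khull[of X Y] by auto
  then have "measure \<mu> (Khull X Y) = measure \<mu> (X \<union> Y \<union> ?Z)" by simp
  also have "\<dots> = measure \<mu> (X \<union> Y) + measure \<mu> ?Z"
    using fmeasurable by (intro measure_Un_AE fmeasurable.Un) auto
  also have "measure \<mu> (X \<union> Y) = measure \<mu> X + measure \<mu> Y"
    using fmeasurable disj by (intro measure_Un_AE) auto
  finally have "emeasure M {\<omega>\<in>space M. isolates X Y \<omega>}
    = ennreal (measure \<mu> X * measure \<mu> Y * exp (- measure \<mu> (Khull X Y)))"
    unfolding emeasure_eq_measure isolates_def using False rectangle_finite disj
    by (subst prob_one_one_zero) (auto simp: sets_mu)
  then show ?thesis
    using False rectangle_finite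
    by (simp add: void_prob_def ennreal_mult emeasure_eq_ennreal_measure[of \<mu>] less_top)
qed (auto simp: isolates_def)

end

context
  fixes U V :: "'p set"
  assumes [measurable]: "U \<in> sets borel" "V \<in> sets borel" and UV_disj: "U \<inter> V = {}"
    and UV_fin: "emeasure \<mu> (Khull U V) < \<infinity>"
begin

definition cell_pairs :: "nat \<Rightarrow> 'w \<Rightarrow> ('p \<times> 'p) set" where
  "cell_pairs n \<omega> = {(a, b). a \<in> \<Phi> \<omega> \<inter> U \<and> b \<in> \<Phi> \<omega> \<inter> V \<and> isolates (U \<inter> cell n a) (V \<inter> cell n b) \<omega>}"

lemma sub_rectangle_disjoint: "(U \<inter> X) \<inter> (V \<inter> Y) = {}"
  using UV_disj by blast

lemma sub_rectangle_finite: "emeasure \<mu> (Khull (U \<inter> X) (V \<inter> Y)) < \<infinity>"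
  by (rule le_less_trans[OF emeasure_Khull_mono UV_fin]) auto

lemma cell_pairs_iff:
  assumes "finite (\<Phi> \<omega> \<inter> Khull U V)"
  shows "(a, b) \<in> cell_pairs n \<omega> \<longleftrightarrow>
    a \<in> \<Phi> \<omega> \<inter> U \<and> b \<in> \<Phi> \<omega> \<inter> V \<and> \<Phi> \<omega> \<inter> Khull (U \<inter> cell n a) (V \<inter> cell n b) \<subseteq> {a, b}"
proof -
  have fin: "finite (\<Phi> \<omega> \<inter> Khull (U \<inter> cell n a) (V \<inter> cell n b))"
    using Khull_mono[of "U \<inter> cell n a" U "V \<inter> cell n b" V] by (intro finite_subset[OF _ assms]) auto
  show ?thesis
  proof (cases "a \<in> \<Phi> \<omega> \<inter> U \<and> b \<in> \<Phi> \<omega> \<inter> V")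
    case True
    then have "a \<in> \<Phi> \<omega> \<inter> (U \<inter> cell n a)" "b \<in> \<Phi> \<omega> \<inter> (V \<inter> cell n b)" by (auto simp: in_cell_self)
    from isolates_iff[OF this sub_rectangle_disjoint fin] True show ?thesis by (simp add: cell_pairs_def)
  qed (auto simp: cell_pairs_def)
qed

lemma incseq_cell_pairs:
  assumes "finite (\<Phi> \<omega> \<inter> Khull U V)"
  shows "incseq (\<lambda>n. cell_pairs n \<omega>)"
proof (intro incseq_SucI subrelI)
  fix n a b assume "(a, b) \<in> cell_pairs n \<omega>"
  moreover have "Khull (U \<inter> cell (Suc n) a) (V \<inter> cell (Suc n) b) \<subseteq> Khull (U \<inter> cell n a) (V \<inter> cell n b)"
    by (intro Khull_mono Int_mono order_refl cell_antimono) auto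
  ultimately show "(a, b) \<in> cell_pairs (Suc n) \<omega>" unfolding cell_pairs_iff[OF assms] by blast
qed

lemma UN_cell_pairs:
  assumes fin: "finite (\<Phi> \<omega> \<inter> Khull U V)"
  shows "(\<Union>n. cell_pairs n \<omega>) = U \<times> V \<inter> isolated \<omega>"
proof (intro equalityI subrelI)
  fix a b assume "(a, b) \<in> (\<Union>n. cell_pairs n \<omega>)"
  then obtain n where "(a, b) \<in> cell_pairs n \<omega>" by (rule UN_E)
  then have ab_in: "a \<in> \<Phi> \<omega> \<inter> U" "b \<in> \<Phi> \<omega> \<inter> V"
    and void: "\<Phi> \<omega> \<inter> Khull (U \<inter> cell n a) (V \<inter> cell n b) \<subseteq> {a, b}"
    unfolding cell_pairs_iff[OF fin] by simp_all
  have "K a b \<subseteq> Khull (U \<inter> cell n a) (V \<inter> cell n b)"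
    using ab_in in_cell_self by (intro K_subset_Khull) auto
  then have "\<Phi> \<omega> \<inter> K a b \<subseteq> {a, b}" using void by (rule order_trans[OF Int_mono[OF order_refl]])
  then show "(a, b) \<in> U \<times> V \<inter> isolated \<omega>" using ab_in by (simp add: isolated_def)
next
  fix a b assume ab_in: "(a, b) \<in> U \<times> V \<inter> isolated \<omega>"
  let ?F = "\<Phi> \<omega> \<inter> Khull U V - {a, b}"
  have "\<forall>\<^sub>F n in sequentially. x \<notin> Khull (U \<inter> cell n a) (V \<inter> cell n b)" if "x \<in> ?F" for x
  proof -
    have "x \<notin> K a b" using ab_in that by (auto simp: isolated_def)
    then obtain m where x_notin: "x \<notin> Khull (U \<inter> cell m a) (V \<inter> cell m b)"
      using INT_Khull_cells[of a U b V] ab_in by auto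
    have "Khull (U \<inter> cell n a) (V \<inter> cell n b) \<subseteq> Khull (U \<inter> cell m a) (V \<inter> cell m b)" if "m \<le> n" for n
      using that by (intro Khull_mono Int_mono order_refl cell_antimono)
    with x_notin show ?thesis unfolding eventually_sequentially by blast
  qed
  then have "\<forall>\<^sub>F n in sequentially. \<forall>x\<in>?F. x \<notin> Khull (U \<inter> cell n a) (V \<inter> cell n b)"
    using fin by (intro eventually_ball_finite) auto
  then obtain n where "\<forall>x\<in>?F. x \<notin> Khull (U \<inter> cell n a) (V \<inter> cell n b)"
    by (auto simp: eventually_sequentially)
  moreover have "Khull (U \<inter> cell n a) (V \<inter> cell n b) \<subseteq> Khull U V" by (intro Khull_mono) auto
  ultimately have "(a, b) \<in> cell_pairs n \<omega>"
    unfolding cell_pairs_iff[OF fin] using ab_in by (auto simp: isolated_def)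
  then show "(a, b) \<in> (\<Union>n. cell_pairs n \<omega>)" by blast
qed

lemma emeasure_cell_pairs:
  assumes \<omega>_in: "\<omega> \<in> space M"
  shows "emeasure (count_space UNIV) (cell_pairs n \<omega>)
    = (\<Sum>(X, Y)\<in>range (cell n) \<times> range (cell n). indicator {\<omega>\<in>space M. isolates (U \<inter> X) (V \<inter> Y) \<omega>} \<omega>)"
proof -
  let ?I = "range (cell n) \<times> range (cell n) :: ('p set \<times> 'p set) set"
  define P where
    "P = (\<lambda>(X, Y). if isolates (U \<inter> X) (V \<inter> Y) \<omega> then (\<Phi> \<omega> \<inter> (U \<inter> X)) \<times> (\<Phi> \<omega> \<inter> (V \<inter> Y)) else {})"
  have mem: "p \<in> P i \<longleftrightarrow> i = (cell n (fst p), cell n (snd p)) \<and> p \<in> cell_pairs n \<omega>" if i_in: "i \<in> ?I" for p i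
  proof -
    obtain x y where "i = (cell n x, cell n y)" using i_in by auto
    then show ?thesis by (cases p) (auto simp: P_def cell_pairs_def in_cell_iff)
  qed
  have "cell_pairs n \<omega> = (\<Union>i\<in>?I. P i)"
  proof (intro equalityI subsetI)
    fix p assume "p \<in> cell_pairs n \<omega>"
    then show "p \<in> (\<Union>i\<in>?I. P i)" by (intro UN_I[of "(cell n (fst p), cell n (snd p))"]) (simp_all add: mem)
  next
    fix p assume "p \<in> (\<Union>i\<in>?I. P i)"
    then show "p \<in> cell_pairs n \<omega>" using mem by (elim UN_E) simp
  qed
  moreover have "disjoint_family_on P ?I"
    unfolding disjoint_family_on_def
  proof (intro ballI impI)
    fix i j assume "i \<in> ?I" "j \<in> ?I" "i \<noteq> j"
    then show "P i \<inter> P j = {}" using mem[of i] mem[of j] by (auto simp: disjoint_iff)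
  qed
  ultimately have "emeasure (count_space UNIV) (cell_pairs n \<omega>)
    = (\<Sum>i\<in>?I. emeasure (count_space UNIV) (P i))"
    by (simp add: sum_emeasure finite_cells)
  also have "emeasure (count_space UNIV) (P (X, Y)) = indicator {\<omega>\<in>space M. isolates (U \<inter> X) (V \<inter> Y) \<omega>} \<omega>"
    for X Y
  proof (cases "isolates (U \<inter> X) (V \<inter> Y) \<omega>")
    case True
    then obtain a b where "\<Phi> \<omega> \<inter> (U \<inter> X) = {a}" "\<Phi> \<omega> \<inter> (V \<inter> Y) = {b}"
      unfolding isolates_def by (metis card_1_singletonE)
    then show ?thesis using True \<omega>_in by (simp add: P_def)
  qed (simp add: P_def)
  then have "(\<Sum>i\<in>?I. emeasure (count_space UNIV) (P i))
    = (\<Sum>(X, Y)\<in>?I. indicator {\<omega>\<in>space M. isolates (U \<inter> X) (V \<inter> Y) \<omega>} \<omega>)"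
    by (intro sum.cong) auto
  finally show ?thesis .
qed

lemma void_prob_cells_eq_sum:
  "void_prob (Khull (U \<inter> cell n (fst p)) (V \<inter> cell n (snd p))) * indicator (U \<times> V) p
    = (\<Sum>(X, Y)\<in>range (cell n) \<times> range (cell n). void_prob (Khull (U \<inter> X) (V \<inter> Y))
      * indicator ((U \<inter> X) \<times> (V \<inter> Y)) p)"
proof -
  let ?I = "range (cell n) \<times> range (cell n) :: ('p set \<times> 'p set) set"
  have "(\<Sum>(X, Y)\<in>?I. void_prob (Khull (U \<inter> X) (V \<inter> Y)) * indicator ((U \<inter> X) \<times> (V \<inter> Y)) p)
    = (\<Sum>XY\<in>?I. if (cell n (fst p), cell n (snd p)) = XY
        then void_prob (Khull (U \<inter> fst XY) (V \<inter> snd XY)) * indicator (U \<times> V) p else 0)"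
    by (intro sum.cong refl) (auto simp: indicator_def in_cell_iff split: prod.splits)
  also have "\<dots> = void_prob (Khull (U \<inter> cell n (fst p)) (V \<inter> cell n (snd p))) * indicator (U \<times> V) p"
    by (subst sum.delta'; simp add: finite_cells)
  finally show ?thesis by simp
qed

lemma count_cell_pairs_measurable: "(\<lambda>\<omega>. emeasure (count_space UNIV) (cell_pairs n \<omega>)) \<in> borel_measurable M"
proof -
  have "(\<lambda>\<omega>. \<Sum>(X, Y)\<in>range (cell n) \<times> range (cell n).
      indicator {\<omega>\<in>space M. isolates (U \<inter> X) (V \<inter> Y) \<omega>} \<omega> :: ennreal) \<in> borel_measurable M"
    using sub_rectangle_disjoint sub_rectangle_finite
    by (intro borel_measurable_sum) (auto intro!: borel_measurable_indicator isolates_sets)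
  then show ?thesis by (simp add: emeasure_cell_pairs cong: measurable_cong)
qed

lemma nn_integral_cell_pairs:
  "(\<integral>\<^sup>+\<omega>. emeasure (count_space UNIV) (cell_pairs n \<omega>) \<partial>M)
    = (\<integral>\<^sup>+p\<in>U \<times> V. void_prob (Khull (U \<inter> cell n (fst p)) (V \<inter> cell n (snd p))) \<partial>(\<mu> \<Otimes>\<^sub>M \<mu>))"
proof -
  let ?I = "range (cell n) \<times> range (cell n) :: ('p set \<times> 'p set) set"
  have "(\<integral>\<^sup>+\<omega>. emeasure (count_space UNIV) (cell_pairs n \<omega>) \<partial>M)
    = (\<integral>\<^sup>+\<omega>. (\<Sum>i\<in>?I. indicator {\<omega>\<in>space M. isolates (U \<inter> fst i) (V \<inter> snd i) \<omega>} \<omega>) \<partial>M)"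
    by (intro nn_integral_cong) (simp add: emeasure_cell_pairs case_prod_unfold)
  also have "\<dots> = (\<Sum>i\<in>?I. emeasure M {\<omega>\<in>space M. isolates (U \<inter> fst i) (V \<inter> snd i) \<omega>})"
    using sub_rectangle_disjoint sub_rectangle_finite
    by (subst nn_integral_sum) (auto intro!: borel_measurable_indicator isolates_sets sum.cong)
  also have "\<dots> = (\<Sum>i\<in>?I. void_prob (Khull (U \<inter> fst i) (V \<inter> snd i))
    * emeasure (\<mu> \<Otimes>\<^sub>M \<mu>) ((U \<inter> fst i) \<times> (V \<inter> snd i)))"
    using sub_rectangle_disjoint sub_rectangle_finite
    by (intro sum.cong refl) (auto simp: emeasure_isolates mu.emeasure_pair_measure_Times sets_mu mult_ac)
  also have "\<dots> = (\<integral>\<^sup>+p. (\<Sum>i\<in>?I. void_prob (Khull (U \<inter> fst i) (V \<inter> snd i))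
    * indicator ((U \<inter> fst i) \<times> (V \<inter> snd i)) p) \<partial>(\<mu> \<Otimes>\<^sub>M \<mu>))"
    by (subst nn_integral_sum) (auto simp: nn_integral_cmult_indicator sets_mu intro!: sum.cong)
  finally show ?thesis by (simp add: void_prob_cells_eq_sum case_prod_unfold)
qed

lemma void_prob_cells_measurable:
  "(\<lambda>p. void_prob (Khull (U \<inter> cell n (fst p)) (V \<inter> cell n (snd p))) * indicator (U \<times> V) p)
    \<in> borel_measurable (\<mu> \<Otimes>\<^sub>M \<mu>)"
  unfolding void_prob_cells_eq_sum case_prod_unfold
  by (intro borel_measurable_sum borel_measurable_times_ennreal borel_measurable_indicator pair_measureI)
    (auto simp: sets_mu)

lemma void_prob_cells_mono:
  assumes "m \<le> n"
  shows "void_prob (Khull (U \<inter> cell m a) (V \<inter> cell m b)) \<le> void_prob (Khull (U \<inter> cell n a) (V \<inter> cell n b))"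
proof -
  have "measure \<mu> (Khull (U \<inter> cell n a) (V \<inter> cell n b)) \<le> measure \<mu> (Khull (U \<inter> cell m a) (V \<inter> cell m b))"
    using assms sub_rectangle_finite
    by (intro measure_mono_fmeasurable Khull_mono Int_mono order_refl cell_antimono fmeasurableI)
      (auto simp: sets_mu)
  then show ?thesis by (simp add: void_prob_def ennreal_leI)
qed

lemma SUP_void_prob_cells:
  assumes "a \<in> U" "b \<in> V"
  shows "(SUP n. void_prob (Khull (U \<inter> cell n a) (V \<inter> cell n b))) = void_prob (K a b)"
proof -
  let ?A = "\<lambda>n. Khull (U \<inter> cell n a) (V \<inter> cell n b)"
  have "(\<lambda>n. measure \<mu> (?A n)) \<longlonglongrightarrow> measure \<mu> (\<Inter>n. ?A n)"
  proof (rule Lim_measure_decseq)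
    show "decseq ?A" by (intro decseq_SucI Khull_mono Int_mono order_refl cell_antimono) auto
    show "emeasure \<mu> (?A n) \<noteq> \<infinity>" for n using sub_rectangle_finite[of "cell n a" "cell n b"] by simp
  qed (auto simp: sets_mu)
  then have "(\<lambda>n. void_prob (?A n)) \<longlonglongrightarrow> void_prob (K a b)"
    unfolding void_prob_def INT_Khull_cells[OF assms] by (intro tendsto_intros)
  moreover have "(\<lambda>n. void_prob (?A n)) \<longlonglongrightarrow> (SUP n. void_prob (?A n))"
    by (intro LIMSEQ_SUP monoI void_prob_cells_mono)
  ultimately show ?thesis by (rule LIMSEQ_unique[rotated])
qed

lemma AE_npairs_rectangle: "AE \<omega> in M. (SUP n. emeasure (count_space UNIV) (cell_pairs n \<omega>))
  = npairs (U \<times> V) \<omega>"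
proof -
  have "AE \<omega> in M. finite (\<Phi> \<omega> \<inter> Khull U V)"
    using UV_fin by (intro AE_finite_points) (auto simp: sets_mu)
  then show ?thesis
  proof eventually_elim
    case (elim \<omega>)
    then show ?case
      using SUP_emeasure_incseq[of "\<lambda>n. cell_pairs n \<omega>" "count_space UNIV"] incseq_cell_pairs[OF elim]
      by (simp add: npairs_def UN_cell_pairs[OF elim])
  qed
qed

lemma mecke_formula_rectangle: "mecke_formula (U \<times> V)"
  unfolding mecke_formula_def
proof
  show "npairs (U \<times> V) \<in> borel_measurable (completion M)"
    using count_cell_pairs_measurable
    by (intro borel_measurable_completion_AE[OF measurable_completion AE_npairs_rectangle]
      borel_measurable_SUP) auto
  have "(\<integral>\<^sup>+\<omega>. npairs (U \<times> V) \<omega> \<partial>M) = (\<integral>\<^sup>+\<omega>. (SUP n. emeasure (count_space UNIV) (cell_pairs n \<omega>)) \<partial>M)"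
    using AE_npairs_rectangle by (intro nn_integral_cong_AE) auto
  also have "\<dots> = (SUP n. \<integral>\<^sup>+\<omega>. emeasure (count_space UNIV) (cell_pairs n \<omega>) \<partial>M)"
  proof (rule nn_integral_monotone_convergence_SUP_AE)
    fix n
    have "AE \<omega> in M. finite (\<Phi> \<omega> \<inter> Khull U V)"
      using UV_fin by (intro AE_finite_points) (auto simp: sets_mu)
    then show "AE \<omega> in M. emeasure (count_space UNIV) (cell_pairs n \<omega>)
      \<le> emeasure (count_space UNIV) (cell_pairs (Suc n) \<omega>)"
      by eventually_elim (auto intro!: emeasure_mono dest: incseq_cell_pairs incseq_SucD)
  qed (rule count_cell_pairs_measurable)
  also have "\<dots> = (SUP n. \<integral>\<^sup>+p\<in>U \<times> V. void_prob (Khull (U \<inter> cell n (fst p)) (V \<inter> cell n (snd p))) \<partial>(\<mu> \<Otimes>\<^sub>M \<mu>))"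
    by (simp add: nn_integral_cell_pairs)
  also have "\<dots> = (\<integral>\<^sup>+p. (SUP n. void_prob (Khull (U \<inter> cell n (fst p)) (V \<inter> cell n (snd p)))
    * indicator (U \<times> V) p) \<partial>(\<mu> \<Otimes>\<^sub>M \<mu>))"
    by (intro nn_integral_monotone_convergence_SUP[symmetric] void_prob_cells_measurable incseq_SucI le_funI
      mult_right_mono void_prob_cells_mono) auto
  also have "\<dots> = (\<integral>\<^sup>+p\<in>U \<times> V. void_prob (K (fst p) (snd p)) \<partial>(\<mu> \<Otimes>\<^sub>M \<mu>))"
    by (intro nn_integral_cong) (auto simp: indicator_def SUP_void_prob_cells)
  finally show "(\<integral>\<^sup>+\<omega>. npairs (U \<times> V) \<omega> \<partial>M) = (\<integral>\<^sup>+p\<in>U \<times> V. void_prob (K (fst p) (snd p)) \<partial>(\<mu> \<Otimes>\<^sub>M \<mu>))" .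
qed

end

lemma mecke_formula_empty: "mecke_formula {}"
proof -
  have "npairs {} = (\<lambda>\<omega>. 0)" by (simp add: fun_eq_iff npairs_def)
  then show ?thesis by (simp add: mecke_formula_def)
qed

lemma mecke_formula_UN:
  assumes disj: "disjoint_family A" and A_formula: "\<And>i :: nat. A i \<in> sets borel" "\<And>i. mecke_formula (A i)"
  shows "mecke_formula (\<Union>i. A i)"
  unfolding mecke_formula_def
proof
  have [measurable]: "A i \<in> sets (\<mu> \<Otimes>\<^sub>M \<mu>)" for i using A_formula(1) sets_mu_pair by simp
  have [measurable]: "(\<lambda>p. void_prob (K (fst p) (snd p))) \<in> borel_measurable (\<mu> \<Otimes>\<^sub>M \<mu>)"
    by (simp add: measurable_cong_sets[OF sets_mu_pair refl] void_prob_K_measurable)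
  have [measurable]: "npairs (A i) \<in> borel_measurable (completion M)" for i
    using A_formula(2) by (simp add: mecke_formula_def)
  have npairs: "npairs (\<Union>i. A i) \<omega> = (\<Sum>i. npairs (A i) \<omega>)" for \<omega>
  proof -
    have "(\<Union>i. A i) \<inter> isolated \<omega> = (\<Union>i. A i \<inter> isolated \<omega>)" by blast
    moreover have "disjoint_family (\<lambda>i. A i \<inter> isolated \<omega>)" using disj by (auto simp: disjoint_family_on_def)
    ultimately show ?thesis by (simp add: npairs_def suminf_emeasure)
  qed
  then show "npairs (\<Union>i. A i) \<in> borel_measurable (completion M)" by (simp cong: measurable_cong)
  have "(\<integral>\<^sup>+\<omega>. npairs (\<Union>i. A i) \<omega> \<partial>M) = (\<integral>\<^sup>+\<omega>. (\<Sum>i. npairs (A i) \<omega>) \<partial>completion M)"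
    by (simp add: npairs nn_integral_completion)
  also have "\<dots> = (\<Sum>i. \<integral>\<^sup>+\<omega>. npairs (A i) \<omega> \<partial>M)"
    by (subst nn_integral_suminf) (simp_all add: nn_integral_completion)
  also have "\<dots> = (\<Sum>i. \<integral>\<^sup>+p\<in>A i. void_prob (K (fst p) (snd p)) \<partial>(\<mu> \<Otimes>\<^sub>M \<mu>))"
    using A_formula(2) by (simp add: mecke_formula_def)
  also have "\<dots> = (\<integral>\<^sup>+p\<in>(\<Union>i. A i). void_prob (K (fst p) (snd p)) \<partial>(\<mu> \<Otimes>\<^sub>M \<mu>))"
    by (subst nn_integral_suminf[symmetric]) (simp_all add: suminf_indicator[OF disj, symmetric])
  finally show "(\<integral>\<^sup>+\<omega>. npairs (\<Union>i. A i) \<omega> \<partial>M) = (\<integral>\<^sup>+p\<in>(\<Union>i. A i). void_prob (K (fst p) (snd p)) \<partial>(\<mu> \<Otimes>\<^sub>M \<mu>))" .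
qed

lemma mecke_formula_Diff:
  assumes sets: "A \<in> sets borel" "B \<in> sets borel" and "A \<subseteq> B"
    and formulas: "mecke_formula A" "mecke_formula B"
    and fin: "(\<integral>\<^sup>+p\<in>A. void_prob (K (fst p) (snd p)) \<partial>(\<mu> \<Otimes>\<^sub>M \<mu>)) < \<infinity>"
  shows "mecke_formula (B - A)"
  unfolding mecke_formula_def
proof
  let ?v = "\<lambda>p. void_prob (K (fst p) (snd p))"
  have [measurable]: "A \<in> sets (\<mu> \<Otimes>\<^sub>M \<mu>)" "B \<in> sets (\<mu> \<Otimes>\<^sub>M \<mu>)" using sets sets_mu_pair by simp_all
  have [measurable]: "?v \<in> borel_measurable (\<mu> \<Otimes>\<^sub>M \<mu>)"
    by (simp add: measurable_cong_sets[OF sets_mu_pair refl] void_prob_K_measurable)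
  have [measurable]: "npairs A \<in> borel_measurable (completion M)"
    "npairs B \<in> borel_measurable (completion M)"
    using formulas by (simp_all add: mecke_formula_def)
  have fin_npairs: "(\<integral>\<^sup>+\<omega>. npairs A \<omega> \<partial>completion M) \<noteq> \<infinity>"
    using formulas(1) fin by (simp add: mecke_formula_def nn_integral_completion)
  then have "AE \<omega> in completion M. npairs A \<omega> \<noteq> \<infinity>" by (intro nn_integral_noteq_infinite) auto
  then have "AE \<omega> in M. npairs A \<omega> \<noteq> \<infinity>" by (simp add: AE_completion_iff)
  then have diff: "AE \<omega> in M. npairs B \<omega> - npairs A \<omega> = npairs (B - A) \<omega>"
  proof eventually_elim
    case (elim \<omega>)
    have "(B - A) \<inter> isolated \<omega> = B \<inter> isolated \<omega> - A \<inter> isolated \<omega>" by blast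
    moreover have "A \<inter> isolated \<omega> \<subseteq> B \<inter> isolated \<omega>" using \<open>A \<subseteq> B\<close> by blast
    ultimately show ?case using elim by (simp add: npairs_def emeasure_Diff)
  qed
  have npairs_le: "npairs A \<omega> \<le> npairs B \<omega>" for \<omega>
    using \<open>A \<subseteq> B\<close> by (auto simp: npairs_def intro!: emeasure_mono)
  show "npairs (B - A) \<in> borel_measurable (completion M)"
    by (rule borel_measurable_completion_AE[OF _ diff]) measurable
  have "(\<integral>\<^sup>+\<omega>. npairs (B - A) \<omega> \<partial>M) = (\<integral>\<^sup>+\<omega>. npairs B \<omega> - npairs A \<omega> \<partial>completion M)"
    using diff by (auto simp: nn_integral_completion intro!: nn_integral_cong_AE)
  also have "\<dots> = (\<integral>\<^sup>+\<omega>. npairs B \<omega> \<partial>M) - (\<integral>\<^sup>+\<omega>. npairs A \<omega> \<partial>M)"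
    using fin_npairs npairs_le by (subst nn_integral_diff) (simp_all add: nn_integral_completion)
  also have "\<dots> = (\<integral>\<^sup>+p\<in>B. ?v p \<partial>(\<mu> \<Otimes>\<^sub>M \<mu>)) - (\<integral>\<^sup>+p\<in>A. ?v p \<partial>(\<mu> \<Otimes>\<^sub>M \<mu>))"
    using formulas by (simp add: mecke_formula_def)
  also have "\<dots> = (\<integral>\<^sup>+p. ?v p * indicator B p - ?v p * indicator A p \<partial>(\<mu> \<Otimes>\<^sub>M \<mu>))"
    using fin \<open>A \<subseteq> B\<close> by (intro nn_integral_diff[symmetric]) (auto simp: indicator_def)
  also have "\<dots> = (\<integral>\<^sup>+p\<in>B - A. ?v p \<partial>(\<mu> \<Otimes>\<^sub>M \<mu>))"
    using \<open>A \<subseteq> B\<close> by (intro nn_integral_cong) (auto simp: indicator_def void_prob_def)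
  finally show "(\<integral>\<^sup>+\<omega>. npairs (B - A) \<omega> \<partial>M) = (\<integral>\<^sup>+p\<in>B - A. ?v p \<partial>(\<mu> \<Otimes>\<^sub>M \<mu>))" .
qed

lemma nn_integral_void_prob_finite:
  assumes rectangle: "U \<in> sets borel" "V \<in> sets borel" "U \<inter> V = {}" and fin: "emeasure \<mu> (Khull U V) < \<infinity>"
    and "E \<subseteq> U \<times> V"
  shows "(\<integral>\<^sup>+p\<in>E. void_prob (K (fst p) (snd p)) \<partial>(\<mu> \<Otimes>\<^sub>M \<mu>)) < \<infinity>"
proof (cases "U = {} \<or> V = {}")
  case True
  then show ?thesis using \<open>E \<subseteq> U \<times> V\<close> by auto
next
  case False
  have "(\<integral>\<^sup>+p\<in>E. void_prob (K (fst p) (snd p)) \<partial>(\<mu> \<Otimes>\<^sub>M \<mu>)) \<le> (\<integral>\<^sup>+p. indicator (U \<times> V) p \<partial>(\<mu> \<Otimes>\<^sub>M \<mu>))"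
    using \<open>E \<subseteq> U \<times> V\<close> by (intro nn_integral_mono) (auto simp: indicator_def void_prob_def)
  also have "\<dots> = emeasure \<mu> U * emeasure \<mu> V"
    using rectangle by (simp add: mu.emeasure_pair_measure_Times sets_mu)
  also have "\<dots> < \<infinity>" using rectangle_finite[OF rectangle fin] False by (simp add: ennreal_mult_less_top)
  finally show ?thesis .
qed

lemma mecke_formula_in_rectangle:
  assumes rectangle: "U \<in> sets borel" "V \<in> sets borel" "U \<inter> V = {}" and fin: "emeasure \<mu> (Khull U V) < \<infinity>"
    and E_borel: "E \<in> sets borel"
  shows "mecke_formula (E \<inter> U \<times> V)"
proof -
  let ?G = "{A \<times> B | A B. A \<in> sets (borel :: 'p measure) \<and> B \<in> sets (borel :: 'p measure)}"
  have sigma: "sets (borel :: ('p \<times> 'p) measure) = sigma_sets UNIV ?G"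
    unfolding borel_prod[symmetric] sets_pair_measure by simp
  have UV_borel: "U \<times> V \<in> sets borel" using rectangle(1,2) by (simp add: borel_prod[symmetric])
  have rect: "mecke_formula (A \<times> B \<inter> U \<times> V)" if borel: "A \<in> sets borel" "B \<in> sets borel" for A B
  proof -
    have "emeasure \<mu> (Khull (A \<inter> U) (B \<inter> V)) < \<infinity>"
      by (rule le_less_trans[OF emeasure_Khull_mono fin]) auto
    then show ?thesis
      unfolding Times_Int_Times using borel rectangle by (intro mecke_formula_rectangle) auto
  qed
  have "Int_stable ?G" by (rule Int_stable_pair_measure_generator)
  moreover have "?G \<subseteq> Pow UNIV" by simp
  moreover have "E \<in> sigma_sets UNIV ?G" using E_borel sigma by simp
  ultimately show ?thesis
  proof (induction rule: sigma_sets_induct_disjoint)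
    case (basic A)
    then show ?case using rect by blast
  next
    case empty
    then show ?case by (simp add: mecke_formula_empty)
  next
    case (compl A)
    have "A \<in> sets borel" using compl(1) sigma by simp
    then have A_borel: "A \<inter> U \<times> V \<in> sets borel" using UV_borel by (rule sets.Int)
    have "(UNIV - A) \<inter> U \<times> V = U \<times> V - A \<inter> U \<times> V" by blast
    moreover have "mecke_formula (U \<times> V - A \<inter> U \<times> V)"
      using compl(2) A_borel UV_borel rect[of UNIV UNIV]
        nn_integral_void_prob_finite[OF rectangle fin, of "A \<inter> U \<times> V"]
      by (intro mecke_formula_Diff) simp_all
    ultimately show ?case by simp
  next
    case (union A)
    have "A i \<in> sets borel" for i using union(2) sigma by blast
    then have "mecke_formula (\<Union>i. A i \<inter> U \<times> V)"
      using union(1,3) UV_borel by (intro mecke_formula_UN sets.Int) (auto simp: disjoint_family_on_def)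
    then show ?case by simp
  qed
qed

lemma ex_basis_rectangle:
  assumes "a \<in> H" "b \<in> H" "a \<noteq> b"
  obtains i j where "a \<in> basis_seq i" "b \<in> basis_seq j" "(basis_seq i :: 'p set) \<inter> basis_seq j = {}"
    "emeasure \<mu> (Khull (basis_seq i) (basis_seq j)) < \<infinity>"
proof -
  obtain X Y where hull_finite: "open X" "open Y" "a \<in> X" "b \<in> Y" "emeasure \<mu> (Khull X Y) < \<infinity>"
    using K_locally_finite[OF assms(1,2)] unfolding Khull_def by auto
  obtain X' Y' where separated: "open X'" "open Y'" "a \<in> X'" "b \<in> Y'" "X' \<inter> Y' = {}"
    using hausdorff[OF assms(3)] by blast
  obtain i where i_basis: "a \<in> basis_seq i" "basis_seq i \<subseteq> X \<inter> X'"
    by (rule ex_basis_seq_subset[of "X \<inter> X'" a]) (use hull_finite separated in auto)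
  obtain j where j_basis: "b \<in> basis_seq j" "basis_seq j \<subseteq> Y \<inter> Y'"
    by (rule ex_basis_seq_subset[of "Y \<inter> Y'" b]) (use hull_finite separated in auto)
  have "emeasure \<mu> (Khull (basis_seq i) (basis_seq j)) < \<infinity>"
    by (rule le_less_trans[OF emeasure_Khull_mono hull_finite(5)]) (use i_basis j_basis in auto)
  moreover have "(basis_seq i :: 'p set) \<inter> basis_seq j = {}" using i_basis j_basis separated by blast
  ultimately show ?thesis using that i_basis j_basis by blast
qed

lemma countable_rectangle_cover:
  assumes E_sub: "E \<subseteq> H \<times> H" and off_diagonal: "\<And>a. (a, a) \<notin> E"
  obtains U V :: "nat \<Rightarrow> 'p set" where "\<And>k. open (U k)" "\<And>k. open (V k)" "\<And>k. U k \<inter> V k = {}"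
    "\<And>k. emeasure \<mu> (Khull (U k) (V k)) < \<infinity>" "E \<subseteq> (\<Union>k. U k \<times> V k)"
proof -
  define admissible where "admissible = (\<lambda>(i, j). (basis_seq i :: 'p set) \<inter> basis_seq j = {}
    \<and> emeasure \<mu> (Khull (basis_seq i) (basis_seq j)) < \<infinity>)"
  define U where "U = (\<lambda>k. if admissible (prod_decode k) then basis_seq (fst (prod_decode k)) else {} :: 'p set)"
  define V where "V = (\<lambda>k. if admissible (prod_decode k) then basis_seq (snd (prod_decode k)) else {} :: 'p set)"
  have "E \<subseteq> (\<Union>k. U k \<times> V k)"
  proof (rule subrelI)
    fix a b assume "(a, b) \<in> E"
    then have "a \<in> H" "b \<in> H" "a \<noteq> b" using E_sub off_diagonal by auto
    then obtain i j where "a \<in> basis_seq i" "b \<in> basis_seq j"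
      "(basis_seq i :: 'p set) \<inter> basis_seq j = {}"
      "emeasure \<mu> (Khull (basis_seq i) (basis_seq j)) < \<infinity>"
      by (rule ex_basis_rectangle)
    then have "(a, b) \<in> U (prod_encode (i, j)) \<times> V (prod_encode (i, j))" by (simp add: U_def V_def admissible_def)
    then show "(a, b) \<in> (\<Union>k. U k \<times> V k)" by blast
  qed
  moreover have "open (U k)" "open (V k)" for k
    by (simp_all add: U_def V_def open_basis_seq)
  moreover have "U k \<inter> V k = {}" "emeasure \<mu> (Khull (U k) (V k)) < \<infinity>" for k
    by (auto simp: U_def V_def admissible_def Khull_def case_prod_beta)
  ultimately show ?thesis by (rule that[rotated 4])
qed

theorem mecke_formula_off_diagonal:
  assumes E_dom: "E \<in> sets borel" "E \<subseteq> H \<times> H" and off_diagonal: "\<And>a. (a, a) \<notin> E"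
  shows "mecke_formula E"
proof -
  obtain U V :: "nat \<Rightarrow> 'p set" where rectangles: "\<And>k. open (U k)" "\<And>k. open (V k)" "\<And>k. U k \<inter> V k = {}"
    "\<And>k. emeasure \<mu> (Khull (U k) (V k)) < \<infinity>" and cover: "E \<subseteq> (\<Union>k. U k \<times> V k)"
    using countable_rectangle_cover[OF E_dom(2) off_diagonal] by blast
  define A where "A = (\<lambda>k. E \<inter> disjointed (\<lambda>k. U k \<times> V k) k)"
  have "range (disjointed (\<lambda>k. U k \<times> V k)) \<subseteq> sets borel"
    using rectangles by (intro sets.range_disjointed_sets) (auto intro: borel_open open_Times)
  then have A_borel: "A k \<in> sets borel" for k using E_dom(1) by (auto simp: A_def)
  have "mecke_formula (A k)" for k
  proof -
    have "mecke_formula (A k \<inter> U k \<times> V k)"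
      using rectangles A_borel by (intro mecke_formula_in_rectangle) auto
    moreover have "A k \<subseteq> U k \<times> V k"
      using disjointed_subset[of "\<lambda>k. U k \<times> V k" k] by (auto simp: A_def)
    ultimately show ?thesis by (simp add: Int_absorb2)
  qed
  moreover have "disjoint_family A"
    using disjoint_family_disjointed[of "\<lambda>k. U k \<times> V k"] by (auto simp: A_def disjoint_family_on_def)
  ultimately have "mecke_formula (\<Union>k. A k)" using A_borel by (intro mecke_formula_UN)
  moreover have "(\<Union>k. A k) = E"
    using cover unfolding A_def Int_UN_distrib[symmetric] UN_disjointed_eq by (rule Int_absorb2)
  ultimately show ?thesis by (simp only:)
qed

end

section \<open>Mutual nearest neighbours in the half space\<close>

lemma nn_integral_translated_radial:
  fixes h :: "real \<Rightarrow> ennreal" and x :: "real \<times> real"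
  assumes [measurable]: "h \<in> borel_measurable borel"
  shows "(\<integral>\<^sup>+y. h (dist x y) \<partial>lborel) = ennreal (2 * pi) * (\<integral>\<^sup>+s\<in>{0<..}. h s * s \<partial>lborel)"
proof -
  have "(\<integral>\<^sup>+y. h (dist x y) \<partial>lborel) = (\<integral>\<^sup>+y. h (dist x (x + y)) \<partial>lborel)"
    by (rule nn_integral_lborel_translate[symmetric]) measurable
  then show ?thesis by (simp add: dist_norm nn_integral_radial)
qed

lemma nn_integral_radial_kernel:
  fixes \<nu> :: "real measure" and k :: "real \<Rightarrow> real \<Rightarrow> real \<Rightarrow> ennreal" and A :: "(real \<times> real) set"
  assumes \<nu>: "sigma_finite_measure \<nu>" and sets_\<nu> [measurable_cong]: "sets \<nu> = sets borel"
    and k_meas: "(\<lambda>(s, z, z'). k s z z') \<in> borel_measurable (borel \<Otimes>\<^sub>M borel \<Otimes>\<^sub>M borel)"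
    and [measurable]: "A \<in> sets borel"
  shows "(\<integral>\<^sup>+a. \<integral>\<^sup>+b. indicator A (fst a)
    * k (dist (fst a) (fst b)) (snd a) (snd b) \<partial>(lborel \<Otimes>\<^sub>M \<nu>) \<partial>(lborel \<Otimes>\<^sub>M \<nu>))
    = emeasure lborel A * (\<integral>\<^sup>+z. \<integral>\<^sup>+z'. ennreal (2 * pi) * (\<integral>\<^sup>+s\<in>{0<..}. k s z z' * s \<partial>lborel) \<partial>\<nu> \<partial>\<nu>)"
proof -
  interpret \<nu>: sigma_finite_measure \<nu> by (rule \<nu>)
  interpret P: pair_sigma_finite "lborel :: (real \<times> real) measure" \<nu> ..
  have [measurable (raw)]: "(\<lambda>x. k (a x) (b x) (c x)) \<in> borel_measurable Q"
    if [measurable]: "a \<in> borel_measurable Q" "b \<in> borel_measurable Q" "c \<in> borel_measurable Q"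
    for a b c and Q :: "'q measure"
    using measurable_compose[OF _ k_meas, of "\<lambda>x. (a x, b x, c x)" Q] by simp
  let ?G = "\<lambda>z. \<integral>\<^sup>+z'. ennreal (2 * pi) * (\<integral>\<^sup>+s\<in>{0<..}. k s z z' * s \<partial>lborel) \<partial>\<nu>"
  have "(\<integral>\<^sup>+b. indicator A (fst a) * k (dist (fst a) (fst b)) (snd a) (snd b) \<partial>(lborel \<Otimes>\<^sub>M \<nu>))
    = indicator A (fst a) * ?G (snd a)" for a
  proof -
    have "(\<integral>\<^sup>+b. indicator A (fst a) * k (dist (fst a) (fst b)) (snd a) (snd b) \<partial>(lborel \<Otimes>\<^sub>M \<nu>))
      = indicator A (fst a) * (\<integral>\<^sup>+b. k (dist (fst a) (fst b)) (snd a) (snd b) \<partial>(lborel \<Otimes>\<^sub>M \<nu>))"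
      by (rule nn_integral_cmult) measurable
    also have "(\<integral>\<^sup>+b. k (dist (fst a) (fst b)) (snd a) (snd b) \<partial>(lborel \<Otimes>\<^sub>M \<nu>))
      = (\<integral>\<^sup>+z'. \<integral>\<^sup>+y. k (dist (fst a) y) (snd a) z' \<partial>lborel \<partial>\<nu>)"
      by (subst P.nn_integral_snd[symmetric]) auto
    also have "\<dots> = ?G (snd a)"
      by (intro nn_integral_cong nn_integral_translated_radial) measurable
    finally show ?thesis .
  qed
  then have "(\<integral>\<^sup>+a. \<integral>\<^sup>+b. indicator A (fst a)
    * k (dist (fst a) (fst b)) (snd a) (snd b) \<partial>(lborel \<Otimes>\<^sub>M \<nu>) \<partial>(lborel \<Otimes>\<^sub>M \<nu>))
    = (\<integral>\<^sup>+a. indicator A (fst a) * ?G (snd a) \<partial>(lborel \<Otimes>\<^sub>M \<nu>))" by simp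
  also have "\<dots> = (\<integral>\<^sup>+z. \<integral>\<^sup>+x. indicator A x * ?G z \<partial>lborel \<partial>\<nu>)"
    by (subst P.nn_integral_snd[symmetric]) auto
  also have "\<dots> = (\<integral>\<^sup>+z. emeasure lborel A * ?G z \<partial>\<nu>)"
    by (intro nn_integral_cong) (simp add: nn_integral_multc)
  also have "\<dots> = emeasure lborel A * (\<integral>\<^sup>+z. ?G z \<partial>\<nu>)"
    by (rule nn_integral_cmult) measurable
  finally show ?thesis .
qed

lemma emeasure_count_space_image:
  "inj_on h X \<Longrightarrow> emeasure (count_space UNIV) (h ` X) = emeasure (count_space UNIV) X"
  by (cases "finite X") (auto simp: card_image finite_image_iff emeasure_count_space)

abbreviation count_over :: "pt set \<Rightarrow> (real \<times> real) set \<Rightarrow> ennreal" where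
  "count_over S A \<equiv> emeasure (count_space UNIV) {a \<in> S. fst a \<in> A}"

lemma mean_meas_UN:
  assumes disj: "disjoint_family C"
    and meas: "\<And>i. (\<lambda>\<omega>. count_over (\<Psi> \<omega>) (C i)) \<in> borel_measurable (completion M)"
  shows "mean_meas M \<Psi> (\<Union>i. C i) = (\<Sum>i. mean_meas M \<Psi> (C i))"
proof -
  have "count_over S (\<Union>i. C i) = (\<Sum>i. count_over S (C i))" for S
  proof -
    have "{a \<in> S. fst a \<in> (\<Union>i. C i)} = (\<Union>i. {a \<in> S. fst a \<in> C i})" by auto
    moreover have "disjoint_family (\<lambda>i. {a \<in> S. fst a \<in> C i})"
      using disj by (auto simp: disjoint_family_on_def)
    ultimately show ?thesis by (simp add: suminf_emeasure)
  qed
  then have "mean_meas M \<Psi> (\<Union>i. C i) = (\<integral>\<^sup>+\<omega>. (\<Sum>i. count_over (\<Psi> \<omega>) (C i)) \<partial>completion M)"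
    by (simp add: mean_meas_def nn_integral_completion)
  also have "\<dots> = (\<Sum>i. mean_meas M \<Psi> (C i))"
    by (subst nn_integral_suminf) (simp_all add: meas mean_meas_def nn_integral_completion)
  finally show ?thesis .
qed

lemma count_over_Phi1_add_Phi2: "count_over (Phi1 \<phi> D) A + count_over (Phi2 \<phi> D) A = count_over \<phi> A"
proof -
  have "{a \<in> \<phi>. fst a \<in> A} = {a \<in> Phi1 \<phi> D. fst a \<in> A} \<union> {a \<in> Phi2 \<phi> D. fst a \<in> A}"
    "{a \<in> Phi1 \<phi> D. fst a \<in> A} \<inter> {a \<in> Phi2 \<phi> D. fst a \<in> A} = {}"
    by (auto simp: Phi1_def Phi2_def)
  then show ?thesis by (simp add: plus_emeasure)
qed

lemma mutual_nn_iff_exclusion_region: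
  assumes upper: "\<phi> \<subseteq> {a. 0 < snd a}"
  shows "mutual_nn \<phi> D a b \<longleftrightarrow>
    a \<in> \<phi> \<and> b \<in> \<phi> \<and> a \<noteq> b \<and> (snd a, snd b) \<in> D \<and> \<phi> \<inter> exclusion_region a b \<subseteq> {a, b}"
proof (cases "a \<in> \<phi> \<and> b \<in> \<phi>")
  case True
  have "dH a b < dH a c \<and> dH b a < dH b c \<longleftrightarrow> c \<notin> exclusion_region a b" if "c \<in> \<phi>" for c
  proof -
    have pos: "0 < snd a" "0 < snd b" "0 < snd c" using that upper True by blast+
    show ?thesis
      using dH_less_iff_notin_hball_through[OF pos] dH_less_iff_notin_hball_through[OF pos(2,1,3)]
      by (simp add: exclusion_region_def)
  qed
  then show ?thesis using True unfolding mutual_nn_def nn_to_def by blast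
qed (auto simp: mutual_nn_def nn_to_def)

lemma nn_to_unique: "nn_to \<phi> a b \<Longrightarrow> nn_to \<phi> a c \<Longrightarrow> b = c"
  unfolding nn_to_def by (metis DiffI empty_iff insert_iff less_asym)

locale marked_poisson = mark_density f for f :: "real \<Rightarrow> real" +
  fixes M :: "'w measure" and \<Phi> :: "'w \<Rightarrow> pt set" and lam :: real and D :: "(real \<times> real) set"
  assumes lam_pos: "lam > 0"
    and D_borel: "D \<in> sets (borel :: (real \<times> real) measure)"
    and D_sub: "D \<subseteq> {0<..} \<times> {0<..}"
    and PPP: "poisson_pp M \<Phi> (intensity lam f)"
begin

abbreviation \<mu> :: "pt measure" where "\<mu> \<equiv> intensity lam f"

lemma intensity_eq: "\<mu> = scale_measure (ennreal lam) (marked_lborel f)"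
  by (simp add: intensity_def marked_lborel_def)

lemma sets_intensity [measurable_cong]: "sets \<mu> = sets borel"
  by (simp add: intensity_eq)

lemma marked_lborel_eq_pair: "marked_lborel f = lborel \<Otimes>\<^sub>M mark_measure f"
  by (simp add: marked_lborel_def lborel_prod)

lemma nn_integral_intensity:
  "h \<in> borel_measurable (lborel \<Otimes>\<^sub>M mark_measure f) \<Longrightarrow>
    (\<integral>\<^sup>+a. h a \<partial>\<mu>) = ennreal lam * (\<integral>\<^sup>+a. h a \<partial>(lborel \<Otimes>\<^sub>M mark_measure f))"
  by (simp only: intensity_eq marked_lborel_eq_pair nn_integral_scale_measure)

lemma emeasure_intensity_cylinder:
  "A \<in> sets borel \<Longrightarrow> emeasure \<mu> (A \<times> UNIV) = ennreal lam * emeasure lborel A"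
  by (simp add: intensity_eq emeasure_marked_lborel_cylinder)

lemma sigma_finite_intensity: "sigma_finite_measure \<mu>"
proof -
  interpret P: pair_sigma_finite "lborel :: (real \<times> real) measure" "mark_measure f" ..
  obtain A where "countable A" "A \<subseteq> sets (marked_lborel f)" "\<Union>A = space (marked_lborel f)"
      "\<forall>a\<in>A. emeasure (marked_lborel f) a \<noteq> \<infinity>"
    using P.sigma_finite_countable by (auto simp: marked_lborel_eq_pair)
  then show ?thesis
    by (intro sigma_finite_measure.intro exI[of _ A])
      (auto simp: intensity_eq space_scale_measure ennreal_mult_eq_top_iff)
qed

sublocale isolated_pairs M \<Phi> \<mu> exclusion_region "{a. 0 < snd a}"
proof (intro isolated_pairs.intro poisson_process.intro isolated_pairs_axioms.intro)
  show "poisson_pp M \<Phi> \<mu>" by (rule PPP)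
  show "sets \<mu> = sets borel" by (rule sets_intensity)
  show "sigma_finite_measure \<mu>" by (rule sigma_finite_intensity)
  show "closed {(a, b, c). c \<in> exclusion_region a b}" by (rule closed_exclusion_region_graph)
  show "a \<in> exclusion_region a b" "b \<in> exclusion_region a b" for a b
    by (rule exclusion_region_left exclusion_region_right)+
  fix a b :: pt assume "a \<in> {a. 0 < snd a}" "b \<in> {a. 0 < snd a}"
  then obtain X Y R where nhds: "open X" "open Y" "a \<in> X" "b \<in> Y"
    and sub: "(\<Union>a'\<in>X. \<Union>b'\<in>Y. exclusion_region a' b') \<subseteq> cball (fst a) R \<times> UNIV"
    using exclusion_region_locally_bounded[of a b] by auto
  have "closure (\<Union>a'\<in>X. \<Union>b'\<in>Y. exclusion_region a' b') \<subseteq> cball (fst a) R \<times> UNIV"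
    using sub by (intro closure_minimal closed_Times) auto
  then have "emeasure (marked_lborel f) (closure (\<Union>a'\<in>X. \<Union>b'\<in>Y. exclusion_region a' b')) < \<infinity>"
    by (rule emeasure_marked_lborel_finite)
  then have "emeasure \<mu> (closure (\<Union>a'\<in>X. \<Union>b'\<in>Y. exclusion_region a' b')) < \<infinity>"
    by (simp add: intensity_eq ennreal_mult_less_top)
  then show "\<exists>X Y. open X \<and> open Y \<and> a \<in> X \<and> b \<in> Y \<and>
      emeasure \<mu> (closure (\<Union>a'\<in>X. \<Union>b'\<in>Y. exclusion_region a' b')) < \<infinity>" using nhds by blast
qed

lemma AE_points_upper: "AE \<omega> in M. \<Phi> \<omega> \<subseteq> {a. 0 < snd a}"
proof -
  have lower_borel: "{a :: pt. snd a \<le> 0} \<in> sets borel"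
    by (intro borel_closed closed_Collect_le continuous_intros)
  have "emeasure (marked_lborel f) {a. snd a \<le> 0}
    = (\<integral>\<^sup>+a\<in>{a. snd a \<le> 0}. mark_weight (snd a) \<partial>(lborel :: pt measure))"
    using lower_borel by (simp add: marked_lborel_eq_density emeasure_density)
  also have "\<dots> = (\<integral>\<^sup>+a. 0 \<partial>(lborel :: pt measure))"
    by (intro nn_integral_cong) (auto simp: mark_weight_def indicator_def)
  finally have "emeasure (marked_lborel f) {a. snd a \<le> 0} = 0" by simp
  then have "{a. snd a \<le> 0} \<in> null_sets \<mu>" using lower_borel by (auto simp: intensity_eq)
  from AE_no_points_in_null_set[OF this] show ?thesis
    by eventually_elim (auto simp: not_less[symmetric])
qed

definition pairs_over :: "(real \<times> real) set \<Rightarrow> (pt \<times> pt) set" where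
  "pairs_over A = {p. fst (fst p) \<in> A \<and> (snd (fst p), snd (snd p)) \<in> D \<and> fst p \<noteq> snd p}"

lemma pairs_over_borel:
  assumes A_borel: "A \<in> sets borel"
  shows "pairs_over A \<in> sets borel"
proof -
  have "(\<lambda>p :: pt \<times> pt. fst (fst p)) -` A \<inter> space borel \<in> sets borel"
    by (rule measurable_sets[OF borel_measurable_continuous_onI A_borel]) (intro continuous_intros)
  moreover have "(\<lambda>p :: pt \<times> pt. (snd (fst p), snd (snd p))) -` D \<inter> space borel \<in> sets borel"
    by (rule measurable_sets[OF borel_measurable_continuous_onI D_borel]) (intro continuous_intros)
  moreover have "{p :: pt \<times> pt. fst p \<noteq> snd p} \<in> sets borel"
    by (intro borel_open open_Collect_neq continuous_intros)
  moreover have "pairs_over A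
    = (\<lambda>p. fst (fst p)) -` A \<inter> (\<lambda>p. (snd (fst p), snd (snd p))) -` D \<inter> {p. fst p \<noteq> snd p}"
    by (auto simp: pairs_over_def)
  ultimately show ?thesis by simp
qed

lemma count_over_Phi2:
  assumes upper: "\<Phi> \<omega> \<subseteq> {a. 0 < snd a}"
  shows "count_over (Phi2 (\<Phi> \<omega>) D) A = npairs (pairs_over A) \<omega>"
proof -
  define L where "L = pairs_over A \<inter> isolated \<omega>"
  have mem_L: "(a, b) \<in> L \<longleftrightarrow> mutual_nn (\<Phi> \<omega>) D a b \<and> fst a \<in> A" for a b
    by (simp add: L_def pairs_over_def isolated_def mutual_nn_iff_exclusion_region[OF upper] conj_ac)
  have "fst ` L = {a. \<exists>b. (a, b) \<in> L}" by force
  also have "\<dots> = {a \<in> Phi2 (\<Phi> \<omega>) D. fst a \<in> A}"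
    unfolding mem_L Phi2_def mutual_nn_def nn_to_def by blast
  finally have "fst ` L = {a \<in> Phi2 (\<Phi> \<omega>) D. fst a \<in> A}" .
  moreover have "inj_on fst L"
  proof (rule inj_onI)
    fix p p' assume "p \<in> L" "p' \<in> L" "fst p = fst p'"
    then obtain a b b' where p_eq: "p = (a, b)" "p' = (a, b')" and "(a, b) \<in> L" "(a, b') \<in> L"
      by (cases p, cases p') simp
    then have "nn_to (\<Phi> \<omega>) a b" "nn_to (\<Phi> \<omega>) a b'" unfolding mem_L by (simp_all add: mutual_nn_def)
    then show "p = p'" using p_eq nn_to_unique by simp
  qed
  ultimately show ?thesis
    by (simp add: npairs_def flip: L_def emeasure_count_space_image)
qed

lemma mecke_formula_pairs_over:
  assumes "A \<in> sets borel"
  shows "mecke_formula (pairs_over A)"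
proof (rule mecke_formula_off_diagonal[OF pairs_over_borel[OF assms]])
  show "pairs_over A \<subseteq> {a. 0 < snd a} \<times> {a. 0 < snd a}" using D_sub by (auto simp: pairs_over_def)
qed (simp add: pairs_over_def)

definition void_kernel :: "real \<Rightarrow> real \<Rightarrow> real \<Rightarrow> ennreal" where
  "void_kernel s z z' = indicator D (z, z') * void_prob (exclusion_region ((0, 0), z) ((s, 0), z'))"

lemma void_kernel_measurable: "(\<lambda>(s, z, z'). void_kernel s z z')
  \<in> borel_measurable (borel \<Otimes>\<^sub>M borel \<Otimes>\<^sub>M borel)"
proof -
  have [measurable]: "D \<in> sets (borel \<Otimes>\<^sub>M borel)" using D_borel unfolding borel_prod .
  have "(\<lambda>q. (((0, 0), fst (snd q)), ((fst q, 0), snd (snd q))) :: pt \<times> pt)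
    \<in> borel_measurable (borel \<Otimes>\<^sub>M borel \<Otimes>\<^sub>M borel)"
    by (intro borel_measurable_Pair) measurable
  from measurable_compose[OF this void_prob_K_measurable]
  have [measurable]: "(\<lambda>q. void_prob (exclusion_region ((0, 0), fst (snd q)) ((fst q, 0), snd (snd q))))
    \<in> borel_measurable (borel \<Otimes>\<^sub>M borel \<Otimes>\<^sub>M borel)"
    by simp
  show ?thesis unfolding void_kernel_def case_prod_beta' by measurable
qed

lemma measurable_void_kernel [measurable (raw)]:
  assumes [measurable]: "a \<in> borel_measurable Q" "b \<in> borel_measurable Q" "c \<in> borel_measurable Q"
  shows "(\<lambda>x. void_kernel (a x) (b x) (c x)) \<in> borel_measurable Q"
  using measurable_compose[OF _ void_kernel_measurable, of "\<lambda>x. (a x, b x, c x)" Q] by simp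

lemma void_prob_exclusion_region:
  assumes "0 < snd a" "0 < snd b" "a \<noteq> b"
  shows "void_prob (exclusion_region a b)
    = ennreal (exp (- lam * Fun_F f (dist (fst a) (fst b)) (snd a) (snd b)))"
proof -
  have "measure \<mu> (exclusion_region a b) = lam * measure (marked_lborel f) (exclusion_region a b)"
    using lam_pos by (simp add: intensity_eq measure_scale_measure)
  then show ?thesis by (simp add: void_prob_def measure_exclusion_region[OF assms])
qed

lemma void_kernel_eq:
  assumes "fst a \<noteq> fst b"
  shows "void_kernel (dist (fst a) (fst b)) (snd a) (snd b)
    = indicator D (snd a, snd b) * void_prob (exclusion_region a b)"
proof (cases "(snd a, snd b) \<in> D")
  case True
  then have "0 < snd a" "0 < snd b" using D_sub by auto
  moreover have "a \<noteq> b" "0 < dist (fst a) (fst b)" using assms by auto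
  ultimately show ?thesis
    using True by (simp add: void_kernel_def void_prob_exclusion_region dist_Pair_Pair)
qed (simp add: void_kernel_def)

lemma void_kernel_eq_exp:
  assumes "0 < s"
  shows "void_kernel s z z' = ennreal (exp (- lam * Fun_F f s z z') * indicator D (z, z'))"
proof (cases "(z, z') \<in> D")
  case True
  then have "0 < z" "0 < z'" using D_sub by auto
  then show ?thesis
    using True assms by (simp add: void_kernel_def void_prob_exclusion_region dist_Pair_Pair)
qed (simp add: void_kernel_def)

lemma P_D_eq:
  "P_D D lam f = ennreal lam
    * (\<integral>\<^sup>+z. \<integral>\<^sup>+z'. ennreal (2 * pi)
      * (\<integral>\<^sup>+s\<in>{0<..}. void_kernel s z z' * s \<partial>lborel) \<partial>mark_measure f \<partial>mark_measure f)"
proof -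
  let ?m = "mark_measure f \<Otimes>\<^sub>M mark_measure f"
  interpret mm: pair_sigma_finite "mark_measure f" "mark_measure f" ..
  interpret smm: pair_sigma_finite "lborel :: real measure" ?m ..
  have "(\<integral>\<^sup>+s. (\<integral>\<^sup>+zz. ennreal (exp (- lam * Fun_F f s (fst zz) (snd zz)) * indicator D zz) \<partial>?m)
    * ennreal s \<partial>restrict_space lborel {0<..})
    = (\<integral>\<^sup>+s\<in>{0<..}. (\<integral>\<^sup>+zz. ennreal (exp (- lam * Fun_F f s (fst zz) (snd zz)) * indicator D zz) \<partial>?m)
      * ennreal s \<partial>lborel)"
    by (rule nn_integral_restrict_space) simp
  also have "\<dots> = (\<integral>\<^sup>+s\<in>{0<..}. (\<integral>\<^sup>+zz. void_kernel s (fst zz) (snd zz) \<partial>?m) * ennreal s \<partial>lborel)"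
    by (intro nn_integral_cong) (auto simp: indicator_def void_kernel_eq_exp)
  also have "\<dots> = (\<integral>\<^sup>+s. \<integral>\<^sup>+zz. void_kernel s (fst zz) (snd zz) * s * indicator {0<..} s \<partial>?m \<partial>lborel)"
    by (simp add: nn_integral_multc)
  also have "\<dots> = (\<integral>\<^sup>+zz. (\<integral>\<^sup>+s\<in>{0<..}. void_kernel s (fst zz) (snd zz) * s \<partial>lborel) \<partial>?m)"
    by (rule smm.Fubini'[symmetric]) measurable
  finally have "P_D D lam f
    = ennreal lam * (ennreal (2 * pi)
      * (\<integral>\<^sup>+zz. (\<integral>\<^sup>+s\<in>{0<..}. void_kernel s (fst zz) (snd zz) * s \<partial>lborel) \<partial>?m))"
    using lam_pos by (simp add: P_D_def ennreal_mult mult_ac)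
  also have "ennreal (2 * pi) * (\<integral>\<^sup>+zz. (\<integral>\<^sup>+s\<in>{0<..}. void_kernel s (fst zz) (snd zz) * s \<partial>lborel) \<partial>?m)
    = (\<integral>\<^sup>+zz. ennreal (2 * pi) * (\<integral>\<^sup>+s\<in>{0<..}. void_kernel s (fst zz) (snd zz) * s \<partial>lborel) \<partial>?m)"
    by (rule nn_integral_cmult[symmetric]) measurable
  also have "\<dots> = (\<integral>\<^sup>+z. \<integral>\<^sup>+z'. ennreal (2 * pi)
    * (\<integral>\<^sup>+s\<in>{0<..}. void_kernel s z z' * s \<partial>lborel) \<partial>mark_measure f \<partial>mark_measure f)"
    by (subst mark.nn_integral_fst[symmetric]) auto
  finally show ?thesis .
qed

lemma nn_integral_pairs_over:
  assumes A_borel [measurable]: "A \<in> sets borel"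
  shows "(\<integral>\<^sup>+p\<in>pairs_over A. void_prob (exclusion_region (fst p) (snd p)) \<partial>(\<mu> \<Otimes>\<^sub>M \<mu>))
    = P_D D lam f * ennreal lam * emeasure lborel A"
proof -
  interpret P: pair_sigma_finite "lborel :: (real \<times> real) measure" "mark_measure f" ..
  let ?h = "\<lambda>p. void_prob (exclusion_region (fst p) (snd p)) * indicator (pairs_over A) p"
  let ?g = "\<lambda>a b. indicator A (fst a) * void_kernel (dist (fst a) (fst b)) (snd a) (snd b)"
  let ?N = "(lborel :: (real \<times> real) measure) \<Otimes>\<^sub>M mark_measure f"
  have h_borel: "?h \<in> borel_measurable borel"
    by (intro borel_measurable_times_ennreal void_prob_K_measurable borel_measurable_indicator
      pairs_over_borel A_borel)
  have sets_N: "sets ?N = sets borel" by (fold marked_lborel_eq_pair) simp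
  have h_section: "(\<lambda>b. ?h (a, b)) \<in> borel_measurable ?N" for a
    by (intro measurable_compose[OF _ h_borel]) (simp add: measurable_cong_sets[OF sets_N refl])
  have inner: "(\<integral>\<^sup>+b. ?h (a, b) \<partial>\<mu>) = ennreal lam * (\<integral>\<^sup>+b. ?g a b \<partial>?N)" for a
  proof -
    have "AE y in lborel. AE z in mark_measure f. fst (y, z) \<noteq> fst a"
      using AE_lborel_singleton[of "fst a"] by eventually_elim simp
    then have "AE b in ?N. fst b \<noteq> fst a" by (intro P.AE_pair_measure) measurable
    then have "(\<integral>\<^sup>+b. ?h (a, b) \<partial>?N) = (\<integral>\<^sup>+b. ?g a b \<partial>?N)"
      by (intro nn_integral_cong_AE, eventually_elim)
        (auto simp: void_kernel_eq pairs_over_def indicator_def)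
    then show ?thesis by (simp only: nn_integral_intensity[OF h_section])
  qed
  have "(\<integral>\<^sup>+p. ?h p \<partial>(\<mu> \<Otimes>\<^sub>M \<mu>)) = (\<integral>\<^sup>+a. \<integral>\<^sup>+b. ?h (a, b) \<partial>\<mu> \<partial>\<mu>)"
    using h_borel by (intro mu.nn_integral_fst[symmetric])
      (simp add: measurable_cong_sets[OF sets_mu_pair refl])
  also have "\<dots> = ennreal lam * (\<integral>\<^sup>+a. ennreal lam * (\<integral>\<^sup>+b. ?g a b \<partial>?N) \<partial>?N)"
    unfolding inner by (rule nn_integral_intensity) measurable
  also have "\<dots> = ennreal lam * (ennreal lam * (\<integral>\<^sup>+a. \<integral>\<^sup>+b. ?g a b \<partial>?N \<partial>?N))"
    by (subst nn_integral_cmult) measurable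
  also have "(\<integral>\<^sup>+a. \<integral>\<^sup>+b. ?g a b \<partial>?N \<partial>?N)
    = emeasure lborel A
      * (\<integral>\<^sup>+z. \<integral>\<^sup>+z'. ennreal (2 * pi)
        * (\<integral>\<^sup>+s\<in>{0<..}. void_kernel s z z' * s \<partial>lborel) \<partial>mark_measure f \<partial>mark_measure f)"
    by (rule nn_integral_radial_kernel[OF mark.sigma_finite_measure_axioms sets_mark_measure
      void_kernel_measurable A_borel])
  finally show ?thesis by (simp add: P_D_eq mult_ac)
qed

lemma
  assumes A_borel: "A \<in> sets borel"
  shows count_over_Phi2_measurable: "(\<lambda>\<omega>. count_over (Phi2 (\<Phi> \<omega>) D) A) \<in> borel_measurable (completion M)"
    and mean_meas_Phi2: "mean_meas M (\<lambda>\<omega>. Phi2 (\<Phi> \<omega>) D) A = P_D D lam f * ennreal lam * emeasure lborel A"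
proof -
  have AE_npairs: "AE \<omega> in M. npairs (pairs_over A) \<omega> = count_over (Phi2 (\<Phi> \<omega>) D) A"
    using AE_points_upper by eventually_elim (simp add: count_over_Phi2)
  show "(\<lambda>\<omega>. count_over (Phi2 (\<Phi> \<omega>) D) A) \<in> borel_measurable (completion M)"
    using mecke_formula_pairs_over[OF A_borel]
    by (intro borel_measurable_completion_AE[OF _ AE_npairs]) (simp add: mecke_formula_def)
  have "mean_meas M (\<lambda>\<omega>. Phi2 (\<Phi> \<omega>) D) A = (\<integral>\<^sup>+\<omega>. npairs (pairs_over A) \<omega> \<partial>M)"
    unfolding mean_meas_def by (rule nn_integral_cong_AE) (use AE_npairs in eventually_elim, simp)
  also have "\<dots> = P_D D lam f * ennreal lam * emeasure lborel A"
    using mecke_formula_pairs_over[OF A_borel]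
    by (simp add: mecke_formula_def nn_integral_pairs_over[OF A_borel])
  finally show "mean_meas M (\<lambda>\<omega>. Phi2 (\<Phi> \<omega>) D) A = P_D D lam f * ennreal lam * emeasure lborel A" .
qed

context
  fixes A :: "(real \<times> real) set"
  assumes A_finite: "A \<in> sets borel" "emeasure lborel A < \<infinity>"
begin

lemma emeasure_cylinder_finite: "A \<times> UNIV \<in> sets \<mu>" "emeasure \<mu> (A \<times> UNIV) < \<infinity>"
  using A_finite
  by (simp_all add: sets_intensity borel_prod[symmetric] emeasure_intensity_cylinder ennreal_mult_less_top)

lemma points_over_eq_cylinder: "{a \<in> \<phi>. fst a \<in> A} = \<phi> \<inter> A \<times> (UNIV :: real set)"
  by auto

lemma mean_meas_Phi: "mean_meas M \<Phi> A = ennreal lam * emeasure lborel A"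
  unfolding mean_meas_def points_over_eq_cylinder nn_integral_count_points[OF emeasure_cylinder_finite]
  by (rule emeasure_intensity_cylinder[OF A_finite(1)])

lemma AE_count_over_Phi1:
  "AE \<omega> in M. count_over (\<Phi> \<omega>) A - count_over (Phi2 (\<Phi> \<omega>) D) A = count_over (Phi1 (\<Phi> \<omega>) D) A"
  using AE_finite_points[OF emeasure_cylinder_finite]
proof eventually_elim
  case (elim \<omega>)
  have "{a \<in> Phi2 (\<Phi> \<omega>) D. fst a \<in> A} \<subseteq> \<Phi> \<omega> \<inter> A \<times> UNIV" by (auto simp: Phi2_def)
  then have "finite {a \<in> Phi2 (\<Phi> \<omega>) D. fst a \<in> A}" using elim by (rule finite_subset)
  then show ?case
    by (simp flip: count_over_Phi1_add_Phi2[of "\<Phi> \<omega>" D A])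
qed

lemma count_over_Phi1_measurable: "(\<lambda>\<omega>. count_over (Phi1 (\<Phi> \<omega>) D) A) \<in> borel_measurable (completion M)"
  using count_points_measurable[OF emeasure_cylinder_finite] count_over_Phi2_measurable[OF A_finite(1)]
  by (intro borel_measurable_completion_AE[OF _ AE_count_over_Phi1] borel_measurable_minus_ennreal)
    (simp_all add: points_over_eq_cylinder)

lemma mean_meas_Phi1_add_Phi2:
  "mean_meas M (\<lambda>\<omega>. Phi1 (\<Phi> \<omega>) D) A + mean_meas M (\<lambda>\<omega>. Phi2 (\<Phi> \<omega>) D) A = ennreal lam * emeasure lborel A"
proof -
  have "mean_meas M (\<lambda>\<omega>. Phi1 (\<Phi> \<omega>) D) A + mean_meas M (\<lambda>\<omega>. Phi2 (\<Phi> \<omega>) D) A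
    = (\<integral>\<^sup>+\<omega>. count_over (Phi1 (\<Phi> \<omega>) D) A + count_over (Phi2 (\<Phi> \<omega>) D) A \<partial>completion M)"
    by (subst nn_integral_add)
      (simp_all add: count_over_Phi1_measurable count_over_Phi2_measurable[OF A_finite(1)] mean_meas_def
        nn_integral_completion)
  also have "\<dots> = mean_meas M \<Phi> A"
    unfolding count_over_Phi1_add_Phi2 by (simp add: mean_meas_def nn_integral_completion)
  finally show ?thesis by (simp only: mean_meas_Phi)
qed

end

lemma P_D_le_1: "P_D D lam f \<le> 1"
proof -
  let ?A = "cbox (0, 0) (1, 1) :: (real \<times> real) set"
  have unit_square: "?A \<in> sets borel" "emeasure lborel ?A = 1"
    by (simp, subst emeasure_lborel_cbox_eq) (auto simp: Basis_prod_def inner_prod_def)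
  have "ennreal lam * P_D D lam f = mean_meas M (\<lambda>\<omega>. Phi2 (\<Phi> \<omega>) D) ?A"
    by (simp add: mean_meas_Phi2[OF unit_square(1)] unit_square(2) mult.commute)
  also have "\<dots> \<le> mean_meas M (\<lambda>\<omega>. Phi1 (\<Phi> \<omega>) D) ?A + mean_meas M (\<lambda>\<omega>. Phi2 (\<Phi> \<omega>) D) ?A"
    by simp
  also have "\<dots> = ennreal lam * 1"
    using mean_meas_Phi1_add_Phi2[of ?A] unit_square by simp
  finally show ?thesis using lam_pos by (subst (asm) ennreal_mult_le_mult_iff) auto
qed

lemma mean_meas_Phi1_finite:
  assumes A_borel: "A \<in> sets borel" and fin: "emeasure lborel A < \<infinity>"
  shows "mean_meas M (\<lambda>\<omega>. Phi1 (\<Phi> \<omega>) D) A = (1 - P_D D lam f) * ennreal lam * emeasure lborel A"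
proof -
  let ?m = "ennreal lam * emeasure lborel A"
  have "P_D D lam f < \<infinity>" by (rule le_less_trans[OF P_D_le_1]) simp
  then have P_fin: "?m * P_D D lam f \<noteq> \<top>" and m_fin: "?m \<noteq> \<top>"
    using fin by (auto simp: ennreal_mult_eq_top_iff)
  have "mean_meas M (\<lambda>\<omega>. Phi1 (\<Phi> \<omega>) D) A + ?m * P_D D lam f = ?m * 1"
    using mean_meas_Phi1_add_Phi2[OF A_borel fin] by (simp add: mean_meas_Phi2[OF A_borel] mult_ac)
  then have "mean_meas M (\<lambda>\<omega>. Phi1 (\<Phi> \<omega>) D) A = ?m * 1 - ?m * P_D D lam f"
    using P_fin by (metis ennreal_add_diff_cancel_right)
  also have "\<dots> = (1 - P_D D lam f) * ennreal lam * emeasure lborel A"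
    using m_fin by (subst ennreal_right_diff_distrib[symmetric]) (simp_all add: mult_ac)
  finally show ?thesis .
qed

lemma mean_meas_Phi1:
  assumes A_borel: "A \<in> sets borel"
  shows "mean_meas M (\<lambda>\<omega>. Phi1 (\<Phi> \<omega>) D) A = (1 - P_D D lam f) * ennreal lam * emeasure lborel A"
proof -
  obtain B :: "nat \<Rightarrow> (real \<times> real) set" where B_partition: "range B \<subseteq> sets lborel"
    "(\<Union>i. B i) = space lborel"
    "\<And>i. emeasure lborel (B i) \<noteq> \<infinity>" "disjoint_family B"
    by (rule lborel.sigma_finite_disjoint) blast
  define C where "C = (\<lambda>i. A \<inter> B i)"
  have C_borel: "C i \<in> sets borel" for i using A_borel B_partition(1) by (auto simp: C_def)
  have C_fin: "emeasure lborel (C i) < \<infinity>" for i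
  proof -
    have "emeasure lborel (C i) \<le> emeasure lborel (B i)"
      using B_partition(1) by (intro emeasure_mono) (auto simp: C_def)
    also have "\<dots> < \<infinity>" using B_partition(3)[of i] by (simp add: less_top)
    finally show ?thesis .
  qed
  have disj: "disjoint_family C" using B_partition(4) by (auto simp: disjoint_family_on_def C_def)
  have A_eq: "A = (\<Union>i. C i)" using B_partition(2) by (auto simp: C_def)
  have "mean_meas M (\<lambda>\<omega>. Phi1 (\<Phi> \<omega>) D) A = (\<Sum>i. mean_meas M (\<lambda>\<omega>. Phi1 (\<Phi> \<omega>) D) (C i))"
    unfolding A_eq using disj count_over_Phi1_measurable[OF C_borel C_fin] by (rule mean_meas_UN)
  also have "\<dots> = (1 - P_D D lam f) * ennreal lam * (\<Sum>i. emeasure lborel (C i))"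
    by (simp add: mean_meas_Phi1_finite[OF C_borel C_fin])
  also have "(\<Sum>i. emeasure lborel (C i)) = emeasure lborel A"
    unfolding A_eq using C_borel disj by (intro suminf_emeasure) auto
  finally show ?thesis .
qed

end

theorem theorem3:
  fixes M :: "'w measure" and \<Phi> :: "'w \<Rightarrow> pt set"
    and lam :: real and f :: "real \<Rightarrow> real" and D :: "(real \<times> real) set"
  assumes lam_pos: "lam > 0"
    and f_meas: "f \<in> borel_measurable borel"
    and f_nonneg: "\<And>z. z > 0 \<Longrightarrow> f z \<ge> 0"
    and f_prob: "(\<integral>\<^sup>+ z. ennreal (f z * indicator {0<..} z) \<partial>lborel) = 1"
    and D_borel: "D \<in> sets (borel :: (real \<times> real) measure)"
    and D_sub: "D \<subseteq> {0<..} \<times> {0<..}"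
    and D_sym: "\<And>z z'. (z, z') \<in> D \<Longrightarrow> (z', z) \<in> D"
    and PPP: "poisson_pp M \<Phi> (intensity lam f)"
  shows "P_D D lam f \<le> 1 \<and>
    (\<forall>A \<in> sets (borel :: (real \<times> real) measure).
       mean_meas M (\<lambda>\<omega>. Phi2 (\<Phi> \<omega>) D) A = P_D D lam f * ennreal lam * emeasure lborel A \<and>
       mean_meas M (\<lambda>\<omega>. Phi1 (\<Phi> \<omega>) D) A = (1 - P_D D lam f) * ennreal lam * emeasure lborel A)"
proof -
  interpret marked_poisson f M \<Phi> lam D
    by unfold_locales (rule f_meas f_nonneg f_prob lam_pos D_borel D_sub PPP | assumption)+
  show ?thesis
    using P_D_le_1 mean_meas_Phi2 mean_meas_Phi1 by blast
qed

end
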